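(* Let $G\subset\mathbb{C}$ be a bounded quasidisk with boundary $L=\partial G$, let $z_1,\ldots,z_m\in L$ be distinct points, let $\alpha_1,\ldots,\alpha_m>-2$, let $h$ be the weight function $h(z)=h_0(z)\prod_{j=1}^m|z-z_j|^{\alpha_j}$ for $z\in G$, $h(z)=0$ for $z\in\mathbb{C}\setminus G$, where $h_0$ is measurable and $C_h^{-1}\le h_0\le C_h$ on $G$ for some constant $C_h\ge 1$, and let $\nu$ be the generalized Jacobi measure $d\nu=h\,dm$. Let $1\le p<\infty$. Then there exists a constant $C=C(G,h,p)\ge 1$ such that for all $n\in\mathbb{N}=\{1,2,\ldots\}$ and all $z\in L$, $$C^{-1}\le\lambda_n(\nu,p,z)\,\rho_{1/n}(z)^{-2}\prod_{j=1}^m\bigl(|z-z_j|+\rho_{1/n}(z)\bigr)^{-\alpha_j}\le C .$$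
   Context: A bounded quasidisk is a bounded Jordan domain $G\subset\mathbb{C}$ whose boundary $L=\partial G$ is a quasiconformal curve, i.e. there is a constant $C_L\ge1$ such that for every pair of different points $\zeta_1,\zeta_2\in L$, $\min(\operatorname{diam}L',\operatorname{diam}L'')\le C_L|\zeta_1-\zeta_2|$, where $L',L''$ are the two connected components of $L\setminus\{\zeta_1,\zeta_2\}$. $dm$ denotes two-dimensional Lebesgue measure in the plane. Let $\mathbb{P}_n$ be the set of complex polynomials of degree at most $n$. For a finite Borel measure $\nu$ on $\mathbb{C}$ with compact infinite support and $1\le p<\infty$, the $n$-th Christoffel function is $$\lambda_n(\nu,p,z):=\inf_{p_n\in\mathbb{P}_n,\ p_n(z)=1}\int|p_n|^p\,d\nu,\quad z\in\mathbb{C}.$$ Let $\overline{\mathbb{C}}=\mathbb{C}\cup\{\infty\}$, $\Omega:=\overline{\mathbb{C}}\setminus\overline{G}$, and let $\Phi$ be the Riemann mapping function of $\Omega$ onto the exterior of the closed unit disk in $\overline{\mathbb{C}}$ normalized by $\Phi(\infty)=\infty$ and $\lim_{z\to\infty}\Phi(z)/z>0$. For $\delta>0$ and $z\in L$ put $L_\delta:=\{\zeta\in\Omega:|\Phi(\zeta)|=1+\delta\}$ and $\rho_\delta(z):=\operatorname{dist}(z,L_\delta)=\inf_{\zeta\in L_\delta}|z-\zeta|$. *)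

theory Defs
  imports "HOL-Complex_Analysis.Complex_Analysis" "HOL-Computational_Algebra.Polynomial"
begin

definition bounded_jordan_domain :: "complex set \<Rightarrow> bool" where
  "bounded_jordan_domain G \<longleftrightarrow>
     (\<exists>\<gamma>. simple_path \<gamma> \<and> pathfinish \<gamma> = pathstart \<gamma> \<and> G = inside (path_image \<gamma>))"

definition quasiconformal_curve :: "complex set \<Rightarrow> bool" where
  "quasiconformal_curve L \<longleftrightarrow>
     (\<exists>C\<ge>1. \<forall>\<zeta>1\<in>L. \<forall>\<zeta>2\<in>L. \<zeta>1 \<noteq> \<zeta>2 \<longrightarrow>
        (\<exists>L' L''. L' \<noteq> L'' \<and> components (L - {\<zeta>1, \<zeta>2}) = {L', L''} \<and>
           min (diameter L') (diameter L'') \<le> C * norm (\<zeta>1 - \<zeta>2)))"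

definition bounded_quasidisk :: "complex set \<Rightarrow> bool" where
  "bounded_quasidisk G \<longleftrightarrow> bounded_jordan_domain G \<and> quasiconformal_curve (frontier G)"

text \<open>
  The normalized Riemann map of the exterior domain in the extended plane onto the exterior of
  the closed unit disk, given by its values at finite points. The value infinity at infinity is
  expressed by the limit of \<open>\<Phi>\<close> there; conformality at infinity is contained in the limit of
  \<open>\<Phi> z / z\<close> being finite and nonzero.
\<close>
definition exterior_riemann_map :: "complex set \<Rightarrow> (complex \<Rightarrow> complex) \<Rightarrow> bool" where
  "exterior_riemann_map G \<Phi> \<longleftrightarrow>
     \<Phi> holomorphic_on (- closure G) \<and>
     bij_betw \<Phi> (- closure G) {w. norm w > 1} \<and>
     filterlim \<Phi> at_infinity at_infinity \<and>
     (\<exists>c::real. c > 0 \<and> ((\<lambda>z. \<Phi> z / z) \<longlongrightarrow> complex_of_real c) at_infinity)"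

definition level_line :: "complex set \<Rightarrow> (complex \<Rightarrow> complex) \<Rightarrow> real \<Rightarrow> complex set" where
  "level_line G \<Phi> \<delta> = {\<zeta> \<in> - closure G. norm (\<Phi> \<zeta>) = 1 + \<delta>}"

definition rho :: "complex set \<Rightarrow> (complex \<Rightarrow> complex) \<Rightarrow> real \<Rightarrow> complex \<Rightarrow> real" where
  "rho G \<Phi> \<delta> z = infdist z (level_line G \<Phi> \<delta>)"

text \<open>
  For a finite measure of compact support, the case of interest, the integrands below are
  integrable, so the default value of the integral for non-integrable functions plays no role.
\<close>
definition christoffel :: "complex measure \<Rightarrow> nat \<Rightarrow> real \<Rightarrow> complex \<Rightarrow> real" where
  "christoffel \<nu> n p z =
     (INF q \<in> {q :: complex poly. degree q \<le> n \<and> poly q z = 1}.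
        (LINT w|\<nu>. norm (poly q w) powr p))"

definition jacobi_weight ::
    "complex set \<Rightarrow> (complex \<Rightarrow> real) \<Rightarrow> nat \<Rightarrow> (nat \<Rightarrow> complex) \<Rightarrow> (nat \<Rightarrow> real) \<Rightarrow> complex \<Rightarrow> real" where
  "jacobi_weight G h\<^sub>0 m zs \<alpha> z =
     (if z \<in> G then h\<^sub>0 z * (\<Prod>j=1..m. norm (z - zs j) powr \<alpha> j) else 0)"

text \<open>
  The density is taken with respect to the completed measure so that \<open>h\<^sub>0\<close> need only be Lebesgue
  measurable.
\<close>
definition jacobi_measure ::
    "complex set \<Rightarrow> (complex \<Rightarrow> real) \<Rightarrow> nat \<Rightarrow> (nat \<Rightarrow> complex) \<Rightarrow> (nat \<Rightarrow> real) \<Rightarrow> complex measure" where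
  "jacobi_measure G h\<^sub>0 m zs \<alpha> = density lebesgue (\<lambda>z. ennreal (jacobi_weight G h\<^sub>0 m zs \<alpha> z))"

end

theory Submission imports Defs begin

text \<open>
  In the coordinate \<open>s = 1 / \<Phi>\<close> the exterior of \<open>L\<close> becomes the unit disc, and no quasiconformal extension
  of \<open>\<Phi>\<close> is needed. For \<open>w\<close> in the closure of \<open>G\<close> the kernel \<open>1 / (s (V s - w))\<close>, where \<open>V\<close> is the inverse
  of \<open>1 / \<Phi>\<close>, has no zeros in the disc, and Schottky's theorem bounds its logarithmic derivative by a
  multiple of \<open>1 / (1 - |s|)\<close>. Hence it changes at most by a power of the hyperbolic distortion, which allows
  polynomials of degree of order \<open>1 / (1 - |s|)\<close> to approximate \<open>1 / (V s - w)\<close>. The three point condition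
  enters only through the corkscrew property of both sides of \<open>L\<close> and through Harnack chains in the exterior;
  they give, with a Carleson estimate for \<open>1 - 1 / |\<Phi>|\<close>, a point at distance of order \<open>\<rho>\<close> from \<open>z\<close> and from
  \<open>L\<close> where \<open>1 - 1 / |\<Phi>|\<close> is of order \<open>1 / n\<close>, and show that \<open>\<rho> z'\<close> changes at most polynomially
  with \<open>|z - z'| / \<rho> z\<close>.

  The upper bound follows by integrating a power of the kernel polynomial attached to this point. For the
  lower bound an admissible polynomial is multiplied by such a power; at a point \<open>\<zeta>\<close> of \<open>L\<close> where the product is
  maximal, the Bernstein-Walsh inequality and Cauchy's estimate keep it large on a disc of radius of order
  \<open>\<rho> \<zeta>\<close> inside \<open>G\<close>.
\<close>

text \<open>Every comparison between a point z of L and another point costs a power of (|z - z'| +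
  \<rho>) / \<rho>, with an exponent that depends on G and is never computed. The kernel polynomials
  decay to any prescribed power at a cost of only a constant factor in the degree, so such losses
  are affordable; this is why all estimates are stated with an unspecified natural exponent. That
  factor M in the degree has to be undone. In the upper bound the construction is run with
  \<open>n div M\<close>, and \<rho> at the coarser level is still comparable. In the lower bound a
  degree \<open>(M + 1) * n\<close> costs only the factor \<open>exp (M + 1)\<close> in the
  Bernstein-Walsh inequality at level 1/n. It is essential that a degree of order 1 / (1 - |s|),
  without a logarithm, suffices for the kernel; this is achieved by bounding Taylor coefficients
  through a Poisson mean instead of a maximum. The condition \<alpha> > -2 enters as the convergence
  of a geometric series of ratio \<open>2 powr \<beta> / 4\<close>. The exponent p enters through p
  >= 1 only: a number in [0, 1] does not increase, and a number above 1 does not decrease, when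
  raised to the power p.\<close>

section \<open>Bloch functions and the hyperbolic metric of the disc\<close>

text \<open>The squared hyperbolic cosine of half the hyperbolic distance (curvature -1), that is 1
  / (1 - r^2) with r the pseudo-hyperbolic distance. On this scale the exponential of a
  hyperbolically Lipschitz function changes by at most a power.\<close>

definition hypdist :: "complex \<Rightarrow> complex \<Rightarrow> real" where
  "hypdist s t = (cmod (1 - cnj s * t))\<^sup>2 / ((1 - (cmod s)\<^sup>2) * (1 - (cmod t)\<^sup>2))"

text \<open>The derivative is integrated along the radius: its bound
  \<open>A * cmod z / (1 - t * cmod z)\<close> has the primitive
  \<open>- A * ln (1 - t * cmod z)\<close>.\<close>

lemma bloch_growth:
  assumes holf: "f holomorphic_on ball 0 1"
    and bl: "\<And>z. z \<in> ball 0 1 \<Longrightarrow> cmod (deriv f z) * (1 - cmod z) \<le> A"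
    and z: "z \<in> ball 0 1"
  shows "cmod (f z - f 0) \<le> A * ln (1 / (1 - cmod z))"
proof -
  have zl: "cmod z < 1" using z by simp
  have in_ball: "of_real t * z \<in> ball 0 1" if "t \<in> {0..1}" for t
    using that zl by (simp add: norm_mult mult_le_one order.strict_trans1 [OF mult_left_le_one_le])
  have lt: "t * cmod z < 1" if "t \<in> {0..1}" for t
    using in_ball[OF that] that by (simp add: norm_mult)
  have "cmod ((\<lambda>t. f (of_real t * z)) 1 - (\<lambda>t. f (of_real t * z)) 0)
      \<le> (\<lambda>t. - A * ln (1 - t * cmod z)) 1 - (\<lambda>t. - A * ln (1 - t * cmod z)) 0"
  proof (rule differentiable_bound_general[where f' = "\<lambda>t. z * deriv f (of_real t * z)"
        and \<phi>' = "\<lambda>t. A * cmod z / (1 - t * cmod z)"])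
    show "(0::real) < 1" by simp
    show "continuous_on {0..1} (\<lambda>t. f (of_real t * z))"
      by (intro continuous_on_compose2[OF holomorphic_on_imp_continuous_on[OF holf]] continuous_intros)
         (use in_ball in auto)
    show "continuous_on {0..1} (\<lambda>t. - A * ln (1 - t * cmod z))"
      by (intro continuous_intros) (use lt in fastforce)
    fix t :: real assume t: "0 < t" "t < 1"
    then have t': "t \<in> {0..1}" by auto
    show "((\<lambda>t. f (complex_of_real t * z)) has_vector_derivative z * deriv f (of_real t * z)) (at t)"
    proof -
      have "(f has_field_derivative deriv f (of_real t * z)) (at (of_real t * z))"
        using holf in_ball[OF t'] by (simp add: holomorphic_derivI)
      moreover have "((\<lambda>t. complex_of_real t * z) has_vector_derivative z) (at t)"
        by (auto intro!: derivative_eq_intros)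
      ultimately show ?thesis
        using field_vector_diff_chain_at[of "\<lambda>t. complex_of_real t * z" z t f]
        by (simp add: o_def)
    qed
    have "((\<lambda>t. - A * ln (1 - t * cmod z)) has_real_derivative A * cmod z / (1 - t * cmod z)) (at t)"
      using lt[OF t'] by (auto intro!: derivative_eq_intros simp: field_simps)
    then show "((\<lambda>t. - A * ln (1 - t * cmod z)) has_vector_derivative A * cmod z / (1 - t * cmod z)) (at t)"
      by (simp add: has_real_derivative_iff_has_vector_derivative)
    have "cmod (deriv f (of_real t * z)) \<le> A / (1 - t * cmod z)"
      using bl[OF in_ball[OF t']] lt[OF t'] t by (simp add: norm_mult pos_le_divide_eq)
    then have "cmod z * cmod (deriv f (of_real t * z)) \<le> cmod z * (A / (1 - t * cmod z))"
      by (intro mult_left_mono) auto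
    then show "cmod (z * deriv f (of_real t * z)) \<le> A * cmod z / (1 - t * cmod z)"
      by (simp add: norm_mult mult.commute)
  qed
  then show ?thesis using zl by (simp add: ln_div)
qed

lemma norm_moebius_identity:
  assumes "cmod s < 1" "cmod t < 1"
  shows "1 - (cmod ((t - s) / (1 - cnj s * t)))\<^sup>2
       = (1 - (cmod s)\<^sup>2) * (1 - (cmod t)\<^sup>2) / (cmod (1 - cnj s * t))\<^sup>2"
proof -
  have ne: "1 - cnj s * t \<noteq> 0"
    using norm_mult_less[of "cnj s" 1 t 1] assms by auto
  have "complex_of_real ((cmod (1 - cnj s * t))\<^sup>2 - (cmod (t - s))\<^sup>2)
      = complex_of_real ((1 - (cmod s)\<^sup>2) * (1 - (cmod t)\<^sup>2))"
    by (simp add: complex_norm_square algebra_simps del: of_real_power)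
  then have "(cmod (1 - cnj s * t))\<^sup>2 - (cmod (t - s))\<^sup>2 = (1 - (cmod s)\<^sup>2) * (1 - (cmod t)\<^sup>2)"
    using of_real_eq_iff by blast
  then show ?thesis using ne by (simp add: norm_divide power_divide field_simps)
qed

lemma hypdist_ge_1:
  assumes "cmod s < 1" "cmod t < 1" shows "hypdist s t \<ge> 1"
proof -
  have ne: "1 - cnj s * t \<noteq> 0"
    using norm_mult_less[of "cnj s" 1 t 1] assms by auto
  have "(1 - (cmod s)\<^sup>2) * (1 - (cmod t)\<^sup>2) / (cmod (1 - cnj s * t))\<^sup>2 \<le> 1"
    using norm_moebius_identity[OF assms] by (smt (verit) zero_le_power2)
  moreover have "(1 - (cmod s)\<^sup>2) > 0" "(1 - (cmod t)\<^sup>2) > 0"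
    using assms by (simp_all add: power_less_one_iff)
  ultimately have "(1 - (cmod s)\<^sup>2) * (1 - (cmod t)\<^sup>2) > 0"
    by simp
  then show ?thesis
    using \<open>(1 - (cmod s)\<^sup>2) * (1 - (cmod t)\<^sup>2) / (cmod (1 - cnj s * t))\<^sup>2 \<le> 1\<close> ne
    unfolding hypdist_def by (subst le_divide_eq_1_pos) (simp_all add: divide_le_eq_1)
qed

lemma hypdist_commute: "hypdist s t = hypdist t s"
proof -
  have "cmod (1 - cnj s * t) = cmod (cnj (1 - cnj s * t))" by (rule complex_mod_cnj[symmetric])
  also have "\<dots> = cmod (1 - cnj t * s)" by (simp add: mult.commute)
  finally show ?thesis by (simp add: hypdist_def mult.commute)
qed

text \<open>A Moebius map carries 0 to \<open>s\<close>. The expression |f'| (1 - |z|^2) is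
  invariant under it; replacing 1 - |z|^2 by 1 - |z| costs one factor 2 in front of the logarithm
  and another one inside.\<close>

lemma bloch_difference:
  assumes holf: "f holomorphic_on ball 0 1"
    and bl: "\<And>z. z \<in> ball 0 1 \<Longrightarrow> cmod (deriv f z) * (1 - cmod z) \<le> A"
    and s: "cmod s < 1" and t: "cmod t < 1"
  shows "cmod (f t - f s) \<le> 2 * A * ln (2 * hypdist s t)"
proof -
  have A0: "A \<ge> 0" using bl[of 0] by (smt (verit) mult_nonneg_nonneg norm_ge_zero centre_in_ball norm_zero)
  define m where "m = Moebius_function 0 (- s)"
  have m: "m x = (x + s) / (1 + cnj s * x)" for x
    by (simp add: m_def Moebius_function_simple)
  have s': "cmod (- s) < 1" using s by simp
  have holm: "m holomorphic_on ball 0 1"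
    unfolding m_def by (rule Moebius_function_holomorphic[OF s'])
  have mb: "m x \<in> ball 0 1" if "x \<in> ball 0 1" for x
    using Moebius_function_norm_lt_1[OF s', of x 0] that by (simp add: m_def)
  have ne: "1 + cnj s * x \<noteq> 0" if "x \<in> ball 0 1" for x
    using norm_mult_less[of "cnj s" 1 x 1] s that by (auto simp: add_eq_0_iff)
  have dm: "(m has_field_derivative (1 - (cmod s)\<^sup>2) / (1 + cnj s * x)\<^sup>2) (at x)" if "x \<in> ball 0 1" for x
  proof -
    have "((\<lambda>x. (x + s) / (1 + cnj s * x)) has_field_derivative (1 - (cmod s)\<^sup>2) / (1 + cnj s * x)\<^sup>2) (at x)"
      using ne[OF that]
      by (auto intro!: derivative_eq_intros simp: power2_eq_square[of "1 + cnj s * x"] divide_simps)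
         (simp add: algebra_simps complex_norm_square[of s, unfolded of_real_power])
    then show ?thesis by (simp add: m[abs_def])
  qed
  define g where "g = f \<circ> m"
  have holg: "g holomorphic_on ball 0 1"
    unfolding g_def by (intro holomorphic_on_compose_gen[OF holm holf]) (use mb in auto)
  have dg_le: "cmod (deriv g x) * (1 - cmod x) \<le> 2 * A" if x: "x \<in> ball 0 1" for x
  proof -
    have fd: "(f has_field_derivative deriv f (m x)) (at (m x))"
      using holf mb[OF x] by (simp add: holomorphic_derivI)
    have "(g has_field_derivative deriv f (m x) * ((1 - (cmod s)\<^sup>2) / (1 + cnj s * x)\<^sup>2)) (at x)"
      unfolding g_def by (rule DERIV_chain[OF fd dm[OF x]])
    then have dg: "deriv g x = deriv f (m x) * ((1 - (cmod s)\<^sup>2) / (1 + cnj s * x)\<^sup>2)"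
      by (rule DERIV_imp_deriv)
    have xl: "cmod x < 1" using x by simp
    have id: "1 - (cmod (m x))\<^sup>2 = (1 - (cmod s)\<^sup>2) * (1 - (cmod x)\<^sup>2) / (cmod (1 + cnj s * x))\<^sup>2"
      using norm_moebius_identity[of "-s" x] s xl by (simp add: m)
    have n0: "0 \<le> 1 - (cmod s)\<^sup>2" using s by (simp add: power_le_one)
    have nrm: "cmod ((1 - (cmod s)\<^sup>2) / (1 + cnj s * x)\<^sup>2) = (1 - (cmod s)\<^sup>2) / (cmod (1 + cnj s * x))\<^sup>2"
    proof -
      have "1 - complex_of_real ((cmod s)\<^sup>2) = complex_of_real (1 - (cmod s)\<^sup>2)" by simp
      then show ?thesis using n0 by (simp only: norm_divide norm_power norm_of_real abs_of_nonneg)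
    qed
    have xx: "1 - (cmod x)\<^sup>2 > 0" using xl by (simp add: power_less_one_iff)
    have le: "1 - (cmod y)\<^sup>2 \<le> 2 * (1 - cmod y)" if "cmod y < 1" for y
    proof -
      have "1 - (cmod y)\<^sup>2 = (1 - cmod y) * (1 + cmod y)" by (simp add: power2_eq_square algebra_simps)
      also have "\<dots> \<le> (1 - cmod y) * 2" using that by (intro mult_left_mono) auto
      finally show ?thesis by simp
    qed
    have "1 - cmod x \<le> 1 - (cmod x)\<^sup>2"
      using xl by (simp add: power2_eq_square mult_left_le)
    have "cmod (deriv g x) * (1 - cmod x) \<le> cmod (deriv g x) * (1 - (cmod x)\<^sup>2)"
      using \<open>1 - cmod x \<le> 1 - (cmod x)\<^sup>2\<close> by (intro mult_left_mono) auto
    also have "\<dots> = cmod (deriv f (m x)) * (1 - (cmod (m x))\<^sup>2)"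
      unfolding dg norm_mult nrm id by simp
    also have "\<dots> \<le> cmod (deriv f (m x)) * (2 * (1 - cmod (m x)))"
      using mb[OF x] by (intro mult_left_mono le) auto
    also have "\<dots> \<le> 2 * A" using bl[OF mb[OF x]] by (simp add: algebra_simps)
    finally show ?thesis .
  qed
  define x where "x = (t - s) / (1 - cnj s * t)"
  have xb: "x \<in> ball 0 1"
    using Moebius_function_norm_lt_1[OF s t, of 0] by (simp add: x_def Moebius_function_simple)
  have mx: "m x = t"
    using Moebius_function_compose[of "-s" s t] s t by (simp add: m_def x_def Moebius_function_simple)
  have m0: "m 0 = s" by (simp add: m)
  have hd: "1 / (1 - (cmod x)\<^sup>2) = hypdist s t"
    using norm_moebius_identity[OF s t] by (simp add: x_def hypdist_def)
  have xl: "cmod x < 1" using xb by simp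
  have "cmod (f t - f s) \<le> 2 * A * ln (1 / (1 - cmod x))"
    using bloch_growth[OF holg dg_le xb] by (simp add: g_def mx m0)
  also have "\<dots> \<le> 2 * A * ln (2 * (1 / (1 - (cmod x)\<^sup>2)))"
  proof (intro mult_left_mono)
    have "1 / (1 - cmod x) = (1 + cmod x) / (1 - (cmod x)\<^sup>2)"
    proof -
      have "1 - (cmod x)\<^sup>2 = (1 - cmod x) * (1 + cmod x)" by (simp add: power2_eq_square algebra_simps)
      moreover have "1 + cmod x \<noteq> 0" using norm_ge_zero[of x] by linarith
      ultimately show ?thesis by (simp add: divide_simps)
    qed
    also have "\<dots> \<le> 2 / (1 - (cmod x)\<^sup>2)"
      using xl by (intro divide_right_mono) (auto simp: power_le_one)
    finally show "ln (1 / (1 - cmod x)) \<le> ln (2 * (1 / (1 - (cmod x)\<^sup>2)))"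
      using xl by (subst ln_le_cancel_iff) (auto simp: power_less_one_iff)
  qed (use A0 in auto)
  finally show ?thesis unfolding hd .
qed

text \<open>A holomorphic logarithm of \<open>f\<close> exists on the disc, and the bound on f'/f is
  the Bloch condition for it. Exponentiating turns the logarithm of \<open>hypdist\<close> into a
  power.\<close>

lemma nonvanishing_distortion:
  assumes holf: "f holomorphic_on ball 0 1"
    and nz: "\<And>z. z \<in> ball 0 1 \<Longrightarrow> f z \<noteq> 0"
    and bl: "\<And>z. z \<in> ball 0 1 \<Longrightarrow> cmod (deriv f z) * (1 - cmod z) \<le> A * cmod (f z)"
    and K: "2 * A \<le> real K"
    and s: "cmod s < 1" and t: "cmod t < 1"
  shows "cmod (f s) \<le> (2 * hypdist s t) ^ K * cmod (f t)"
proof -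
  have "contractible (ball (0::complex) 1)" by (simp add: convex_imp_contractible)
  from contractible_imp_holomorphic_log[OF holf this nz]
  obtain g where holg: "g holomorphic_on ball 0 1" and g: "\<And>z. z \<in> ball 0 1 \<Longrightarrow> f z = exp (g z)"
    by metis
  have dg: "deriv f z = exp (g z) * deriv g z" if "z \<in> ball 0 1" for z
  proof -
    have "((\<lambda>z. exp (g z)) has_field_derivative exp (g z) * deriv g z) (at z)"
      using holg that by (auto intro!: derivative_eq_intros holomorphic_derivI)
    then have "(f has_field_derivative exp (g z) * deriv g z) (at z)"
      by (rule has_field_derivative_transform_within_open[where S="ball 0 1"]) (use that g in auto)
    then show ?thesis by (rule DERIV_imp_deriv)
  qed
  have "cmod (deriv g z) * (1 - cmod z) \<le> A" if z: "z \<in> ball 0 1" for z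
    using bl[OF z] nz[OF z] by (simp add: dg[OF z] g[OF z] norm_mult mult.assoc)
  from bloch_difference[OF holg this s t]
  have d: "cmod (g t - g s) \<le> 2 * A * ln (2 * hypdist s t)" by simp
  have h1: "2 * hypdist s t \<ge> 1" using hypdist_ge_1[OF s t] by simp
  have "Re (g s) - Re (g t) \<le> 2 * A * ln (2 * hypdist s t)"
    using d abs_Re_le_cmod[of "g t - g s"] by simp
  also have "\<dots> \<le> real K * ln (2 * hypdist s t)" using K h1 by (intro mult_right_mono) auto
  finally have "exp (Re (g s)) \<le> exp (real K * ln (2 * hypdist s t)) * exp (Re (g t))"
    by (simp flip: exp_add)
  also have "exp (real K * ln (2 * hypdist s t)) = (2 * hypdist s t) ^ K"
    using h1 by (simp add: exp_of_nat_mult)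
  finally show ?thesis using s t g by simp
qed

section \<open>The exterior of a Jordan curve in the coordinate \<open>1 / \<Phi>\<close>\<close>

locale jordan_domain =
  fixes G :: "complex set"
  assumes jordan: "bounded_jordan_domain G"
begin

abbreviation L :: "complex set" where "L \<equiv> frontier G"
abbreviation Ext :: "complex set" where "Ext \<equiv> - closure G"

lemma jordan_facts:
  shows open_G: "open G" and connected_G: "connected G" and bounded_G: "bounded G" and G_ne: "G \<noteq> {}"
    and connected_Ext: "connected Ext" and frontier_Ext: "frontier Ext = L"
    and compact_L: "compact L" and connected_L: "connected L"
    and L_eq: "\<exists>\<gamma>. simple_path \<gamma> \<and> pathfinish \<gamma> = pathstart \<gamma> \<and> L = path_image \<gamma>"
proof -
  obtain \<gamma> where g: "simple_path \<gamma>" "pathfinish \<gamma> = pathstart \<gamma>" "G = inside (path_image \<gamma>)"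
    using jordan by (auto simp: bounded_jordan_domain_def)
  note J = Jordan_inside_outside[OF g(1,2)]
  have L: "L = path_image \<gamma>" using J g(3) by simp
  show "open G" "connected G" "bounded G" "G \<noteq> {}" using J g(3) by auto
  have "closure G = G \<union> path_image \<gamma>"
    using L \<open>open G\<close> by (metis closure_Un_frontier)
  then have E: "Ext = outside (path_image \<gamma>)"
    using inside_Int_outside[of "path_image \<gamma>"] inside_Un_outside[of "path_image \<gamma>"] g(3) by blast
  show "connected Ext" "frontier Ext = L" using J E L by auto
  show "compact L" "connected L"
    using L g(1) by (simp_all add: compact_simple_path_image connected_simple_path_image)
  show "\<exists>\<gamma>. simple_path \<gamma> \<and> pathfinish \<gamma> = pathstart \<gamma> \<and> L = path_image \<gamma>" using g L by blast
qed

lemma open_Ext: "open Ext" by (simp add: open_Compl)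

lemma closure_G: "closure G = G \<union> L" by (simp add: closure_Un_frontier)

lemma G_L_disjoint: "G \<inter> L = {}"
  using open_G frontier_disjoint_eq[of G] by blast

lemma notin_closure_G: "x \<in> Ext \<longleftrightarrow> x \<notin> G \<and> x \<notin> L" by (simp add: closure_G)

lemma closed_L: "closed L" by simp

lemma L_ne: "L \<noteq> {}"
  using frontier_not_empty[of G] G_ne bounded_G not_bounded_UNIV by metis

lemma L_closure: "L \<subseteq> closure G" by (simp add: closure_G)

lemma infdist_attained: obtains p where "p \<in> L" "infdist x L = dist x p"
  using infdist_attains_inf[OF closed_L L_ne] by metis

lemma infdist_pos: "x \<notin> L \<Longrightarrow> infdist x L > 0"
  using in_closed_iff_infdist_zero[OF closed_L L_ne, of x] infdist_nonneg[of x L] by linarith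

text \<open>The segment from \<open>x\<close> to \<open>w\<close> crosses \<open>L\<close>. Applied
  to \<open>x = V s\<close>, this bounds |V s - w| from below uniformly in \<open>w\<close>.\<close>

lemma infdist_le_dist_closure:
  assumes "x \<in> Ext" "w \<in> closure G" shows "infdist x L \<le> dist x w"
proof -
  have "closed_segment x w \<inter> L \<noteq> {}"
  proof (cases "w \<in> L")
    case False
    then have "w \<in> G" using assms closure_G by auto
    then show ?thesis using assms closure_G
      by (intro connected_Int_frontier[of "closed_segment x w" G]) auto
  qed auto
  then obtain p where p: "p \<in> closed_segment x w" "p \<in> L" by blast
  then have "infdist x L \<le> dist x p" by (intro infdist_le)
  also have "\<dots> \<le> dist x w" using p(1) segment_bound1[of p x w] by (simp add: dist_norm norm_minus_commute)
  finally show ?thesis .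
qed

text \<open>Each \<open>a\<close> in \<open>L\<close> has distance at least
  \<open>dist p q / 2\<close> from one of two fixed points of \<open>L\<close>, and the distances
  from \<open>a\<close> to the points of the connected set \<open>L\<close> fill an interval. This
  supplies points of \<open>L\<close> at a prescribed small distance, uniformly in
  \<open>a\<close>.\<close>

lemma L_sphere: "\<exists>D>0. \<forall>a\<in>L. \<forall>e. 0 < e \<and> e \<le> D \<longrightarrow> (\<exists>b\<in>L. dist a b = e)"
proof -
  obtain \<gamma> where g: "simple_path \<gamma>" "L = path_image \<gamma>" using L_eq by blast
  have "\<gamma> (1/3) \<noteq> \<gamma> (1/2)" 
  proof
    assume "\<gamma> (1/3) = \<gamma> (1/2)"
    then have "1/3 = (1/2::real) \<or> 1/3 = (0::real) \<and> 1/2 = (1::real) \<or> 1/3 = (1::real) \<and> 1/2 = (0::real)"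
      using g(1)[unfolded simple_path_def loop_free_def, THEN conjunct2, rule_format, of "1/3" "1/2"] by simp
    then show False by simp
  qed
  moreover have "\<gamma> (1/3) \<in> L" "\<gamma> (1/2) \<in> L" using g(2) by (auto simp: path_image_def)
  ultimately obtain p q where pq: "p \<in> L" "q \<in> L" "p \<noteq> q" by metis
  show ?thesis
  proof (intro exI[of _ "dist p q / 2"] conjI ballI allI impI)
    show "0 < dist p q / 2" using pq by simp
    fix a e assume a: "a \<in> L" and e: "0 < e \<and> e \<le> dist p q / 2"
    have "dist p q / 2 \<le> dist a p \<or> dist p q / 2 \<le> dist a q"
      using dist_triangle2[of p q a] by (simp add: dist_commute) linarith
    then obtain x where x: "x \<in> L" "dist p q / 2 \<le> dist a x" using pq by blast
    have "connected ((dist a) ` L)"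
      by (intro connected_continuous_image connected_L continuous_intros)
    moreover have "0 \<in> dist a ` L" "dist a x \<in> dist a ` L" using a x by force+
    ultimately have "e \<in> dist a ` L"
      using e x(2) by (intro connectedD_interval[of "dist a ` L" 0 "dist a x" e]) auto
    then show "\<exists>b\<in>L. dist a b = e" by auto
  qed
qed

end

locale exterior_map = jordan_domain +
  fixes \<Phi> :: "complex \<Rightarrow> complex"
  assumes rm: "exterior_riemann_map G \<Phi>"
begin

lemma Phi_facts:
  shows Phi_hol: "\<Phi> holomorphic_on Ext" and Phi_bij: "bij_betw \<Phi> Ext {w. norm w > 1}"
    and Phi_inf: "filterlim \<Phi> at_infinity at_infinity"
  using rm by (auto simp: exterior_riemann_map_def)

lemma Phi_gt1: "x \<in> Ext \<Longrightarrow> cmod (\<Phi> x) > 1"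
  using Phi_bij by (auto simp: bij_betw_def)

text \<open>The inversion y = 1 / (x - w0) moves infinity to 0, where 1 / \<Phi> has a removable
  singularity. The resulting map \<open>us\<close> is injective from a neighbourhood
  \<open>U\<close> of 0 onto the unit disc, and \<phi> is its inverse, so \<phi> has nonzero
  derivative at 0.\<close>

lemma exterior_chart:
  "\<exists>w0 \<phi>. w0 \<in> G \<and> \<phi> holomorphic_on ball 0 1 \<and> inj_on \<phi> (ball 0 1) \<and> \<phi> 0 = 0 \<and> deriv \<phi> 0 \<noteq> 0 \<and>
     (\<forall>s\<in>ball 0 1. s \<noteq> 0 \<longrightarrow> w0 + 1 / \<phi> s \<in> Ext \<and> \<Phi> (w0 + 1 / \<phi> s) = 1 / s) \<and>
     (\<forall>x\<in>Ext. w0 + 1 / \<phi> (1 / \<Phi> x) = x)"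
proof -
  obtain w0 where w0: "w0 \<in> G" using G_ne by blast
  have w0E: "w0 \<notin> Ext" using w0 closure_G by auto
  define U where "U = {y. y = 0 \<or> w0 + 1 / y \<in> Ext}"
  define us where "us y = (if y = 0 then 0 else 1 / \<Phi> (w0 + 1 / y))" for y
  have lim: "filterlim (\<lambda>y::complex. w0 + 1 / y) at_infinity (at 0)"
  proof -
    have "filterlim (\<lambda>y::complex. inverse y) at_infinity (at 0)" by (rule filterlim_inverse_at_infinity)
    then have "filterlim (\<lambda>y::complex. inverse y + w0) at_infinity (at 0)"
      by (rule tendsto_add_filterlim_at_infinity'[OF _ tendsto_const])
    then show ?thesis by (simp add: inverse_eq_divide add.commute)
  qed
  have "eventually (\<lambda>x. x \<in> Ext) at_infinity"
  proof -
    obtain B where B: "\<And>x. x \<in> closure G \<Longrightarrow> norm x \<le> B"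
      using bounded_G bounded_closure bounded_iff by metis
    have "x \<in> Ext" if "norm x \<ge> B + 1" for x using B[of x] that by auto
    then show ?thesis unfolding eventually_at_infinity by blast
  qed
  then have ev: "eventually (\<lambda>y. w0 + 1 / y \<in> Ext) (at 0)"
    using lim by (rule eventually_compose_filterlim)
  have openU': "open {y. y \<noteq> 0 \<and> w0 + 1 / y \<in> Ext}"
  proof -
    have "open (- {0} \<inter> (\<lambda>y::complex. w0 + 1 / y) -` Ext)"
      by (rule continuous_open_preimage) (auto intro!: continuous_intros)
    moreover have "{y. y \<noteq> 0 \<and> w0 + 1 / y \<in> Ext} = - {0} \<inter> (\<lambda>y::complex. w0 + 1 / y) -` Ext"
      by auto
    ultimately show ?thesis by simp
  qed
  have openU: "open U"
  proof -
    obtain d where d: "d > 0" "\<And>y. y \<noteq> 0 \<Longrightarrow> dist y 0 < d \<Longrightarrow> w0 + 1 / y \<in> Ext"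
      using ev unfolding eventually_at by auto
    have "U = {y. y \<noteq> 0 \<and> w0 + 1 / y \<in> Ext} \<union> ball 0 d"
      using d by (auto simp: U_def dist_commute)
    then show ?thesis using open_Un[OF openU' open_ball] by simp
  qed
  have hol': "us holomorphic_on U - {0}"
  proof -
    have "(\<lambda>y. 1 / \<Phi> (w0 + 1 / y)) holomorphic_on U - {0}"
    proof (intro holomorphic_intros)
      have "(\<Phi> \<circ> (\<lambda>y. w0 + 1 / y)) holomorphic_on U - {0}"
        by (intro holomorphic_on_compose_gen[OF _ Phi_hol] holomorphic_intros) (auto simp: U_def)
      then show "(\<lambda>y. \<Phi> (w0 + 1 / y)) holomorphic_on U - {0}" by (simp add: o_def)
      show "\<Phi> (w0 + 1 / y) \<noteq> 0" if "y \<in> U - {0}" for y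
        using that Phi_gt1[of "w0 + 1 / y"] by (auto simp: U_def)
    qed
    then show ?thesis by (rule holomorphic_transform) (auto simp: us_def)
  qed
  have "((\<lambda>y. 1 / \<Phi> (w0 + 1 / y)) \<longlongrightarrow> 0) (at 0)"
    using filterlim_compose[OF Phi_inf lim] by (rule tendsto_divide_0[OF tendsto_const])
  moreover have "eventually (\<lambda>y. 1 / \<Phi> (w0 + 1 / y) = us y) (at 0)"
    unfolding eventually_at_filter by (simp add: us_def)
  ultimately have us0: "(us \<longlongrightarrow> 0) (at 0)" by (rule Lim_transform_eventually)
  have "us 0 = 0" by (simp add: us_def)
  then have us0': "(us \<longlongrightarrow> us 0) (at 0 within U)"
    using tendsto_within_subset[OF us0 subset_UNIV] by (simp only:)
  have holus: "us holomorphic_on U"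
  proof (rule no_isolated_singularity'[OF _ hol' openU])
    fix z :: complex assume "z \<in> {0}"
    then show "(us \<longlongrightarrow> us z) (at z within U)" using us0' by (simp only: singleton_iff)
  qed (rule finite.emptyI[THEN finite.insertI])
  have injPhi: "inj_on \<Phi> Ext" using Phi_bij by (simp add: bij_betw_def)
  have injus: "inj_on us U"
  proof (rule inj_onI)
    fix x y assume xy: "x \<in> U" "y \<in> U" "us x = us y"
    have nz: "us z \<noteq> 0" if "z \<in> U" "z \<noteq> 0" for z
    proof -
      have "w0 + 1 / z \<in> Ext" using that by (simp add: U_def)
      from Phi_gt1[OF this] have "\<Phi> (w0 + 1 / z) \<noteq> 0" by auto
      then show ?thesis using that by (simp add: us_def)
    qed
    show "x = y"
    proof (cases "x = 0 \<or> y = 0")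
      case True then show ?thesis using nz[OF xy(1)] nz[OF xy(2)] xy(3) by (metis us_def)
    next
      case False
      then have "\<Phi> (w0 + 1 / x) = \<Phi> (w0 + 1 / y)" using xy(3) by (simp add: us_def)
      then have "w0 + 1 / x = w0 + 1 / y" using injPhi False xy by (auto simp: U_def dest: inj_onD)
      then show ?thesis using False by simp
    qed
  qed
  have us_Phi: "1 / (x - w0) \<in> U" "us (1 / (x - w0)) = 1 / \<Phi> x" "1 / \<Phi> x \<in> ball 0 1" "x \<noteq> w0" if "x \<in> Ext" for x
  proof -
    show ne: "x \<noteq> w0" using that w0E by blast
    show "1 / (x - w0) \<in> U" "us (1 / (x - w0)) = 1 / \<Phi> x" using ne that by (simp_all add: U_def us_def)
    show "1 / \<Phi> x \<in> ball 0 1" using Phi_gt1[OF that] by (simp add: norm_divide divide_less_eq_1)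
  qed
  have img: "us ` U = ball 0 1"
  proof
    show "us ` U \<subseteq> ball 0 1"
    proof (intro image_subsetI)
      fix y assume "y \<in> U"
      then show "us y \<in> ball 0 1"
        using Phi_gt1[of "w0 + 1 / y"] by (cases "y = 0") (simp_all add: us_def U_def norm_divide divide_less_eq_1)
    qed
    show "ball 0 1 \<subseteq> us ` U"
    proof
      fix s :: complex assume s: "s \<in> ball 0 1"
      show "s \<in> us ` U"
      proof (cases "s = 0")
        case True then show ?thesis by (auto simp: us_def U_def intro!: image_eqI[of _ _ 0])
      next
        case False
        then have "1 / s \<in> {w. norm w > 1}" using s False by (simp add: norm_divide less_divide_eq_1)
        then obtain x where x: "x \<in> Ext" "\<Phi> x = 1 / s"
          using Phi_bij by (metis bij_betw_imp_surj_on imageE)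
        have "s = us (1 / (x - w0))" using us_Phi(2)[OF x(1)] x(2) by simp
        then show ?thesis using us_Phi(1)[OF x(1)] by (rule image_eqI)
      qed
    qed
  qed
  obtain \<phi> where hol: "\<phi> holomorphic_on us ` U"
    and der: "\<And>z. z \<in> U \<Longrightarrow> deriv us z * deriv \<phi> (us z) = 1"
    and inv: "\<And>z. z \<in> U \<Longrightarrow> \<phi> (us z) = z"
    using holomorphic_has_inverse[OF holus openU injus] by metis
  have 0: "0 \<in> U" "us 0 = 0" by (auto simp: U_def us_def)
  show ?thesis
  proof (intro exI conjI ballI impI)
    show "w0 \<in> G" by fact
    show "\<phi> holomorphic_on ball 0 1" using hol img by simp
    show "inj_on \<phi> (ball 0 1)" unfolding img[symmetric]
      by (rule inj_onI) (use inv in auto)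
    show "\<phi> 0 = 0" using inv[OF 0(1)] 0(2) by simp
    show "deriv \<phi> 0 \<noteq> 0" using der[OF 0(1)] 0(2) by auto
    fix s :: complex assume s: "s \<in> ball 0 1" "s \<noteq> 0"
    then obtain y where y: "y \<in> U" "s = us y" using img by blast
    then have "y \<noteq> 0" using s by (auto simp: us_def)
    then show "w0 + 1 / \<phi> s \<in> Ext" "\<Phi> (w0 + 1 / \<phi> s) = 1 / s"
      using y inv[OF y(1)] by (auto simp: U_def us_def)
  next
    fix x assume x: "x \<in> Ext"
    show "w0 + 1 / \<phi> (1 / \<Phi> x) = x"
      using us_Phi[OF x] inv[of "1 / (x - w0)"] by simp
  qed
qed

end

locale exterior_chart = exterior_map +
  fixes w0 :: complex and \<phi> :: "complex \<Rightarrow> complex"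
  assumes w0: "w0 \<in> G" and phi_hol: "\<phi> holomorphic_on ball 0 1" and phi_inj: "inj_on \<phi> (ball 0 1)"
    and phi_0: "\<phi> 0 = 0" and dphi_0: "deriv \<phi> 0 \<noteq> 0"
    and phi_V: "\<And>s. s \<in> ball 0 1 \<Longrightarrow> s \<noteq> 0 \<Longrightarrow> w0 + 1 / \<phi> s \<in> Ext \<and> \<Phi> (w0 + 1 / \<phi> s) = 1 / s"
    and phi_u: "\<And>x. x \<in> Ext \<Longrightarrow> w0 + 1 / \<phi> (1 / \<Phi> x) = x"
begin

definition V :: "complex \<Rightarrow> complex" where "V s = w0 + 1 / \<phi> s"
definition u :: "complex \<Rightarrow> complex" where "u x = 1 / \<Phi> x"
text \<open>Up to the factor |\<Phi>| this is the height |\<Phi>| - 1. The extension by 0 makes it a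
  continuous function on the whole plane with values in [0, 1), so intermediate value and
  compactness arguments may cross \<open>L\<close>.\<close>

definition eta :: "complex \<Rightarrow> real" where "eta x = (if x \<in> Ext then 1 - cmod (u x) else 0)"

lemma V_Ext: "cmod s < 1 \<Longrightarrow> s \<noteq> 0 \<Longrightarrow> V s \<in> Ext"
  using phi_V by (simp add: V_def)

lemma u_V: "cmod s < 1 \<Longrightarrow> s \<noteq> 0 \<Longrightarrow> u (V s) = s"
  using phi_V by (simp add: V_def u_def)

lemma V_u: "x \<in> Ext \<Longrightarrow> V (u x) = x" using phi_u by (simp add: V_def u_def)

lemma u_bounds:
  assumes "x \<in> Ext"
  shows "0 < cmod (u x)" "cmod (u x) < 1" "u x \<noteq> 0"
proof -
  have 1: "1 < cmod (\<Phi> x)" using Phi_gt1[OF assms] .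
  then have "\<Phi> x \<noteq> 0" by (metis norm_zero not_one_less_zero)
  then show "u x \<noteq> 0" "0 < cmod (u x)" by (simp_all add: u_def)
  show "cmod (u x) < 1" using 1 by (simp add: u_def norm_divide divide_less_eq_1)
qed

lemma eta_V: "cmod s < 1 \<Longrightarrow> s \<noteq> 0 \<Longrightarrow> eta (V s) = 1 - cmod s"
  using V_Ext u_V by (simp add: eta_def)

lemma eta_nonneg: "eta x \<ge> 0" and eta_less1: "eta x < 1"
  using u_bounds(1,2)[of x] by (cases "x \<in> Ext"; simp add: eta_def)+

lemma eta_pos: "x \<in> Ext \<Longrightarrow> eta x > 0" using u_bounds(2)[of x] by (simp add: eta_def)

lemma eta_eq_0: "x \<in> closure G \<Longrightarrow> eta x = 0" by (simp add: eta_def)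

lemma phi_nz: "cmod s < 1 \<Longrightarrow> s \<noteq> 0 \<Longrightarrow> \<phi> s \<noteq> 0"
  using phi_inj phi_0 by (metis inj_onD mem_ball_0 norm_zero zero_less_one)

lemma V_hol: "V holomorphic_on ball 0 1 - {0}"
  unfolding V_def using phi_nz
  by (intro holomorphic_intros holomorphic_on_subset[OF phi_hol]) auto

lemma u_hol: "u holomorphic_on Ext"
  unfolding u_def
proof (intro holomorphic_intros Phi_hol)
  show "\<Phi> x \<noteq> 0" if "x \<in> Ext" for x using Phi_gt1[OF that] by (metis norm_zero not_one_less_zero)
qed

text \<open>By injectivity, \<phi> at such points omits the image of a small ball about 0, which is
  an open neighbourhood of 0.\<close>

lemma phi_lower: "0 < \<rho> \<Longrightarrow> \<exists>c>0. \<forall>s. \<rho> \<le> cmod s \<and> cmod s < 1 \<longrightarrow> c \<le> cmod (\<phi> s)"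
proof -
  assume r: "0 < \<rho>"
  define r where "r = min \<rho> 1"
  have "open (\<phi> ` ball 0 r)"
    by (rule open_mapping_thm3)
       (auto simp: r_def intro: holomorphic_on_subset[OF phi_hol] inj_on_subset[OF phi_inj])
  moreover have "0 \<in> \<phi> ` ball 0 r" using phi_0 r by (auto simp: r_def intro!: image_eqI[of _ _ 0])
  ultimately obtain c where c: "c > 0" "ball 0 c \<subseteq> \<phi> ` ball 0 r"
    by (meson open_contains_ball)
  have "c \<le> cmod (\<phi> s)" if s: "\<rho> \<le> cmod s" "cmod s < 1" for s
  proof (rule ccontr)
    assume "\<not> c \<le> cmod (\<phi> s)"
    then have "\<phi> s \<in> ball 0 c" by simp
    then obtain t where t: "t \<in> ball 0 r" "\<phi> s = \<phi> t" using c by blast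
    then have "s = t" using phi_inj s by (auto simp: r_def dest: inj_onD)
    then show False using t s by (simp add: r_def)
  qed
  then show ?thesis using c by blast
qed

lemma V_bounded: "0 < \<rho> \<Longrightarrow> \<exists>B>0. \<forall>s. \<rho> \<le> cmod s \<and> cmod s < 1 \<longrightarrow> cmod (V s - w0) \<le> B"
proof -
  assume "0 < \<rho>"
  then obtain c where c: "c > 0" "\<And>s. \<rho> \<le> cmod s \<Longrightarrow> cmod s < 1 \<Longrightarrow> c \<le> cmod (\<phi> s)"
    using phi_lower by metis
  have "cmod (V s - w0) \<le> 1 / c" if "\<rho> \<le> cmod s" "cmod s < 1" for s
    using c(2)[OF that] c(1) by (auto simp: V_def norm_divide intro!: divide_left_mono mult_pos_pos)
  then show ?thesis using c(1) by (intro exI[of _ "1/c"]) auto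
qed

text \<open>Under the inversion at \<open>w0\<close> the superlevel set is the preimage of the
  compact image of \<open>cball 0 (1 - \<epsilon>)\<close> under \<phi>. A ball about
  \<open>w0\<close> is left out because the inversion is singular there.\<close>

lemma superlevel_closed: "\<epsilon> > 0 \<Longrightarrow> closed {x. \<epsilon> \<le> eta x}"
proof -
  assume e: "\<epsilon> > 0"
  obtain r where r: "r > 0" "ball w0 r \<subseteq> G" using open_G w0 by (meson open_contains_ball)
  have ball_Ext: "x \<notin> ball w0 r" if "x \<in> Ext" for x
    using r that closure_G by auto
  define K where "K = \<phi> ` cball 0 (1 - \<epsilon>)"
  have "compact K" unfolding K_def
    by (intro compact_continuous_image holomorphic_on_imp_continuous_on holomorphic_on_subset[OF phi_hol])
       (use e in auto)
  have "closed (- ball w0 r \<inter> (\<lambda>x. 1 / (x - w0)) -` K)"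
    by (rule continuous_closed_preimage)
       (use r \<open>compact K\<close> compact_imp_closed in \<open>auto intro!: continuous_intros closed_Compl\<close>)
  moreover have "{x. \<epsilon> \<le> eta x} = - ball w0 r \<inter> (\<lambda>x. 1 / (x - w0)) -` K"
  proof (intro set_eqI iffI)
    fix x assume "x \<in> {x. \<epsilon> \<le> eta x}"
    then have x: "\<epsilon> \<le> eta x" by simp
    then have xE: "x \<in> Ext" using e by (auto simp: eta_def split: if_splits)
    then have ux: "cmod (u x) \<le> 1 - \<epsilon>" using x by (simp add: eta_def)
    have "x - w0 = 1 / \<phi> (u x)" using V_u[OF xE] by (simp add: V_def algebra_simps)
    then have "1 / (x - w0) = \<phi> (u x)" by simp
    then have "1 / (x - w0) \<in> K" unfolding K_def using ux by (intro image_eqI[of _ _ "u x"]) auto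
    then show "x \<in> - ball w0 r \<inter> (\<lambda>x. 1 / (x - w0)) -` K" using ball_Ext xE by simp
  next
    fix x assume "x \<in> - ball w0 r \<inter> (\<lambda>x. 1 / (x - w0)) -` K"
    then have x: "x \<notin> ball w0 r" "1 / (x - w0) \<in> K" by auto
    then obtain s where s: "cmod s \<le> 1 - \<epsilon>" "1 / (x - w0) = \<phi> s" by (auto simp: K_def)
    have "x \<noteq> w0" using x r by auto
    then have "s \<noteq> 0" using s phi_0 by auto
    have "V s = x" using s(2)[symmetric] by (simp add: V_def)
    then show "x \<in> {x. \<epsilon> \<le> eta x}" using eta_V[of s] \<open>s \<noteq> 0\<close> s(1) e by auto
  qed
  ultimately show ?thesis by simp
qed

text \<open>On \<open>Ext\<close> this is the continuity of \<open>u\<close>. Elsewhere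
  \<open>eta\<close> is 0, and since it is nonnegative, the closed superlevel sets give
  continuity.\<close>

lemma eta_continuous: "continuous_on UNIV eta"
  unfolding continuous_on_eq_continuous_at[OF open_UNIV]
proof
  fix x
  show "isCont eta x"
  proof (cases "x \<in> Ext")
    case True
    have "continuous_on Ext (\<lambda>x. 1 - cmod (u x))"
      by (intro continuous_intros holomorphic_on_imp_continuous_on u_hol)
    then have "continuous_on Ext eta" by (rule continuous_on_eq) (auto simp: eta_def)
    then show ?thesis using True open_Ext continuous_on_eq_continuous_at by blast
  next
    case False
    then have 0: "eta x = 0" by (simp add: eta_def)
    show ?thesis unfolding isCont_def 0
    proof (rule tendstoI)
      fix e :: real assume e: "e > 0"
      have "open (- {x. e \<le> eta x})" using superlevel_closed[OF e] by (simp add: open_Compl)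
      moreover have "x \<in> - {x. e \<le> eta x}" using 0 e by simp
      ultimately have "eventually (\<lambda>y. y \<in> - {x. e \<le> eta x}) (at x)"
        by (rule eventually_at_in_open')
      then show "eventually (\<lambda>y. dist (eta y) 0 < e) (at x)"
        by eventually_elim (use eta_nonneg in auto)
    qed
  qed
qed

end

section \<open>Distortion of the exterior map\<close>

context exterior_chart begin

lemma V_field_deriv: "cmod s < 1 \<Longrightarrow> s \<noteq> 0 \<Longrightarrow> (V has_field_derivative deriv V s) (at s)"
  using V_hol by (intro holomorphic_derivI[of V "ball 0 1 - {0}"]) auto

text \<open>A substitute for the Koebe distortion theorem: after an affine normalization \<open>V\<close> omits
  the values \<open>0\<close> and \<open>1\<close>, so Schottky's theorem applies.\<close>
lemma V_deriv_bound:
  "\<exists>A>0. \<forall>s. 1/2 \<le> cmod s \<and> cmod s < 1 \<longrightarrow> cmod (deriv V s) * (1 - cmod s) \<le> A * infdist (V s) L"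
proof -
  obtain B where B: "B > 0" "\<And>s. 1/2 \<le> cmod s \<Longrightarrow> cmod s < 1 \<Longrightarrow> cmod (V s - w0) \<le> B"
    using V_bounded[of "1/2"] by auto
  obtain D where D: "D > 0" "\<And>a e. a \<in> L \<Longrightarrow> 0 < e \<Longrightarrow> e \<le> D \<Longrightarrow> \<exists>b\<in>L. dist a b = e"
    using L_sphere by metis
  \<comment> \<open>The ratio of |a - b| to the distance d of \<open>V s\<close> from
    \<open>L\<close> must not depend on \<open>s\<close>. As d is at most \<open>B\<close>, the
    length \<theta> d is at most \<open>D\<close>, so a point b of \<open>L\<close> at this distance
    from a exists.\<close>
  define \<theta> where "\<theta> = min 1 (D / B)"
  define S where "S = exp (pi * exp (pi * (2 + 2 * (1 / \<theta>) + 12 * (1/2) / (1 - 1/2))))"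
  have th: "0 < \<theta>" "\<theta> \<le> 1" using D B by (auto simp: \<theta>_def)
  have S: "S > 0" by (simp add: S_def)
  have "cmod (deriv V s) * (1 - cmod s) \<le> (4 * S) * infdist (V s) L"
    if s: "1/2 \<le> cmod s" "cmod s < 1" for s
  proof -
    have s0: "s \<noteq> 0" using s by auto
    have VE: "V s \<in> Ext" using V_Ext s s0 by blast
    obtain a where a: "a \<in> L" "infdist (V s) L = dist (V s) a" using infdist_attained by blast
    define d where "d = dist (V s) a"
    have dpos: "d > 0" using infdist_pos[of "V s"] VE a notin_closure_G by (simp add: d_def)
    have "d \<le> dist (V s) w0"
      using infdist_le_dist_closure[OF VE, of w0] w0 closure_G a d_def by auto
    also have "\<dots> \<le> B" using B(2)[OF s] by (simp add: dist_norm)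
    finally have dB: "d \<le> B" .
    have "\<theta> * d \<le> D"
    proof -
      have "\<theta> * d \<le> (D / B) * B" using th dpos dB D B by (intro mult_mono) (auto simp: \<theta>_def)
      then show ?thesis using B by simp
    qed
    then obtain b where b: "b \<in> L" "dist a b = \<theta> * d" using D(2)[OF a(1), of "\<theta> * d"] th dpos by auto
    have ab: "b \<noteq> a" using b th dpos by auto
    \<comment> \<open>For |s| >= 1/2 this is at most 3/8, so the closed disc of radius r about
      \<open>s\<close> avoids 0, the pole of \<open>V\<close>, as well as the unit circle.\<close>
    define r where "r = 3/4 * (1 - cmod s)"
    have r: "r > 0" using s by (simp add: r_def)
    define f where "f x = (V (s + of_real r * x) - a) / (b - a)" for x
    have dom: "cmod (s + of_real r * x) < 1" "s + of_real r * x \<noteq> 0" if "x \<in> cball 0 1" for x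
    proof -
      have rx: "cmod (of_real r * x) \<le> r" using that r by (simp add: norm_mult mult_left_le)
      have "cmod (s + of_real r * x) \<le> cmod s + r" using rx norm_triangle_ineq[of s "of_real r * x"] by linarith
      also have "\<dots> < 1" using s by (simp add: r_def field_simps)
      finally show "cmod (s + of_real r * x) < 1" .
      show "s + of_real r * x \<noteq> 0"
      proof
        assume "s + of_real r * x = 0"
        then have "cmod s = cmod (of_real r * x)" by (metis add_eq_0_iff norm_minus_cancel)
        then show False using rx s by (simp add: r_def)
      qed
    qed
    have holf: "f holomorphic_on cball 0 1"
    proof -
      have "(V \<circ> (\<lambda>x. s + of_real r * x)) holomorphic_on cball 0 1"
        by (intro holomorphic_on_compose_gen[OF _ V_hol] holomorphic_intros) (use dom in auto)
      then show ?thesis unfolding f_def using ab by (intro holomorphic_intros) (auto simp: o_def)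
    qed
    have f0: "norm (f 0) \<le> 1 / \<theta>"
      using b dpos th by (simp add: f_def norm_divide d_def dist_norm norm_minus_commute)
    have nf: "\<not> (f x = 0 \<or> f x = 1)" if "x \<in> cball 0 1" for x
    proof -
      have "V (s + of_real r * x) \<in> Ext" using V_Ext dom[OF that] by blast
      then show ?thesis using a b ab notin_closure_G by (auto simp: f_def)
    qed
    have fb: "norm (f x) \<le> S" if "norm x \<le> 1/2" for x
      unfolding S_def using Schottky[OF holf f0 nf, of "1/2" x] that by auto
    have "cmod ((deriv ^^ 1) f 0) \<le> fact 1 * S / (1/2)^1"
    proof (rule Cauchy_inequality)
      show "f holomorphic_on ball 0 (1/2)" "continuous_on (cball 0 (1/2)) f"
        by (auto intro!: holomorphic_on_imp_continuous_on intro: holomorphic_on_subset[OF holf])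
    qed (use fb in auto)
    then have df: "cmod (deriv f 0) \<le> 2 * S" by simp
    have "(f has_field_derivative (of_real r * deriv V s) / (b - a)) (at 0)"
    proof -
      have "((\<lambda>x. V (s + of_real r * x)) has_field_derivative deriv V s * of_real r) (at 0)"
        by (rule DERIV_chain2[where f=V]) (use V_field_deriv[of s] s s0 in \<open>auto intro!: derivative_eq_intros\<close>)
      then show ?thesis unfolding f_def using ab by (auto intro!: derivative_eq_intros)
    qed
    then have "deriv f 0 = (of_real r * deriv V s) / (b - a)" by (rule DERIV_imp_deriv)
    then have "r * cmod (deriv V s) / (\<theta> * d) \<le> 2 * S"
      using df r b by (simp add: norm_divide norm_mult dist_norm norm_minus_commute)
    then have "r * cmod (deriv V s) \<le> 2 * S * (\<theta> * d)" using th dpos by (simp add: pos_divide_le_eq)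
    also have "\<dots> \<le> 2 * S * d" using th dpos S by (simp add: mult_left_le_one_le)
    finally have "3/4 * (cmod (deriv V s) * (1 - cmod s)) \<le> 2 * S * d" by (simp add: r_def algebra_simps)
    moreover have "S * d \<ge> 0" using S dpos by simp
    ultimately have "cmod (deriv V s) * (1 - cmod s) \<le> 4 * (S * d)" by linarith
    then show ?thesis using a by (simp add: d_def)
  qed
  then show ?thesis using S by (intro exI[of _ "4 * S"]) auto
qed

section \<open>The kernel attached to a point of the closure of G and its distortion\<close>

definition phi1 :: "complex \<Rightarrow> complex" where
  "phi1 s = (if s = 0 then deriv \<phi> 0 else \<phi> s / s)"

text \<open>For s different from 0 this is 1 / (s (V s - w)), see \<open>kappa_V\<close>. In this
  form the pole of \<open>V\<close> at 0 has disappeared: \<open>kappa w 0 = deriv \<phi> 0\<close>,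
  so the kernel is holomorphic and zero-free on the whole disc.\<close>

definition kappa :: "complex \<Rightarrow> complex \<Rightarrow> complex" where
  "kappa w s = phi1 s / (1 - (w - w0) * \<phi> s)"

lemma phi1_hol: "phi1 holomorphic_on ball 0 1"
proof -
  have "(\<lambda>z. if z = 0 then deriv \<phi> 0 else (\<phi> z - \<phi> 0) / (z - 0)) holomorphic_on ball 0 1"
    by (rule pole_lemma[OF phi_hol]) auto
  moreover have "phi1 = (\<lambda>z. if z = 0 then deriv \<phi> 0 else (\<phi> z - \<phi> 0) / (z - 0))"
    by (rule ext) (simp add: phi1_def phi_0)
  ultimately show ?thesis by simp
qed

lemma kappa_denominator:
  assumes "w \<in> closure G" "cmod s < 1" shows "1 - (w - w0) * \<phi> s \<noteq> 0"
proof
  assume eq: "1 - (w - w0) * \<phi> s = 0"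
  then have "s \<noteq> 0" using phi_0 by auto
  moreover have "\<phi> s \<noteq> 0" using eq by auto
  then have "w = V s" using eq by (simp add: V_def field_simps)
  ultimately show False using V_Ext assms by auto
qed

lemma kappa_hol: "w \<in> closure G \<Longrightarrow> kappa w holomorphic_on ball 0 1"
  unfolding kappa_def using kappa_denominator
  by (intro holomorphic_intros phi1_hol phi_hol) auto

lemma kappa_nz: "w \<in> closure G \<Longrightarrow> cmod s < 1 \<Longrightarrow> kappa w s \<noteq> 0"
  using kappa_denominator phi_nz dphi_0 by (auto simp: kappa_def phi1_def)

lemma kappa_V:
  assumes "w \<in> closure G" "cmod s < 1" "s \<noteq> 0" shows "kappa w s = 1 / (s * (V s - w))"
proof -
  have "\<phi> s \<noteq> 0" using phi_nz assms by blast
  then have "V s - w = (1 - (w - w0) * \<phi> s) / \<phi> s" by (simp add: V_def field_simps)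
  then show ?thesis using assms by (simp add: kappa_def phi1_def)
qed

text \<open>The logarithmic derivative of the kernel is - (1 / s + V'(s) / (V s - w)), and
  \<open>V_deriv_bound\<close> controls V' by the distance of \<open>V s\<close> to
  \<open>L\<close>, which is at most |V s - w| for every admissible \<open>w\<close>. Hence the
  constant is uniform in \<open>w\<close>. The inner disc is reached by the maximum
  principle.\<close>

lemma kappa_bloch:
  "\<exists>A>0. \<forall>w\<in>closure G. \<forall>s. cmod s < 1 \<longrightarrow> cmod (deriv (kappa w) s) * (1 - cmod s) \<le> A * cmod (kappa w s)"
proof -
  obtain A where A: "A > 0" "\<And>s. 1/2 \<le> cmod s \<Longrightarrow> cmod s < 1 \<Longrightarrow> cmod (deriv V s) * (1 - cmod s) \<le> A * infdist (V s) L"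
    using V_deriv_bound by auto
  have outer: "cmod (deriv (kappa w) s) * (1 - cmod s) \<le> (A + 1) * cmod (kappa w s)"
    if w: "w \<in> closure G" and s: "1/2 \<le> cmod s" "cmod s < 1" for w s
  proof -
    have s0: "s \<noteq> 0" using s by auto
    have VE: "V s \<in> Ext" using V_Ext s s0 by blast
    then have ne: "V s - w \<noteq> 0" using w by auto
    have "((\<lambda>s. 1 / (s * (V s - w))) has_field_derivative
        - ((V s - w) + s * deriv V s) / (s * (V s - w))\<^sup>2) (at s)"
      using V_field_deriv[OF s(2) s0] s0 ne by (auto intro!: derivative_eq_intros simp: power2_eq_square)
    then have "(kappa w has_field_derivative - ((V s - w) + s * deriv V s) / (s * (V s - w))\<^sup>2) (at s)"
      by (rule has_field_derivative_transform_within_open[where S="ball 0 1 - {0}"])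
         (use s s0 kappa_V[OF w] in auto)
    then have "deriv (kappa w) s = - ((V s - w) + s * deriv V s) / (s * (V s - w))\<^sup>2" by (rule DERIV_imp_deriv)
    also have "\<dots> = - kappa w s * (1 / s + deriv V s / (V s - w))"
    proof -
      have "- (v + s * d) / (s * v)\<^sup>2 = - (1 / (s * v)) * (1 / s + d / v)" if "v \<noteq> 0" for v d
        using that s0 by (simp add: power2_eq_square field_simps)
      from this[OF ne] show ?thesis unfolding kappa_V[OF w s(2) s0] .
    qed
    finally have "cmod (deriv (kappa w) s) = cmod (kappa w s) * cmod (1 / s + deriv V s / (V s - w))"
      by (simp add: norm_mult)
    also have "\<dots> * (1 - cmod s) \<le> cmod (kappa w s) * (A + 1)"
      unfolding mult.assoc
    proof (intro mult_left_mono)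
      have "cmod (1 / s + deriv V s / (V s - w)) * (1 - cmod s)
          \<le> (1 / cmod s + cmod (deriv V s) / cmod (V s - w)) * (1 - cmod s)"
        using s norm_triangle_ineq[of "1 / s" "deriv V s / (V s - w)"]
        by (intro mult_right_mono) (auto simp: norm_divide)
      also have "\<dots> = (1 - cmod s) / cmod s + cmod (deriv V s) * (1 - cmod s) / cmod (V s - w)"
        by (simp add: algebra_simps)
      also have "\<dots> \<le> 1 + A"
      proof (intro add_mono)
        show "(1 - cmod s) / cmod s \<le> 1" using s s0 by (simp add: divide_le_eq_1_pos)
        have "infdist (V s) L \<le> cmod (V s - w)"
          using infdist_le_dist_closure[OF VE w] by (simp add: dist_norm)
        then have "cmod (deriv V s) * (1 - cmod s) \<le> A * cmod (V s - w)"
          using A(2)[OF s] A(1) by (smt (verit) mult_left_mono)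
        then show "cmod (deriv V s) * (1 - cmod s) / cmod (V s - w) \<le> A"
          using ne by (simp add: pos_divide_le_eq)
      qed
      finally show "cmod (1 / s + deriv V s / (V s - w)) * (1 - cmod s) \<le> A + 1" by simp
    qed auto
    finally show ?thesis by (simp add: mult.commute)
  qed
  \<comment> \<open>The factor 2 comes from the circle |z| = 1/2, where 1 - |z| = 1/2 and from which
    the bound is carried inward.\<close>
  have "cmod (deriv (kappa w) s) * (1 - cmod s) \<le> (2 * (A + 1)) * cmod (kappa w s)"
    if w: "w \<in> closure G" and s: "cmod s < 1" for w s
  proof (cases "1/2 \<le> cmod s")
    case True
    have "(A + 1) * cmod (kappa w s) \<le> (2 * (A + 1)) * cmod (kappa w s)" using A by (intro mult_right_mono) auto
    then show ?thesis using outer[OF w True s] by linarith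
  next
    case False
    have hq: "(\<lambda>s. deriv (kappa w) s / kappa w s) holomorphic_on ball 0 1"
      using kappa_nz[OF w] by (intro holomorphic_intros kappa_hol w) auto
    have "cmod (deriv (kappa w) s / kappa w s) \<le> 2 * (A + 1)"
    proof (rule maximum_modulus_frontier[where S="ball 0 (1/2)" and f="\<lambda>s. deriv (kappa w) s / kappa w s"])
      show "(\<lambda>s. deriv (kappa w) s / kappa w s) holomorphic_on interior (ball 0 (1/2))"
        by (rule holomorphic_on_subset[OF hq]) auto
      show "continuous_on (closure (ball 0 (1/2))) (\<lambda>s. deriv (kappa w) s / kappa w s)"
        by (rule holomorphic_on_imp_continuous_on[OF holomorphic_on_subset[OF hq]]) auto
      show "s \<in> ball 0 (1/2)" using False by simp
      fix z :: complex assume "z \<in> frontier (ball 0 (1/2))"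
      then have z: "cmod z = 1/2" by simp
      then show "cmod (deriv (kappa w) z / kappa w z) \<le> 2 * (A + 1)"
        using outer[OF w, of z, unfolded z] kappa_nz[OF w, of z] by (simp add: norm_divide pos_divide_le_eq algebra_simps)
    qed simp
    then have "cmod (deriv (kappa w) s) \<le> (2 * (A + 1)) * cmod (kappa w s)"
      using kappa_nz[OF w s] by (simp add: norm_divide pos_divide_le_eq)
    moreover have "cmod (deriv (kappa w) s) * (1 - cmod s) \<le> cmod (deriv (kappa w) s) * 1"
      by (intro mult_left_mono) auto
    ultimately show ?thesis by linarith
  qed
  then show ?thesis using A by (intro exI[of _ "2 * (A + 1)"]) auto
qed

text \<open>The common source of the later power laws: with \<open>w\<close> on \<open>L\<close> it
  compares the distances |V s - w| and |V t - w|, and with \<open>w\<close> in the closure of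
  \<open>G\<close> it controls the kernel that is approximated by polynomials.\<close>

lemma kappa_distortion:
  "\<exists>K::nat>0. \<forall>w\<in>closure G. \<forall>s t. cmod s < 1 \<longrightarrow> cmod t < 1 \<longrightarrow>
     cmod (kappa w s) \<le> (2 * hypdist s t) ^ K * cmod (kappa w t)"
proof -
  obtain A where A: "A > 0" "\<And>w s. w \<in> closure G \<Longrightarrow> cmod s < 1 \<Longrightarrow>
      cmod (deriv (kappa w) s) * (1 - cmod s) \<le> A * cmod (kappa w s)"
    using kappa_bloch by auto
  obtain K where K: "2 * A \<le> real K" using real_arch_simple by blast
  have "cmod (kappa w s) \<le> (2 * hypdist s t) ^ K * cmod (kappa w t)"
    if w: "w \<in> closure G" and "cmod s < 1" "cmod t < 1" for w s t
    by (rule nonvanishing_distortion[where A=A]) (use kappa_hol[OF w] kappa_nz[OF w] A(2)[OF w] K that in auto)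
  moreover have "K > 0" using K A(1) by (cases K) auto
  ultimately show ?thesis by blast
qed

end

section \<open>Polynomial approximation of the Cauchy kernel\<close>

lemma of_real_cmod_power2: "(complex_of_real (cmod z))\<^sup>2 = z * cnj z"
  by (metis complex_norm_square of_real_power)

text \<open>On the unit circle |1 - a z|^2 = (1 - a z) (z - cnj a) / z, so the mean is a Cauchy
  integral of 1 / (1 - a z) evaluated at \<open>cnj a\<close>.\<close>

lemma poisson_mean:
  fixes a :: complex assumes a: "cmod a < 1"
  shows "((\<lambda>t. 1 / (cmod (1 - a * exp (2 * of_real pi * \<i> * of_real t)))\<^sup>2) has_integral 1 / (1 - (cmod a)\<^sup>2)) {0..1}"
proof -
  have nz: "1 - a * z \<noteq> 0" if "cmod z \<le> 1" for z
  proof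
    assume "1 - a * z = 0"
    then have "cmod a * cmod z = 1" by (metis eq_iff_diff_eq_0 norm_mult norm_one)
    then show False using a that mult_left_le[of "cmod z" "cmod a"] by simp
  qed
  have "((\<lambda>z. (1 / (1 - a * z)) / (z - cnj a)) has_contour_integral (2 * of_real pi * \<i> * (1 / (1 - a * cnj a)))) (circlepath 0 1)"
    by (rule Cauchy_integral_circlepath_simple) (use a nz in \<open>auto intro!: holomorphic_intros\<close>)
  then have int: "((\<lambda>t. (1 / (1 - a * circlepath 0 1 t)) / (circlepath 0 1 t - cnj a) * vector_derivative (circlepath 0 1) (at t))
      has_integral (2 * of_real pi * \<i> * (1 / (1 - a * cnj a)))) {0..1}"
    by (simp add: has_contour_integral)
  have eq: "(1 / (1 - a * circlepath 0 1 t)) / (circlepath 0 1 t - cnj a) * vector_derivative (circlepath 0 1) (at t)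
      = (2 * of_real pi * \<i>) * of_real (1 / (cmod (1 - a * exp (2 * of_real pi * \<i> * of_real t)))\<^sup>2)" for t
  proof -
    define z where "z = exp (2 * of_real pi * \<i> * of_real t)"
    have z1: "cmod z = 1" by (simp add: z_def norm_exp_eq_Re)
    then have zz: "z * cnj z = 1" by (simp add: of_real_cmod_power2[symmetric])
    have "z - cnj a = z * cnj (1 - a * z)" using zz by (simp add: algebra_simps)
    moreover have "z \<noteq> 0" "1 - a * z \<noteq> 0" "cnj (1 - a * z) \<noteq> 0" using z1 nz[of z] by (auto simp del: complex_cnj_diff complex_cnj_mult)
    moreover have "of_real (1 / (cmod (1 - a * z))\<^sup>2) = 1 / ((1 - a * z) * cnj (1 - a * z))"
      by (simp only: of_real_divide of_real_1 of_real_power of_real_cmod_power2)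
    ultimately show ?thesis
      by (simp only: vector_derivative_circlepath) (simp add: circlepath flip: z_def del: complex_cnj_diff complex_cnj_mult of_real_divide of_real_power)
  qed
  have "((\<lambda>t. complex_of_real (1 / (cmod (1 - a * exp (2 * of_real pi * \<i> * of_real t)))\<^sup>2))
      has_integral of_real (1 / (1 - (cmod a)\<^sup>2))) {0..1}"
    using has_integral_mult_right[OF int[unfolded eq], of "1 / (2 * of_real pi * \<i>)"]
    by (simp add: of_real_cmod_power2)
  from has_integral_Re[OF this] show ?thesis by simp
qed

text \<open>Cauchy's formula on |z| = r, where \<open>poisson_mean\<close> gives the mean of the
  majorant. Compared with its maximum, which is of order 1 / (1 - r |s|)^2, the mean saves one power
  of the boundary distance.\<close>

lemma taylor_coeff_bound:
  assumes holf: "f holomorphic_on ball 0 1" and r: "0 < r" "r < 1" and s: "cmod s < 1"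
    and bd: "\<And>z. cmod z = r \<Longrightarrow> cmod (f z) \<le> M / (cmod (1 - cnj s * z))\<^sup>2"
  shows "cmod ((deriv ^^ k) f 0 / fact k) \<le> M / (1 - (r * cmod s)\<^sup>2) / r ^ k"
proof -
  have "((\<lambda>u. f u / (u - 0) ^ Suc k) has_contour_integral ((2 * pi * \<i>) / fact k * (deriv ^^ k) f 0)) (circlepath 0 r)"
    by (rule Cauchy_has_contour_integral_higher_derivative_circlepath)
       (use r in \<open>auto intro!: holomorphic_on_imp_continuous_on intro: holomorphic_on_subset[OF holf]\<close>)
  then have int: "((\<lambda>t. f (circlepath 0 r t) / (circlepath 0 r t) ^ Suc k * vector_derivative (circlepath 0 r) (at t))
      has_integral ((2 * pi * \<i>) / fact k * (deriv ^^ k) f 0)) {0..1}"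
    by (simp add: has_contour_integral)
  let ?e = "\<lambda>t. exp (2 * of_real pi * \<i> * of_real t)"
  have eq: "f (circlepath 0 r t) / (circlepath 0 r t) ^ Suc k * vector_derivative (circlepath 0 r) (at t)
      = (2 * of_real pi * \<i>) * (f (of_real r * ?e t) / (of_real r * ?e t) ^ k)" for t
    using r by (simp only: vector_derivative_circlepath) (simp add: circlepath)
  have int2: "((\<lambda>t. f (of_real r * ?e t) / (of_real r * ?e t) ^ k) has_integral (deriv ^^ k) f 0 / fact k) {0..1}"
    using has_integral_mult_right[OF int[unfolded eq], of "1 / (2 * of_real pi * \<i>)"] by simp
  have rs: "cmod (cnj s * of_real r) < 1" using r s by (simp add: norm_mult) (metis mult_less_cancel_right2 mult_strict_mono' norm_ge_zero mult.right_neutral order_less_imp_le zero_le_one)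
  have int3: "((\<lambda>t. M / r ^ k * (1 / (cmod (1 - (cnj s * of_real r) * ?e t))\<^sup>2)) has_integral
      M / r ^ k * (1 / (1 - (cmod (cnj s * of_real r))\<^sup>2))) {0..1}"
    by (intro has_integral_mult_right poisson_mean rs)
  have "cmod (integral {0..1} (\<lambda>t. f (of_real r * ?e t) / (of_real r * ?e t) ^ k))
      \<le> integral {0..1} (\<lambda>t. M / r ^ k * (1 / (cmod (1 - (cnj s * of_real r) * ?e t))\<^sup>2))"
  proof (rule integral_norm_bound_integral)
    show "(\<lambda>t. f (of_real r * ?e t) / (of_real r * ?e t) ^ k) integrable_on {0..1}"
      using int2 by blast
    show "(\<lambda>t. M / r ^ k * (1 / (cmod (1 - (cnj s * of_real r) * ?e t))\<^sup>2)) integrable_on {0..1}"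
      using int3 by blast
    fix t :: real assume "t \<in> {0..1}"
    have e1: "cmod (?e t) = 1" by (simp add: norm_exp_eq_Re)
    have "cmod (f (of_real r * ?e t)) \<le> M / (cmod (1 - cnj s * (of_real r * ?e t)))\<^sup>2"
      by (rule bd) (use r e1 in \<open>simp add: norm_mult\<close>)
    then have "cmod (f (of_real r * ?e t)) / r ^ k \<le> M / (cmod (1 - cnj s * (of_real r * ?e t)))\<^sup>2 / r ^ k"
      using r by (intro divide_right_mono) auto
    then show "cmod (f (of_real r * ?e t) / (of_real r * ?e t) ^ k)
        \<le> M / r ^ k * (1 / (cmod (1 - (cnj s * of_real r) * ?e t))\<^sup>2)"
      using r e1 by (simp add: norm_divide norm_mult norm_power mult.assoc field_simps)
  qed
  then have "cmod ((deriv ^^ k) f 0 / fact k) \<le> M / r ^ k * (1 / (1 - (cmod (cnj s * of_real r))\<^sup>2))"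
    using int2 int3 by (simp add: integral_unique)
  then show ?thesis using r by (simp add: norm_mult mult.commute)
qed

text \<open>The terms at \<open>s\<close> are bounded by M \<delta> q^k with \<delta> = 1 - |s| and
  q <= 1 - \<delta>/2. The factor \<delta> compensates for the roughly 1/\<delta> relevant terms of
  the geometric series, so the tail is small as soon as N \<delta> is a large constant.\<close>

lemma taylor_tail_bound:
  assumes holf: "f holomorphic_on ball 0 1" and s: "1/2 \<le> cmod s" "cmod s < 1" and M: "M \<ge> 0"
    and bd: "\<And>z. cmod z = (1 + cmod s) / 2 \<Longrightarrow> cmod (f z) \<le> M * (1 - cmod s)\<^sup>2 / (cmod (1 - cnj s * z))\<^sup>2"
  shows "cmod (f s - (\<Sum>k<N. (deriv ^^ k) f 0 / fact k * s ^ k)) \<le> 2 * M * exp (- real N * (1 - cmod s) / 2)"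
proof -
  define \<delta> where "\<delta> = 1 - cmod s"
  have d: "0 < \<delta>" "\<delta> \<le> 1/2" using s by (auto simp: \<delta>_def)
  define r where "r = (1 + cmod s) / 2"
  have r: "0 < r" "r < 1" "r = 1 - \<delta> / 2" "cmod s = 1 - \<delta>" using s by (auto simp: r_def \<delta>_def field_simps)
  define c where "c k = (deriv ^^ k) f 0 / fact k" for k
  define q where "q = cmod s / r"
  have q: "0 \<le> q" "q \<le> 1 - \<delta> / 2"
  proof -
    show "0 \<le> q" unfolding q_def using r(1) by (intro divide_nonneg_pos norm_ge_zero)
    have "1 - \<delta> \<le> (1 - \<delta> / 2) * (1 - \<delta> / 2)" by (simp add: algebra_simps)
    then show "q \<le> 1 - \<delta> / 2" unfolding q_def using r by (simp add: pos_divide_le_eq)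
  qed
  have q1: "q < 1" using q d by simp
  have cb: "cmod (c k * s ^ k) \<le> M * \<delta> * q ^ k" for k
  proof -
    have "cmod (c k) \<le> M * \<delta>\<^sup>2 / (1 - (r * cmod s)\<^sup>2) / r ^ k"
      unfolding c_def by (rule taylor_coeff_bound[OF holf r(1,2) s(2)]) (use bd in \<open>simp add: r_def \<delta>_def\<close>)
    also have "\<dots> \<le> M * \<delta>\<^sup>2 / \<delta> / r ^ k"
    proof (intro divide_right_mono divide_left_mono)
      have "(r * cmod s)\<^sup>2 \<le> (cmod s)\<^sup>2" using r(1,2) by (intro power_mono mult_nonneg_nonneg mult_left_le_one_le) auto
      also have "\<dots> \<le> cmod s" using s by (simp add: power2_eq_square mult_left_le)
      finally have *: "\<delta> \<le> 1 - (r * cmod s)\<^sup>2" by (simp add: \<delta>_def)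
      then show "\<delta> \<le> 1 - (r * cmod s)\<^sup>2" .
      show "0 < (1 - (r * cmod s)\<^sup>2) * \<delta>" using * d by simp
    qed (use r M in auto)
    also have "\<dots> = M * \<delta> / r ^ k" using d by (simp add: power2_eq_square)
    finally have "cmod (c k) * cmod s ^ k \<le> M * \<delta> / r ^ k * cmod s ^ k" by (intro mult_right_mono) auto
    then show ?thesis by (simp add: norm_mult norm_power q_def power_divide)
  qed
  have "(\<lambda>k. c k * (s - 0) ^ k) sums f s" unfolding c_def
    by (rule holomorphic_power_series[OF holf]) (use s in auto)
  then have sm: "(\<lambda>k. c k * s ^ k) sums f s" by simp
  have geo: "(\<lambda>k. M * \<delta> * q ^ N * q ^ k) sums (M * \<delta> * q ^ N * (1 / (1 - q)))"
    by (intro sums_mult geometric_sums) (use q q1 in auto)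
  have "f s - (\<Sum>k<N. c k * s ^ k) = (\<Sum>k. c (k + N) * s ^ (k + N))"
    using suminf_minus_initial_segment[of "\<lambda>k. c k * s ^ k" N] sm by (simp add: sums_iff)
  also have "cmod \<dots> \<le> (\<Sum>k. M * \<delta> * q ^ N * q ^ k)"
  proof (rule norm_suminf_le)
    show "cmod (c (k + N) * s ^ (k + N)) \<le> M * \<delta> * q ^ N * q ^ k" for k
      using cb[of "k + N"] by (simp add: power_add mult_ac)
    show "summable (\<lambda>k. M * \<delta> * q ^ N * q ^ k)" using geo by (rule sums_summable)
  qed
  also have "\<dots> = M * \<delta> * q ^ N / (1 - q)" using geo by (simp add: sums_iff)
  also have "\<dots> \<le> M * \<delta> * q ^ N / (\<delta> / 2)" using q d M by (intro divide_left_mono) auto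
  also have "\<dots> = 2 * M * q ^ N" using d by simp
  also have "\<dots> \<le> 2 * M * exp (- real N * \<delta> / 2)"
  proof (intro mult_left_mono)
    have "q \<le> exp (- \<delta> / 2)" using q(2) exp_ge_add_one_self[of "- \<delta> / 2"] by simp
    then have "q ^ N \<le> exp (- \<delta> / 2) ^ N" using q by (intro power_mono) auto
    then show "q ^ N \<le> exp (- real N * \<delta> / 2)" by (simp flip: exp_of_nat_mult)
  qed (use M in auto)
  finally show ?thesis by (simp add: c_def \<delta>_def)
qed

context exterior_chart begin

definition fker :: "complex \<Rightarrow> complex \<Rightarrow> complex" where "fker w s = \<phi> s / (1 - (w - w0) * \<phi> s)"

lemma fker_hol: "w \<in> closure G \<Longrightarrow> fker w holomorphic_on ball 0 1"
  unfolding fker_def using kappa_denominator by (intro holomorphic_intros phi_hol) auto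

lemma fker_kappa: "fker w s = s * kappa w s"
  using phi_0 by (simp add: fker_def kappa_def phi1_def)

text \<open>Comparing coefficients in fker = \<phi> + (w - w0) fker \<phi> gives a recursion in
  which each coefficient is a combination of earlier ones times w - w0, because \<phi> 0 = 0; so the
  degree grows by at most one per step. For k >= 1 the coefficient is F_k' / k with F_k the Faber
  polynomial of degree k.\<close>

lemma fker_coeff_poly:
  "\<exists>q. degree q \<le> k \<and> (\<forall>w\<in>closure G. fps_nth (fps_expansion (fker w) 0) k = poly q w)"
proof (induction k rule: less_induct)
  case (less k)
  define P where "P = fps_expansion \<phi> 0"
  have P: "\<phi> has_fps_expansion P" unfolding P_def
    by (rule has_fps_expansion_fps_expansion[OF open_ball _ phi_hol]) auto
  have P0: "fps_nth P 0 = 0" by (simp add: P_def fps_expansion_def phi_0)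
  have rec: "fps_nth (fps_expansion (fker w) 0) n
      = fps_nth P n + (w - w0) * (\<Sum>i<n. fps_nth (fps_expansion (fker w) 0) i * fps_nth P (n - i))"
    if w: "w \<in> closure G" for w n
  proof -
    define F where "F = fps_expansion (fker w) 0"
    have F: "fker w has_fps_expansion F" unfolding F_def
      by (rule has_fps_expansion_fps_expansion[OF open_ball _ fker_hol[OF w]]) auto
    have "(\<lambda>s. \<phi> s + (w - w0) * (fker w s * \<phi> s)) has_fps_expansion P + fps_const (w - w0) * (F * P)"
      by (intro has_fps_expansion_add has_fps_expansion_mult P F has_fps_expansion_const)
    moreover have "eventually (\<lambda>s. \<phi> s + (w - w0) * (fker w s * \<phi> s) = fker w s) (nhds 0)"
    proof -
      have "eventually (\<lambda>s. s \<in> ball 0 1) (nhds (0::complex))" by (rule eventually_nhds_in_open) auto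
      then show ?thesis
      proof eventually_elim
        case (elim s)
        then have "1 - (w - w0) * \<phi> s \<noteq> 0" using kappa_denominator[OF w, of s] by simp
        then have "\<phi> s = fker w s * (1 - (w - w0) * \<phi> s)" by (simp add: fker_def)
        then show ?case by (simp add: algebra_simps)
      qed
    qed
    ultimately have "fker w has_fps_expansion P + fps_const (w - w0) * (F * P)"
      by (simp only: has_fps_expansion_cong[OF _ refl])
    then have eq: "F = P + fps_const (w - w0) * (F * P)"
      using F fps_expansion_unique_complex by blast
    have "fps_nth F n = fps_nth P n + (w - w0) * (\<Sum>i=0..n. fps_nth F i * fps_nth P (n - i))"
      by (subst eq) (simp add: fps_mult_nth[of F P])
    also have "(\<Sum>i=0..n. fps_nth F i * fps_nth P (n - i)) = (\<Sum>i<n. fps_nth F i * fps_nth P (n - i))"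
      using P0 by (simp add: atLeast0AtMost flip: lessThan_Suc_atMost)
    finally show ?thesis by (simp add: F_def)
  qed
  from less have "\<forall>i\<in>{..<k}. \<exists>q. degree q \<le> i \<and> (\<forall>w\<in>closure G. fps_nth (fps_expansion (fker w) 0) i = poly q w)"
    by auto
  then obtain q where q: "\<And>i. i < k \<Longrightarrow> degree (q i) \<le> i"
    "\<And>i w. i < k \<Longrightarrow> w \<in> closure G \<Longrightarrow> fps_nth (fps_expansion (fker w) 0) i = poly (q i) w"
    by (auto dest!: bchoice)
  define Q where "Q = [:fps_nth P k:] + [:- w0, 1:] * (\<Sum>i<k. smult (fps_nth P (k - i)) (q i))"
  have "degree Q \<le> k"
  proof (cases "k = 0")
    case False
    have "degree (\<Sum>i<k. smult (fps_nth P (k - i)) (q i)) \<le> k - 1"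
      by (intro degree_sum_le) (use q(1) in \<open>auto intro!: order.trans[OF degree_smult_le] intro: order.trans[OF q(1)]\<close>)
    then have "degree ([:- w0, 1:] * (\<Sum>i<k. smult (fps_nth P (k - i)) (q i))) \<le> 1 + (k - 1)"
      by (intro order.trans[OF degree_mult_le] add_mono) auto
    then show ?thesis unfolding Q_def using False by (intro degree_add_le) auto
  qed (simp add: Q_def)
  moreover have "fps_nth (fps_expansion (fker w) 0) k = poly Q w" if "w \<in> closure G" for w
    using rec[OF that, of k] q(2)[OF _ that] by (simp add: Q_def poly_sum mult.commute algebra_simps)
  ultimately show ?case by blast
qed

lemma fker_mult_coeff_poly:
  assumes B: "B holomorphic_on ball 0 1"
  shows "\<exists>q. degree q \<le> k \<and> (\<forall>w\<in>closure G. (deriv ^^ k) (\<lambda>s. fker w s * B s) 0 / fact k = poly q w)"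
proof -
  define Bf where "Bf = fps_expansion B 0"
  have Bf: "B has_fps_expansion Bf" unfolding Bf_def
    by (rule has_fps_expansion_fps_expansion[OF open_ball _ B]) auto
  obtain q where q: "\<And>i. degree (q i) \<le> i"
    "\<And>i w. w \<in> closure G \<Longrightarrow> fps_nth (fps_expansion (fker w) 0) i = poly (q i) w"
    using fker_coeff_poly by metis
  define Q where "Q = (\<Sum>i\<le>k. smult (fps_nth Bf (k - i)) (q i))"
  have "degree Q \<le> k" unfolding Q_def
    by (intro degree_sum_le) (use q(1) in \<open>auto intro!: order.trans[OF degree_smult_le] intro: order.trans[OF q(1)]\<close>)
  moreover have "(deriv ^^ k) (\<lambda>s. fker w s * B s) 0 / fact k = poly Q w" if w: "w \<in> closure G" for w
  proof -
    define F where "F = fps_expansion (fker w) 0"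
    have F: "fker w has_fps_expansion F" unfolding F_def
      by (rule has_fps_expansion_fps_expansion[OF open_ball _ fker_hol[OF w]]) auto
    have "(\<lambda>s. fker w s * B s) has_fps_expansion F * Bf"
      by (rule has_fps_expansion_mult[OF F Bf])
    then have "fps_nth (F * Bf) k = (deriv ^^ k) (\<lambda>s. fker w s * B s) 0 / fact k"
      by (rule fps_nth_fps_expansion)
    then have "(deriv ^^ k) (\<lambda>s. fker w s * B s) 0 / fact k = (\<Sum>i\<le>k. fps_nth F i * fps_nth Bf (k - i))"
      by (simp add: fps_mult_nth atLeast0AtMost)
    also have "\<dots> = poly Q w"
      using q(2)[OF w] by (simp add: F_def Q_def poly_sum mult.commute)
    finally show ?thesis .
  qed
  ultimately show ?thesis by blast
qed

text \<open>The kernel \<open>1 / (V s - w)\<close> is the value at \<open>s\<close> of \<open>fker w\<close>. Before taking a Taylor section we multiply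
  by a high power of \<open>(1 - |s|\<^sup>2) / (1 - cnj s * x)\<close>, which is \<open>1\<close> at \<open>x = s\<close> and beats the polynomial growth
  of \<open>fker w\<close> away from \<open>s\<close>.\<close>
lemma poly_kernel:
  "\<exists>M>0. \<forall>s N. 1/2 \<le> cmod s \<longrightarrow> cmod s < 1 \<longrightarrow> M \<le> real N * (1 - cmod s) \<longrightarrow>
     (\<exists>p. degree p \<le> N \<and> (\<forall>w\<in>closure G. cmod (poly p w - 1 / (V s - w)) \<le> 1/2 * (1 / cmod (V s - w))))"
proof -
  obtain K where K: "\<And>w s t. w \<in> closure G \<Longrightarrow> cmod s < 1 \<Longrightarrow> cmod t < 1 \<Longrightarrow>
     cmod (kappa w s) \<le> (2 * hypdist s t) ^ K * cmod (kappa w t)"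
    using kappa_distortion by blast
  \<comment> \<open>With \<open>M = 8 ^ (K + 1) / cmod (V s - w)\<close> below,
    \<open>2 * M / A\<close> is exactly half of 1 / |V s - w|. The threshold \<open>2 * ln A\<close>
    makes the exponential in the tail bound at most \<open>1 / A\<close>.\<close>
  define A :: real where "A = 4 * 8 ^ (K + 1)"
  have A: "A \<ge> 2" using one_le_power[of "8::real" "K+1"] by (simp add: A_def)
  have "\<exists>p. degree p \<le> N \<and> (\<forall>w\<in>closure G. cmod (poly p w - 1 / (V s - w)) \<le> 1/2 * (1 / cmod (V s - w)))"
    if s: "1/2 \<le> cmod s" "cmod s < 1" and N: "2 * ln A \<le> real N * (1 - cmod s)" for s N
  proof -
    have s0: "s \<noteq> 0" using s by auto
    define e where "e = 1 - (cmod s)\<^sup>2"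
    \<comment> \<open>Of the exponent, 2 K cancels the K-th power of \<open>hypdist\<close>, which
      is quadratic in |1 - cnj s x|; the remaining 2 produces the majorant of
      \<open>taylor_tail_bound\<close>.\<close>
    define B where "B x = (of_real e / (1 - cnj s * x)) ^ (2 * K + 2)" for x
    have e: "0 < e" "e \<le> 2 * (1 - cmod s)"
    proof -
      have "e = (1 - cmod s) * (1 + cmod s)" by (simp add: e_def power2_eq_square algebra_simps)
      also have "\<dots> \<le> (1 - cmod s) * 2" using s by (intro mult_left_mono) auto
      finally show "e \<le> 2 * (1 - cmod s)" by simp
      show "0 < e" using s by (simp add: e_def power_less_one_iff)
    qed
    have nz: "1 - cnj s * x \<noteq> 0" if "cmod x < 1" for x
      using norm_mult_less[of "cnj s" 1 x 1] s that by auto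
    have Bhol: "B holomorphic_on ball 0 1" unfolding B_def using nz by (intro holomorphic_intros) auto
    have "of_real e = 1 - cnj s * s" by (simp add: e_def of_real_cmod_power2 mult.commute)
    then have Bs: "B s = 1" using nz[OF s(2)] by (simp add: B_def)
    define r where "r = (1 + cmod s) / 2"
    have r: "0 < r" "r < 1" using s by (auto simp: r_def)
    have r2: "(1 - cmod s) / 2 \<le> 1 - r\<^sup>2" 
    proof -
      have "r\<^sup>2 \<le> r" using r by (simp add: power2_eq_square mult_left_le)
      then show ?thesis by (simp add: r_def field_simps)
    qed
    obtain q where q: "\<And>k. degree (q k) \<le> k"
      "\<And>k w. w \<in> closure G \<Longrightarrow> (deriv ^^ k) (\<lambda>s. fker w s * B s) 0 / fact k = poly (q k) w"
      using fker_mult_coeff_poly[OF Bhol] by metis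
    define p where "p = (\<Sum>k<N. smult (s ^ k) (q k))"
    have "degree p \<le> N" unfolding p_def
      by (intro degree_sum_le) (auto intro!: order.trans[OF degree_smult_le] intro: order.trans[OF q(1)])
    moreover have "cmod (poly p w - 1 / (V s - w)) \<le> 1/2 * (1 / cmod (V s - w))" if w: "w \<in> closure G" for w
    proof -
      define M where "M = 8 ^ (K + 1) / cmod (V s - w)"
      have VE: "V s \<in> Ext" using V_Ext s s0 by blast
      then have ne: "V s \<noteq> w" using w by auto
      have ks: "cmod (kappa w s) \<le> 2 / cmod (V s - w)"
      proof -
        have "cmod (kappa w s) = 1 / cmod s * (1 / cmod (V s - w))"
          using kappa_V[OF w s(2) s0] by (simp add: norm_divide norm_mult)
        also have "\<dots> \<le> 2 * (1 / cmod (V s - w))"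
          using s s0 by (intro mult_right_mono) (auto simp: field_simps)
        finally show ?thesis by simp
      qed
      define H where "H x = fker w x * B x" for x
      have Hhol: "H holomorphic_on ball 0 1" unfolding H_def by (intro holomorphic_intros fker_hol w Bhol)
      have "cmod (H s - (\<Sum>k<N. (deriv ^^ k) H 0 / fact k * s ^ k)) \<le> 2 * M * exp (- real N * (1 - cmod s) / 2)"
      proof (rule taylor_tail_bound[OF Hhol s])
        show "0 \<le> M" by (simp add: M_def)
        fix z assume z: "cmod z = (1 + cmod s) / 2"
        have z1: "cmod z < 1" using z s by simp
        define D where "D = cmod (1 - cnj s * z)"
        have D: "D > 0" using nz[OF z1] by (simp add: D_def)
        have hy: "hypdist z s = D\<^sup>2 / ((1 - r\<^sup>2) * e)"
          unfolding hypdist_commute[of z s] using z by (simp add: hypdist_def D_def r_def e_def mult.commute)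
        have rr: "1 - r\<^sup>2 > 0" using r by (simp add: power_less_one_iff)
        have "cmod (H z) = cmod z * cmod (kappa w z) * (e / D) ^ (2 * K + 2)"
          using e by (simp add: H_def fker_kappa B_def norm_mult norm_power norm_divide D_def)
        also have "\<dots> \<le> 1 * ((2 * hypdist z s) ^ K * cmod (kappa w s)) * (e / D) ^ (2 * K + 2)"
          using z1 e D by (intro mult_right_mono mult_mono K w s) auto
        also have "\<dots> = (2 * e / (1 - r\<^sup>2)) ^ K * e\<^sup>2 / D\<^sup>2 * cmod (kappa w s)"
          using D e rr unfolding hy
          by (simp add: power_mult_distrib power_divide power_add power_mult divide_simps power2_eq_square)
        also have "\<dots> \<le> 8 ^ K * (4 * (1 - cmod s)\<^sup>2) / D\<^sup>2 * (2 / cmod (V s - w))"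
        proof (intro mult_mono divide_right_mono power_mono ks)
          have "2 * e \<le> 8 * ((1 - cmod s) / 2)" using e by simp
          also have "\<dots> \<le> 8 * (1 - r\<^sup>2)" using r2 by simp
          finally show "2 * e / (1 - r\<^sup>2) \<le> 8" using rr by (simp add: pos_divide_le_eq)
          have "e\<^sup>2 \<le> (2 * (1 - cmod s))\<^sup>2" using e by (intro power_mono) auto
          then show "e\<^sup>2 \<le> 4 * (1 - cmod s)\<^sup>2" unfolding power_mult_distrib by simp
        qed (use e rr in auto)
        also have "\<dots> = M * (1 - cmod s)\<^sup>2 / D\<^sup>2" by (simp add: M_def mult_ac)
        finally show "cmod (H z) \<le> M * (1 - cmod s)\<^sup>2 / (cmod (1 - cnj s * z))\<^sup>2" by (simp add: D_def)
      qed
      also have "\<dots> \<le> 2 * M * (1 / A)"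
      proof (intro mult_left_mono)
        have "ln A \<le> real N * (1 - cmod s) / 2" using N by simp
        then have "exp (- real N * (1 - cmod s) / 2) \<le> exp (- ln A)" by simp
        then show "exp (- real N * (1 - cmod s) / 2) \<le> 1 / A" using A by (simp add: exp_minus inverse_eq_divide)
      qed (simp add: M_def)
      also have "\<dots> = 1/2 * (1 / cmod (V s - w))" by (simp add: M_def A_def)
      finally have "cmod (H s - (\<Sum>k<N. (deriv ^^ k) H 0 / fact k * s ^ k)) \<le> 1/2 * (1 / cmod (V s - w))" .
      moreover have "(\<Sum>k<N. (deriv ^^ k) H 0 / fact k * s ^ k) = poly p w"
        using q(2)[OF w] by (simp add: p_def poly_sum H_def[abs_def] mult.commute)
      moreover have "H s = 1 / (V s - w)"
        using kappa_V[OF w s(2) s0] s0 by (simp add: H_def Bs fker_kappa)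
      ultimately show ?thesis by (simp add: norm_minus_commute)
    qed
    ultimately show ?thesis by blast
  qed
  moreover have "2 * ln A > 0" using A by simp
  ultimately show ?thesis by blast
qed

end

section \<open>Geometry of quasidisks\<close>

locale quasidisk_domain = jordan_domain +
  fixes Cq :: real
  assumes Cq1: "Cq \<ge> 1"
    and three_point: "\<And>a b. a \<in> L \<Longrightarrow> b \<in> L \<Longrightarrow> a \<noteq> b \<Longrightarrow>
       \<exists>L' L''. L' \<noteq> L'' \<and> components (L - {a, b}) = {L', L''} \<and> min (diameter L') (diameter L'') \<le> Cq * norm (a - b)"
begin

text \<open>Two disjoint nonempty connected sets that fill \<open>L - {a, b}\<close> must be its two
  components, so the condition can be used for any explicit pair of arcs.\<close>

lemma three_point_split:
  assumes ab: "a \<in> L" "b \<in> L" "a \<noteq> b"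
    and IJ: "I \<union> J = L - {a, b}" "I \<inter> J = {}" "connected I" "connected J" "I \<noteq> {}" "J \<noteq> {}"
  shows "min (diameter I) (diameter J) \<le> Cq * dist a b"
proof -
  obtain L' L'' where l: "L' \<noteq> L''" "components (L - {a, b}) = {L', L''}"
     "min (diameter L') (diameter L'') \<le> Cq * norm (a - b)"
    using three_point[OF ab] by blast
  have U: "L' \<union> L'' = I \<union> J" using Union_components[of "L - {a,b}"] l(2) IJ(1) by auto
  have disj: "L' \<inter> L'' = {}"
    using l components_nonoverlap[of L' "L - {a,b}" L''] by auto
  have ne: "L' \<noteq> {}" "L'' \<noteq> {}" using l(2) in_components_nonempty by blast+
  have sub: "X \<subseteq> L' \<or> X \<subseteq> L''" if "connected X" "X \<noteq> {}" "X \<subseteq> I \<union> J" for X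
    using exists_component_superset[of X "L - {a,b}"] that IJ(1,5) l(2) by auto
  from sub[of I] sub[of J] IJ have "I \<subseteq> L' \<or> I \<subseteq> L''" "J \<subseteq> L' \<or> J \<subseteq> L''" by auto
  then have "I = L' \<and> J = L'' \<or> I = L'' \<and> J = L'" using U disj ne IJ(2) by blast
  then show ?thesis using l(3) by (auto simp: dist_norm min.commute)
qed

lemma based_param:
  assumes "z \<in> L"
  obtains \<gamma> where "continuous_on {0..1} \<gamma>" "\<gamma> 0 = z" "\<gamma> 1 = z" "L = \<gamma> ` {0..1::real}"
    "\<And>s t. s \<in> {0..1} \<Longrightarrow> t \<in> {0..1} \<Longrightarrow> \<gamma> s = \<gamma> t \<Longrightarrow> s = t \<or> s = 0 \<and> t = 1 \<or> s = 1 \<and> t = 0"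
proof -
  obtain \<beta> where b: "simple_path \<beta>" "pathfinish \<beta> = pathstart \<beta>" "L = path_image \<beta>" using L_eq by blast
  obtain a where a: "a \<in> {0..1}" "\<beta> a = z" using assms b(3) by (auto simp: path_image_def)
  define \<gamma> where "\<gamma> = shiftpath a \<beta>"
  have sp: "simple_path \<gamma>" unfolding \<gamma>_def using b a by (intro simple_path_shiftpath) auto
  have im: "path_image \<gamma> = L" unfolding \<gamma>_def b(3) using a b by (intro path_image_shiftpath) auto
  have st: "pathstart \<gamma> = z" unfolding \<gamma>_def using a by (subst pathstart_shiftpath) auto
  have fi: "pathfinish \<gamma> = z" unfolding \<gamma>_def using a b pathfinish_shiftpath[of a \<beta>] by auto
  show thesis
  proof (rule that)
    show "continuous_on {0..1} \<gamma>" using sp by (simp add: simple_path_def path_def)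
    show "\<gamma> 0 = z" "\<gamma> 1 = z" using st fi by (simp_all add: pathstart_def pathfinish_def)
    show "L = \<gamma> ` {0..1}" using im by (simp add: path_image_def)
    show "s = t \<or> s = 0 \<and> t = 1 \<or> s = 1 \<and> t = 0"
      if "s \<in> {0..1}" "t \<in> {0..1}" "\<gamma> s = \<gamma> t" for s t
      using sp[unfolded simple_path_def loop_free_def, THEN conjunct2, rule_format, OF that] .
  qed
qed

text \<open>Passes from arcs without end points, which are the components, to closed arcs, whose end
  points are used later.\<close>

lemma diameter_dense_bound:
  fixes f :: "real \<Rightarrow> complex"
  assumes f: "continuous_on {0..1} f" and S: "S \<subseteq> {0..1}" "T \<subseteq> closure S" and d: "diameter (f ` S) \<le> e"
    and xy: "x \<in> f ` T" "y \<in> f ` T"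
  shows "dist x y \<le> e"
proof -
  have cl: "closure S \<subseteq> {0..1}" using S(1) by (intro closure_minimal) auto
  have "f ` closure S \<subseteq> closure (f ` S)"
  proof (rule image_closure_subset)
    show "continuous_on (closure S) f" using continuous_on_subset[OF f cl] .
    show "f ` S \<subseteq> closure (f ` S)" by (rule closure_subset)
  qed simp
  then have xy': "x \<in> closure (f ` S)" "y \<in> closure (f ` S)" using xy S(2) by auto
  have "bounded (f ` {0..1})" using compact_continuous_image[OF f compact_Icc] by (rule compact_imp_bounded)
  then have b: "bounded (f ` S)" by (rule bounded_subset) (use S in auto)
  have "dist x y \<le> diameter (closure (f ` S))"
    by (rule diameter_bounded_bound) (use b xy' bounded_closure in auto)
  then show ?thesis using d b by (simp add: diameter_closure)
qed

text \<open>One of the two points is the base point of the parametrization, so each arc is the image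
  of a single parameter interval.\<close>

lemma three_point_arcs0:
  assumes g: "continuous_on {0..1} \<gamma>" "\<gamma> 0 = \<gamma> 1" "L = \<gamma> ` {0..1::real}"
    and inj: "\<And>s t. s \<in> {0..1} \<Longrightarrow> t \<in> {0..1} \<Longrightarrow> \<gamma> s = \<gamma> t \<Longrightarrow> s = t \<or> s = 0 \<and> t = 1 \<or> s = 1 \<and> t = 0"
    and t: "0 < t" "t < 1"
  shows "(\<forall>x\<in>\<gamma> ` {0..t}. \<forall>y\<in>\<gamma> ` {0..t}. dist x y \<le> Cq * dist (\<gamma> 0) (\<gamma> t)) \<or>
         (\<forall>x\<in>\<gamma> ` {t..1}. \<forall>y\<in>\<gamma> ` {t..1}. dist x y \<le> Cq * dist (\<gamma> 0) (\<gamma> t))"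
proof -
  have ne: "\<gamma> 0 \<noteq> \<gamma> t" using inj[of 0 t] t by auto
  have "min (diameter (\<gamma> ` {0<..<t})) (diameter (\<gamma> ` {t<..<1})) \<le> Cq * dist (\<gamma> 0) (\<gamma> t)"
  proof (rule three_point_split)
    show "\<gamma> 0 \<in> L" "\<gamma> t \<in> L" using g(3) t by auto
    show "\<gamma> ` {0<..<t} \<union> \<gamma> ` {t<..<1} = L - {\<gamma> 0, \<gamma> t}"
    proof (intro set_eqI iffI)
      fix x assume "x \<in> L - {\<gamma> 0, \<gamma> t}"
      then obtain s where s: "s \<in> {0..1}" "x = \<gamma> s" "s \<noteq> 0" "s \<noteq> t" "s \<noteq> 1" using g by (smt (verit) Diff_iff imageE insert_iff)
      then show "x \<in> \<gamma> ` {0<..<t} \<union> \<gamma> ` {t<..<1}" by (cases "s < t") auto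
    next
      fix x assume "x \<in> \<gamma> ` {0<..<t} \<union> \<gamma> ` {t<..<1}"
      then have "x \<in> \<gamma> ` ({0<..<t} \<union> {t<..<1})" by (simp only: image_Un)
      then obtain s where s: "s \<in> {0<..<t} \<union> {t<..<1}" "x = \<gamma> s" by (rule imageE)
      then have "\<gamma> s \<noteq> \<gamma> 0" "\<gamma> s \<noteq> \<gamma> t" using inj[of s 0] inj[of s t] t by auto
      then show "x \<in> L - {\<gamma> 0, \<gamma> t}" using s t g(3) by auto
    qed
    show "\<gamma> ` {0<..<t} \<inter> \<gamma> ` {t<..<1} = {}"
    proof -
      have False if "p \<in> {0<..<t}" "q \<in> {t<..<1}" "\<gamma> p = \<gamma> q" for p q
        using inj[of p q] that t by auto
      then show ?thesis by blast
    qed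
    show "connected (\<gamma> ` {0<..<t})" "connected (\<gamma> ` {t<..<1})"
      using t by (auto intro!: connected_continuous_image continuous_on_subset[OF g(1)])
  qed (use t ne in auto)
  moreover have "{0..t} \<subseteq> closure {0<..<t}" "{t..1} \<subseteq> closure {t<..<1}" using t by auto
  ultimately show ?thesis
    using diameter_dense_bound[OF g(1), of "{0<..<t}" "{0..t}" "Cq * dist (\<gamma> 0) (\<gamma> t)"]
      diameter_dense_bound[OF g(1), of "{t<..<1}" "{t..1}" "Cq * dist (\<gamma> 0) (\<gamma> t)"] t
    by (smt (verit) greaterThanLessThan_subseteq_atLeastAtMost_iff min_def)
qed

text \<open>Here the base point is interior to one of the arcs, which is therefore parametrized by
  two intervals glued at their outer ends.\<close>

lemma three_point_arcs:
  assumes g: "continuous_on {0..1} \<gamma>" "\<gamma> 0 = \<gamma> 1" "L = \<gamma> ` {0..1::real}"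
    and inj: "\<And>s t. s \<in> {0..1} \<Longrightarrow> t \<in> {0..1} \<Longrightarrow> \<gamma> s = \<gamma> t \<Longrightarrow> s = t \<or> s = 0 \<and> t = 1 \<or> s = 1 \<and> t = 0"
    and t: "0 < s" "s < t" "t < 1"
  shows "(\<forall>x\<in>\<gamma> ` {s..t}. \<forall>y\<in>\<gamma> ` {s..t}. dist x y \<le> Cq * dist (\<gamma> s) (\<gamma> t)) \<or>
         (\<forall>x\<in>\<gamma> ` ({0..s} \<union> {t..1}). \<forall>y\<in>\<gamma> ` ({0..s} \<union> {t..1}). dist x y \<le> Cq * dist (\<gamma> s) (\<gamma> t))"
proof -
  have ne: "\<gamma> s \<noteq> \<gamma> t" using inj[of s t] t by auto
  have "min (diameter (\<gamma> ` {s<..<t})) (diameter (\<gamma> ` ({0..<s} \<union> {t<..1}))) \<le> Cq * dist (\<gamma> s) (\<gamma> t)"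
  proof (rule three_point_split)
    show "\<gamma> s \<in> L" "\<gamma> t \<in> L" using g(3) t by auto
    show "\<gamma> ` {s<..<t} \<union> \<gamma> ` ({0..<s} \<union> {t<..1}) = L - {\<gamma> s, \<gamma> t}"
    proof (intro set_eqI iffI)
      fix x assume "x \<in> L - {\<gamma> s, \<gamma> t}"
      then obtain p where p: "p \<in> {0..1}" "x = \<gamma> p" "p \<noteq> s" "p \<noteq> t" using g by (smt (verit) Diff_iff imageE insert_iff)
      then show "x \<in> \<gamma> ` {s<..<t} \<union> \<gamma> ` ({0..<s} \<union> {t<..1})" by (cases "p < s"; cases "p < t") auto
    next
      fix x assume "x \<in> \<gamma> ` {s<..<t} \<union> \<gamma> ` ({0..<s} \<union> {t<..1})"
      then have "x \<in> \<gamma> ` ({s<..<t} \<union> ({0..<s} \<union> {t<..1}))" by (simp only: image_Un)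
      then obtain p where p: "p \<in> {s<..<t} \<union> ({0..<s} \<union> {t<..1})" "x = \<gamma> p" by (rule imageE)
      then have "\<gamma> p \<noteq> \<gamma> s" "\<gamma> p \<noteq> \<gamma> t" using inj[of p s] inj[of p t] t by auto
      then show "x \<in> L - {\<gamma> s, \<gamma> t}" using p t g(3) by auto
    qed
    show "\<gamma> ` {s<..<t} \<inter> \<gamma> ` ({0..<s} \<union> {t<..1}) = {}"
    proof -
      have False if "p \<in> {s<..<t}" "q \<in> {0..<s} \<union> {t<..1}" "\<gamma> p = \<gamma> q" for p q
        using inj[of p q] that t by auto
      then show ?thesis by blast
    qed
    show "connected (\<gamma> ` {s<..<t})"
      using t by (auto intro!: connected_continuous_image continuous_on_subset[OF g(1)])
    have "connected (\<gamma> ` {0..<s} \<union> \<gamma> ` {t<..1})"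
    proof (rule connected_Un)
      show "connected (\<gamma> ` {0..<s})" "connected (\<gamma> ` {t<..1})"
        using t by (auto intro!: connected_continuous_image continuous_on_subset[OF g(1)])
      have "\<gamma> 0 \<in> \<gamma> ` {0..<s}" "\<gamma> 1 \<in> \<gamma> ` {t<..1}" using t by auto
      then show "\<gamma> ` {0..<s} \<inter> \<gamma> ` {t<..1} \<noteq> {}" using g(2) by auto
    qed
    then show "connected (\<gamma> ` ({0..<s} \<union> {t<..1}))" by (simp add: image_Un)
  qed (use t ne in auto)
  moreover have "{s..t} \<subseteq> closure {s<..<t}" using t by auto
  moreover have "{0..s} \<union> {t..1} \<subseteq> closure ({0..<s} \<union> {t<..1})" using t by auto
  ultimately show ?thesis
    using diameter_dense_bound[OF g(1), of "{s<..<t}" "{s..t}" "Cq * dist (\<gamma> s) (\<gamma> t)"]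
      diameter_dense_bound[OF g(1), of "{0..<s} \<union> {t<..1}" "{0..s} \<union> {t..1}" "Cq * dist (\<gamma> s) (\<gamma> t)"] t
    unfolding min_def by (smt (verit) Un_subset_iff atLeastAtMost_iff atLeastLessThan_iff greaterThanAtMost_iff greaterThanLessThan_iff subsetI)
qed

end

lemma first_exit:
  fixes \<gamma> :: "real \<Rightarrow> complex"
  assumes g: "continuous_on {0..1} \<gamma>" and s: "s \<in> {0..1}" "r \<le> dist (\<gamma> 0) (\<gamma> s)" and r: "0 < r"
  obtains a where "0 < a" "a \<le> s" "dist (\<gamma> 0) (\<gamma> a) = r" "\<And>p. 0 \<le> p \<Longrightarrow> p < a \<Longrightarrow> dist (\<gamma> 0) (\<gamma> p) < r"
proof -
  define A where "A = {p\<in>{0..s}. r \<le> dist (\<gamma> 0) (\<gamma> p)}"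
  have cont: "continuous_on {0..s} (\<lambda>p. dist (\<gamma> 0) (\<gamma> p))"
    by (intro continuous_intros continuous_on_subset[OF g]) (use s in auto)
  have "closed A" unfolding A_def
    using continuous_closed_preimage[OF cont, of "{r..}"] by (simp add: vimage_def Int_def)
  moreover have "bounded A" by (rule bounded_subset[of "{0..s}"]) (auto simp: A_def)
  ultimately have "compact A" by (simp add: compact_eq_bounded_closed)
  moreover have "A \<noteq> {}" using s by (auto simp: A_def)
  ultimately obtain a where a: "a \<in> A" "\<And>p. p \<in> A \<Longrightarrow> a \<le> p" using compact_attains_inf by metis
  have a': "0 \<le> a" "a \<le> s" "r \<le> dist (\<gamma> 0) (\<gamma> a)" using a(1) by (auto simp: A_def)
  have lt: "dist (\<gamma> 0) (\<gamma> p) < r" if "0 \<le> p" "p < a" for p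
    using a(2)[of p] that a' by (auto simp: A_def not_le[symmetric])
  obtain p where p: "0 \<le> p" "p \<le> a" "dist (\<gamma> 0) (\<gamma> p) = r"
    using IVT'[of "\<lambda>p. dist (\<gamma> 0) (\<gamma> p)" 0 r a] a' r continuous_on_subset[OF cont] by auto
  then have "p = a" using lt[of p] by force
  show thesis by (rule that[of a]) (use p \<open>p = a\<close> a' lt r in \<open>auto simp: less_le\<close>)
qed

lemma last_entry:
  fixes \<gamma> :: "real \<Rightarrow> complex"
  assumes g: "continuous_on {0..1} \<gamma>" and s: "s \<in> {0..1}" "r \<le> dist (\<gamma> 1) (\<gamma> s)" and r: "0 < r"
  obtains a where "a < 1" "s \<le> a" "dist (\<gamma> 1) (\<gamma> a) = r" "\<And>p. p \<le> 1 \<Longrightarrow> a < p \<Longrightarrow> dist (\<gamma> 1) (\<gamma> p) < r"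
proof -
  have g': "continuous_on {0..1} (\<lambda>p. \<gamma> (1 - p))"
    by (intro continuous_on_compose2[OF g] continuous_intros) auto
  obtain a where a: "0 < a" "a \<le> 1 - s" "dist (\<gamma> 1) (\<gamma> (1 - a)) = r"
    "\<And>p. 0 \<le> p \<Longrightarrow> p < a \<Longrightarrow> dist (\<gamma> 1) (\<gamma> (1 - p)) < r"
    using first_exit[OF g', of "1 - s" r] s r by auto
  show thesis
    by (rule that[of "1 - a"]) (use a(1-3) a(4)[of "1 - p" for p] in auto)
qed

context quasidisk_domain begin

text \<open>The two arcs of \<open>L\<close> issuing from \<open>z\<close> are, away from \<open>z\<close>, separated by the three point condition.
  A point of \<open>W\<close> on a small circle around \<open>z\<close> that is equidistant from both arcs is far from \<open>L\<close>.
  If there were none, the part of the circle in \<open>W\<close> would split into crosscuts each attached to a single arc,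
  and by Janiszewski's theorem these could not separate points of \<open>W\<close> near \<open>z\<close> from points of \<open>W\<close> far away.\<close>
lemma corkscrew:
  assumes W: "connected W" "frontier W = L" "W \<inter> L = {}"
    and z: "z \<in> L" and x: "x \<in> L" "r < dist z x" and r: "r > 0"
  shows "\<exists>m\<in>W. dist z m = r / (4 * Cq) \<and> r / (16 * Cq\<^sup>2) \<le> infdist m L"
proof -
  obtain \<gamma> where g: "continuous_on {0..1} \<gamma>" "\<gamma> 0 = z" "\<gamma> 1 = z" "L = \<gamma> ` {0..1::real}"
    and inj: "\<And>s t. s \<in> {0..1} \<Longrightarrow> t \<in> {0..1} \<Longrightarrow> \<gamma> s = \<gamma> t \<Longrightarrow> s = t \<or> s = 0 \<and> t = 1 \<or> s = 1 \<and> t = 0"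
    using based_param[OF z] by blast
  have g01: "\<gamma> 0 = \<gamma> 1" using g by simp
  \<comment> \<open>By \<open>mid\<close> below, the middle part of \<open>L\<close> stays at
    distance at least r / Cq = 4 t from \<open>z\<close>. Hence the circle of radius t meets
    \<open>L\<close> only in the two arms issuing from \<open>z\<close>.\<close>
  define t where "t = r / (4 * Cq)"
  have t: "0 < t" "4 * t \<le> r" "r / Cq = 4 * t" using r Cq1 by (auto simp: t_def field_simps)
  obtain sx where sx: "sx \<in> {0..1}" "x = \<gamma> sx" using x g by auto
  obtain s1 where s1: "0 < s1" "s1 \<le> sx" "dist z (\<gamma> s1) = r" "\<And>p. 0 \<le> p \<Longrightarrow> p < s1 \<Longrightarrow> dist z (\<gamma> p) < r"
    using first_exit[OF g(1) sx(1), of r] x sx(2) r g by auto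
  obtain s2 where s2: "s2 < 1" "sx \<le> s2" "dist z (\<gamma> s2) = r" "\<And>p. p \<le> 1 \<Longrightarrow> s2 < p \<Longrightarrow> dist z (\<gamma> p) < r"
    using last_entry[OF g(1) sx(1), of r] x sx(2) r g by auto
  have sx': "s1 < sx" "sx < s2" using s1 s2 sx x by (auto simp: less_le)
  \<comment> \<open>Both arcs between \<open>z\<close> and such a point contain a point at distance
    r from \<open>z\<close>, so even the smaller one has diameter at least r.\<close>
  have mid: "r / Cq \<le> dist z (\<gamma> s)" if s: "s1 \<le> s" "s \<le> s2" for s
  proof -
    have "0 < s" "s < 1" using s s1 s2 by auto
    from three_point_arcs0[OF g(1) g01 g(4) inj this] have "r \<le> Cq * dist z (\<gamma> s)"
    proof
      assume *: "\<forall>x\<in>\<gamma> ` {0..s}. \<forall>y\<in>\<gamma> ` {0..s}. dist x y \<le> Cq * dist (\<gamma> 0) (\<gamma> s)"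
      have "\<gamma> 0 \<in> \<gamma> ` {0..s}" "\<gamma> s1 \<in> \<gamma> ` {0..s}" using s s1 by auto
      from *[rule_format, OF this] show ?thesis using s1 g by simp
    next
      assume *: "\<forall>x\<in>\<gamma> ` {s..1}. \<forall>y\<in>\<gamma> ` {s..1}. dist x y \<le> Cq * dist (\<gamma> 0) (\<gamma> s)"
      have "\<gamma> 1 \<in> \<gamma> ` {s..1}" "\<gamma> s2 \<in> \<gamma> ` {s..1}" using s s2 by auto
      from *[rule_format, OF this] show ?thesis using s2 g by simp
    qed
    then show ?thesis using Cq1 by (simp add: pos_divide_le_eq mult.commute)
  qed
  \<comment> \<open>One arc between the two points passes through \<open>z\<close>, the other
    through a point at distance r from \<open>z\<close>; both are therefore long.\<close>
  have sep: "\<kappa> \<le> Cq * dist (\<gamma> s) (\<gamma> s')"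
    if s: "0 \<le> s" "s \<le> s1" "s2 \<le> s'" "s' \<le> 1" and k: "0 < \<kappa>" "\<kappa> \<le> r / 2"
      "\<kappa> \<le> dist z (\<gamma> s)" "dist z (\<gamma> s) \<le> r / 2" "\<kappa> \<le> dist z (\<gamma> s')" for s s' \<kappa>
  proof -
    have "s \<noteq> 0" "s' \<noteq> 1" using k g by auto
    then have ss: "0 < s" "s < s'" "s' < 1" using s sx' by auto
    from three_point_arcs[OF g(1) g01 g(4) inj ss] show ?thesis
    proof
      assume *: "\<forall>x\<in>\<gamma> ` {s..s'}. \<forall>y\<in>\<gamma> ` {s..s'}. dist x y \<le> Cq * dist (\<gamma> s) (\<gamma> s')"
      have "\<gamma> s \<in> \<gamma> ` {s..s'}" "\<gamma> s1 \<in> \<gamma> ` {s..s'}" using s ss sx' by auto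
      from *[rule_format, OF this] have "dist (\<gamma> s) (\<gamma> s1) \<le> Cq * dist (\<gamma> s) (\<gamma> s')" .
      moreover have "r \<le> dist z (\<gamma> s) + dist (\<gamma> s) (\<gamma> s1)" using s1 dist_triangle[of z "\<gamma> s1" "\<gamma> s"] by simp
      ultimately show ?thesis using k by linarith
    next
      assume *: "\<forall>x\<in>\<gamma> ` ({0..s} \<union> {s'..1}). \<forall>y\<in>\<gamma> ` ({0..s} \<union> {s'..1}). dist x y \<le> Cq * dist (\<gamma> s) (\<gamma> s')"
      have "\<gamma> 0 \<in> \<gamma> ` ({0..s} \<union> {s'..1})" "\<gamma> s \<in> \<gamma> ` ({0..s} \<union> {s'..1})" using ss by auto
      from *[rule_format, OF this] show ?thesis using k g by simp
    qed
  qed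
  define A1 where "A1 = \<gamma> ` {0..s1}"
  define A2 where "A2 = \<gamma> ` {s2..1}"
  have comp: "compact (\<gamma> ` {a..b})" and conn: "connected (\<gamma> ` {a..b})" if "0 \<le> a" "b \<le> 1" for a b
    using that by (auto intro!: compact_continuous_image connected_continuous_image continuous_on_subset[OF g(1)])
  have cA: "closed A1" "closed A2" "A1 \<noteq> {}" "A2 \<noteq> {}"
    unfolding A1_def A2_def using comp[THEN compact_imp_closed] s1 s2 sx by auto
  have "\<exists>m\<in>W. dist z m = t \<and> infdist m A1 = infdist m A2"
  proof (rule ccontr)
    assume no: "\<not> ?thesis"
    obtain a1 where a1: "0 < a1" "a1 \<le> s1" "\<And>p. 0 \<le> p \<Longrightarrow> p < a1 \<Longrightarrow> dist z (\<gamma> p) < t"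
      using first_exit[OF g(1), of s1 t] s1 sx t g by auto
    obtain b2 where b2: "b2 < 1" "s2 \<le> b2" "\<And>p. p \<le> 1 \<Longrightarrow> b2 < p \<Longrightarrow> dist z (\<gamma> p) < t"
      using last_entry[OF g(1), of s2 t] s2 sx t g by auto
    \<comment> \<open>Before \<open>a1\<close> the arm stays inside the circle of radius t, so
      \<open>D1\<close> contains all points of the arm on that circle. This makes
      \<open>L \<inter> T1\<close> equal to the connected set \<open>D1\<close>, as Janiszewski's
      theorem requires.\<close>
    define D1 where "D1 = \<gamma> ` {a1..s1}"
    define D2 where "D2 = \<gamma> ` {s2..b2}"
    define E1 where "E1 = {w \<in> sphere z t \<inter> closure W. infdist w A1 \<le> infdist w A2}"
    define E2 where "E2 = {w \<in> sphere z t \<inter> closure W. infdist w A2 \<le> infdist w A1}"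
    have clW: "closure W = W \<union> L" using closure_Un_frontier[of W] W by simp
    have cE: "compact E1" "compact E2"
    proof -
      have "closed {w. infdist w A1 \<le> infdist w A2}" "closed {w. infdist w A2 \<le> infdist w A1}"
        by (auto intro!: closed_Collect_le continuous_intros)
      then have "compact (sphere z t \<inter> (closure W \<inter> {w. infdist w A1 \<le> infdist w A2}))"
        "compact (sphere z t \<inter> (closure W \<inter> {w. infdist w A2 \<le> infdist w A1}))"
        by (auto intro!: compact_Int_closed closed_Int)
      moreover have "E1 = sphere z t \<inter> (closure W \<inter> {w. infdist w A1 \<le> infdist w A2})"
        "E2 = sphere z t \<inter> (closure W \<inter> {w. infdist w A2 \<le> infdist w A1})"
        by (auto simp: E1_def E2_def)
      ultimately show "compact E1" "compact E2" by simp_all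
    qed
    have LS: "(s1 \<ge> s \<and> a1 \<le> s) \<or> (s2 \<le> s \<and> s \<le> b2)" if s: "s \<in> {0..1}" "dist z (\<gamma> s) = t" for s
    proof -
      have "\<not> (s1 \<le> s \<and> s \<le> s2)" using mid[of s] s t by auto
      then show ?thesis using a1(3)[of s] b2(3)[of s] s by force
    qed
    have A12: "\<not> (w \<in> A1 \<and> w \<in> A2)" if w: "dist z w = t" for w
    proof
      assume "w \<in> A1 \<and> w \<in> A2"
      then obtain p q where pq: "p \<in> {0..s1}" "q \<in> {s2..1}" "w = \<gamma> p" "w = \<gamma> q" by (auto simp: A1_def A2_def)
      then have "p = q \<or> p = 0 \<and> q = 1 \<or> p = 1 \<and> q = 0" using inj[of p q] s1 s2 sx by auto
      then show False using pq sx' w t g by auto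
    qed
    have E1L: "w \<in> D1" if w: "w \<in> E1" "w \<in> L" for w
    proof -
      obtain s where s: "s \<in> {0..1}" "w = \<gamma> s" using w g by auto
      have tz: "dist z w = t" using w by (simp add: E1_def)
      have "w \<notin> A2"
      proof
        assume "w \<in> A2"
        then have "infdist w A1 = 0" using w infdist_nonneg[of w A1] by (auto simp: E1_def)
        then have "w \<in> A1" using in_closed_iff_infdist_zero cA by blast
        then show False using A12 tz \<open>w \<in> A2\<close> by blast
      qed
      then show ?thesis using LS[of s] s tz b2 by (auto simp: A2_def D1_def)
    qed
    have E2L: "w \<in> D2" if w: "w \<in> E2" "w \<in> L" for w
    proof -
      obtain s where s: "s \<in> {0..1}" "w = \<gamma> s" using w g by auto
      have tz: "dist z w = t" using w by (simp add: E2_def)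
      have "w \<notin> A1"
      proof
        assume "w \<in> A1"
        then have "infdist w A2 = 0" using w infdist_nonneg[of w A2] by (auto simp: E2_def)
        then have "w \<in> A2" using in_closed_iff_infdist_zero cA by blast
        then show False using A12 tz \<open>w \<in> A1\<close> by blast
      qed
      then show ?thesis using LS[of s] s tz a1 by (auto simp: A1_def D2_def)
    qed
    have DL: "D1 \<subseteq> L" "D2 \<subseteq> L" using g(4) a1 b2 s1 s2 sx by (auto simp: D1_def D2_def)
    have cD: "compact D1" "compact D2" "connected D1" "connected D2"
      unfolding D1_def D2_def using comp conn a1 b2 s1 s2 sx by auto
    define T1 where "T1 = D1 \<union> E1"
    define T2 where "T2 = D2 \<union> E2"
    have cT: "closed T1" "closed T2" "compact T1" "compact T2"
      using cD cE by (auto simp: T1_def T2_def compact_imp_closed intro!: closed_Un compact_Un)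
    have LT: "L \<inter> T1 = D1" "L \<inter> T2 = D2" using E1L E2L DL by (auto simp: T1_def T2_def)
    \<comment> \<open>The arc of \<open>L\<close> complementary to \<open>D1\<close> joins
      \<open>z\<close> to \<open>x\<close> and misses \<open>T1\<close>; thickened by small discs at
      its ends it shows that \<open>T1\<close> alone does not separate \<open>p\<close> from
      \<open>q\<close>.\<close>
    define Y1 where "Y1 = \<gamma> ` ({0..<a1} \<union> {s1<..1})"
    define Y2 where "Y2 = \<gamma> ` ({0..<s2} \<union> {b2<..1})"
    have conY: "connected (\<gamma> ` ({0..<a} \<union> {b<..1}))" if "0 < a" "b < 1" "a \<le> 1" "0 \<le> b" for a b
    proof -
      have "connected (\<gamma> ` {0..<a} \<union> \<gamma> ` {b<..1})"
      proof (rule connected_Un)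
        show "connected (\<gamma> ` {0..<a})" "connected (\<gamma> ` {b<..1})"
          using that by (auto intro!: connected_continuous_image continuous_on_subset[OF g(1)])
        have "\<gamma> 0 \<in> \<gamma> ` {0..<a}" using that by auto
        moreover have "\<gamma> 1 \<in> \<gamma> ` {b<..1}" using that by auto
        ultimately show "\<gamma> ` {0..<a} \<inter> \<gamma> ` {b<..1} \<noteq> {}" using g01 by auto
      qed
      then show ?thesis by (simp add: image_Un)
    qed
    have Y: "connected Y1" "connected Y2" unfolding Y1_def Y2_def using conY a1 b2 s1 s2 sx by auto
    have YL: "Y1 \<subseteq> L" "Y2 \<subseteq> L" using g(4) a1 b2 s1 s2 sx by (auto simp: Y1_def Y2_def)
    have Yz: "z \<in> Y1" "z \<in> Y2" unfolding Y1_def Y2_def using g(2) a1 s2 sx' s1 by (auto intro!: image_eqI[of _ _ 0])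
    have Yx: "x \<in> Y1" "x \<in> Y2" unfolding Y1_def Y2_def using sx sx' by auto
    have Y1D: "Y1 \<inter> D1 = {}"
    proof -
      have False if "p \<in> {0..<a1} \<union> {s1<..1}" "q \<in> {a1..s1}" "\<gamma> p = \<gamma> q" for p q
        using inj[of p q] that a1 s1 s2 sx' by auto
      then show ?thesis unfolding Y1_def D1_def by blast
    qed
    have Y2D: "Y2 \<inter> D2 = {}"
    proof -
      have False if "p \<in> {0..<s2} \<union> {b2<..1}" "q \<in> {s2..b2}" "\<gamma> p = \<gamma> q" for p q
        using inj[of p q] that b2 s1 s2 sx' by auto
      then show ?thesis unfolding Y2_def D2_def by blast
    qed
    have YT: "Y1 \<inter> T1 = {}" "Y2 \<inter> T2 = {}" using Y1D Y2D YL LT by blast+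
    have "open (- (T1 \<union> T2))" using cT by auto
    moreover have "z \<notin> T1 \<union> T2" "x \<notin> T1 \<union> T2"
      using Yz Yx YT by auto
    ultimately obtain e1 e2 where e: "e1 > 0" "ball z e1 \<subseteq> - (T1 \<union> T2)" "e2 > 0" "ball x e2 \<subseteq> - (T1 \<union> T2)"
      by (meson ComplI open_contains_ball)
    define e where "e = Min {e1, e2, t, dist z x - t}"
    have ee: "e > 0" "e \<le> e1" "e \<le> e2" "e \<le> t" "e \<le> dist z x - t" using e t x r by (auto simp: e_def)
    have "z \<in> closure W" "x \<in> closure W" using clW z x by auto
    then obtain p q where p: "p \<in> W" "dist p z < e" and q: "q \<in> W" "dist q x < e"
      using ee(1) by (meson closure_approachable)
    have ccT: "connected_component (- T1) p q" "connected_component (- T2) p q"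
    proof -
      have *: "connected_component (- T) p q" if "connected Y" "z \<in> Y" "x \<in> Y" "Y \<inter> T = {}" "T \<subseteq> T1 \<union> T2" for Y T
      proof -
        have zx: "z \<in> ball z e" "x \<in> ball x e" using ee by auto
        have "connected (ball z e \<union> Y)" by (intro connected_Un) (use that zx in blast)+
        then have "connected (ball z e \<union> Y \<union> ball x e)" by (intro connected_Un) (use that zx in blast)+
        moreover have "ball z e \<union> Y \<union> ball x e \<subseteq> - T"
        proof -
          have "ball z e \<subseteq> ball z e1" "ball x e \<subseteq> ball x e2" using ee by auto
          then show ?thesis using e that by blast
        qed
        ultimately show ?thesis unfolding connected_component_def
          using p q by (intro exI[of _ "ball z e \<union> Y \<union> ball x e"]) (auto simp: dist_commute)
      qed
      show "connected_component (- T1) p q" using *[of Y1 T1] Y Yz Yx YT by auto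
      show "connected_component (- T2) p q" using *[of Y2 T2] Y Yz Yx YT by auto
    qed
    have ccL: "connected_component (- L) p q"
      unfolding connected_component_def using W p q by (intro exI[of _ W]) auto
    \<comment> \<open>Janiszewski's theorem is applied to \<open>L\<close> and \<open>T1\<close>,
      then to \<open>L \<union> T1\<close> and \<open>T2\<close>. The second intersection is the
      connected set \<open>D2\<close>, because a point of \<open>E1 \<inter> E2\<close> is
      equidistant from both arms and so, by the assumption to be refuted, lies on
      \<open>L\<close>.\<close>
    have "connected_component (- (L \<union> T1)) p q"
      by (rule Janiszewski[OF compact_L cT(1) _ ccL ccT(1)]) (use LT cD in simp)
    moreover have "(L \<union> T1) \<inter> T2 = D2"
    proof -
      have "E1 \<inter> E2 \<subseteq> L"
      proof
        fix w assume w: "w \<in> E1 \<inter> E2"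
        then have "infdist w A1 = infdist w A2" "dist z w = t" "w \<in> closure W" by (auto simp: E1_def E2_def)
        then show "w \<in> L" using no clW by blast
      qed
      then have "T1 \<inter> T2 \<subseteq> L" using DL by (auto simp: T1_def T2_def)
      then show ?thesis using LT by blast
    qed
    ultimately have "connected_component (- ((L \<union> T1) \<union> T2)) p q"
      by (intro Janiszewski[OF _ cT(2) _ _ ccT(2)]) (use cT compact_L cD in auto)
    then obtain Q where Q: "connected Q" "Q \<subseteq> - (L \<union> T1 \<union> T2)" "p \<in> Q" "q \<in> Q"
      by (auto simp: connected_component_def)
    have QW: "Q \<subseteq> W"
    proof (rule ccontr)
      assume "\<not> Q \<subseteq> W"
      then have "Q \<inter> frontier W \<noteq> {}" using Q p by (intro connected_Int_frontier) auto
      then show False using Q W by auto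
    qed
    have "connected (dist z ` Q)" by (intro connected_continuous_image Q continuous_intros)
    moreover have "dist z p \<in> dist z ` Q" "dist z q \<in> dist z ` Q" using Q by auto
    moreover have "dist z p \<le> t" using p ee by (simp add: dist_commute)
    moreover have "t \<le> dist z q" using q ee dist_triangle[of z x q] by (simp add: dist_commute)
    ultimately have "t \<in> dist z ` Q" using connectedD_interval by metis
    then obtain w where w: "w \<in> Q" "dist z w = t" by auto
    then have "w \<in> E1 \<or> w \<in> E2" using QW clW by (auto simp: E1_def E2_def)
    then show False using w Q by (auto simp: T1_def T2_def)
  qed
  then obtain m where m: "m \<in> W" "dist z m = t" "infdist m A1 = infdist m A2" by blast
  define d where "d = infdist m A1"
  obtain y1 where y1: "y1 \<in> A1" "d = dist m y1" using infdist_attains_inf[OF cA(1,3)] d_def by metis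
  obtain y2 where y2: "y2 \<in> A2" "d = dist m y2" using infdist_attains_inf[OF cA(2,4)] d_def m by metis
  have tC: "t / (4 * Cq) \<le> t / 4" using t Cq1 by (intro divide_left_mono) auto
  \<comment> \<open>Otherwise the nearest points on the two arms would be less than t / (2 Cq) apart
    while at distance at least t / 2 from \<open>z\<close>, against \<open>sep\<close> with \<kappa>
    = t / 2.\<close>
  have d: "t / (4 * Cq) \<le> d"
  proof (rule ccontr)
    assume "\<not> t / (4 * Cq) \<le> d"
    then have dl: "d < t / (4 * Cq)" by simp
    obtain p1 p2 where p: "p1 \<in> {0..s1}" "y1 = \<gamma> p1" "p2 \<in> {s2..1}" "y2 = \<gamma> p2" using y1 y2 by (auto simp: A1_def A2_def)
    have *: "t / 2 \<le> dist z y" "dist z y \<le> r / 2" if "d = dist m y" for y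
      using that m dl tC t dist_triangle[of z m y] dist_triangle[of z y m] by (auto simp: dist_commute)
    have "t / 2 \<le> Cq * dist y1 y2"
      unfolding p(2,4) by (rule sep) (use p * [OF y1(2)] *[OF y2(2)] t in auto)
    also have "\<dots> \<le> Cq * (2 * d)" using y1 y2 dist_triangle2[of y1 y2 m] Cq1 by (intro mult_left_mono) (auto simp: dist_commute)
    also have "\<dots> < Cq * (2 * (t / (4 * Cq)))" using dl Cq1 by (intro mult_strict_left_mono) auto
    also have "\<dots> = t / 2" using Cq1 by simp
    finally show False by simp
  qed
  have "t / (4 * Cq) \<le> infdist m L"
  proof -
    obtain y where y: "y \<in> L" "infdist m L = dist m y" using infdist_attained by blast
    obtain s where s: "s \<in> {0..1}" "y = \<gamma> s" using y g by auto
    consider "s \<le> s1" | "s2 \<le> s" | "s1 \<le> s" "s \<le> s2" by linarith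
    then show ?thesis
    proof cases
      case 1 then show ?thesis using infdist_le[of y A1 m] s y d by (auto simp: A1_def d_def)
    next
      case 2 then show ?thesis using infdist_le[of y A2 m] s y d m by (auto simp: A2_def d_def)
    next
      case 3
      have "4 * t \<le> dist z y" using mid[OF 3] s t by simp
      then show ?thesis using y m tC t dist_triangle[of z y m] by linarith
    qed
  qed
  moreover have "t / (4 * Cq) = r / (16 * Cq\<^sup>2)" by (simp add: t_def power2_eq_square)
  ultimately show ?thesis using m t_def by auto
qed

end

section \<open>Continuous logarithms and separation in the plane\<close>

lemma exp_eq_imp_eq:
  fixes x y :: complex
  assumes "exp x = exp y" "cmod (x - y) < 2 * pi" shows "x = y"
proof -
  obtain n :: int where n: "x = y + (of_int (2 * n) * pi) * \<i>" using assms(1) exp_eq by blast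
  have "cmod (x - y) = \<bar>of_int (2 * n) * pi\<bar>" unfolding n by (simp add: norm_mult abs_mult)
  then have "2 * pi * \<bar>of_int n\<bar> < 2 * pi * 1" using assms(2) by (simp add: abs_mult)
  then have "\<bar>real_of_int n\<bar> < 1" by (subst (asm) mult_less_cancel_left_pos) auto
  then have "n = 0" by linarith
  then show ?thesis using n by simp
qed

lemma log_branches_differ_by_constant:
  fixes h g :: "'a::topological_space \<Rightarrow> complex"
  assumes "connected S" "continuous_on S h" "continuous_on S g" "\<And>x. x \<in> S \<Longrightarrow> exp (h x) = exp (g x)"
    and "a \<in> S" "b \<in> S"
  shows "h a - g a = h b - g b"
proof -
  have "(\<lambda>x. h x - g x) constant_on S"
  proof (rule continuous_discrete_range_constant[OF assms(1)])
    show "continuous_on S (\<lambda>x. h x - g x)" by (intro continuous_intros assms)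
    fix x assume x: "x \<in> S"
    have "2 * pi \<le> norm ((h y - g y) - (h x - g x))" if "y \<in> S" "h y - g y \<noteq> h x - g x" for y
    proof (rule ccontr)
      assume "\<not> 2 * pi \<le> norm ((h y - g y) - (h x - g x))"
      moreover have "exp (h y - g y) = exp (h x - g x)" using assms(4) x that by (simp add: exp_diff)
      ultimately show False using exp_eq_imp_eq[of "h y - g y" "h x - g x"] that by simp
    qed
    then show "\<exists>e>0. \<forall>y. y \<in> S \<and> h y - g y \<noteq> h x - g x \<longrightarrow> e \<le> norm ((h y - g y) - (h x - g x))"
      by (intro exI[of _ "2 * pi"]) auto
  qed
  then show ?thesis using assms(5,6) by (auto simp: constant_on_def)
qed

text \<open>Eilenberg's criterion. Borsuk's theorem says that the two points lie in one component of
  the complement iff the two radial maps to the circle are homotopic; their quotient is then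
  inessential, hence has a continuous argument, and the modulus is restored by real
  logarithms.\<close>

lemma connected_component_iff_log:
  fixes a b :: complex
  assumes S: "compact S" "a \<notin> S" "b \<notin> S"
  shows "connected_component (- S) a b \<longleftrightarrow>
    (\<exists>h. continuous_on S h \<and> (\<forall>x\<in>S. exp (h x) = (x - a) / (x - b)))"
proof -
  let ?A = "\<lambda>x. (x - a) /\<^sub>R norm (x - a)" and ?B = "\<lambda>x. (x - b) /\<^sub>R norm (x - b)"
  have cont: "continuous_on S ?A" "continuous_on S ?B" using S by (auto intro!: continuous_intros)
  have sph: "?A \<in> S \<rightarrow> sphere 0 1" "?B \<in> S \<rightarrow> sphere 0 1" using S by (auto simp: divide_simps)
  have "connected_component (- S) a b \<longleftrightarrow>
     (\<exists>g. continuous_on S g \<and> (\<forall>x\<in>S. ?A x / ?B x = exp (\<i> * of_real (g x))))"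
  proof -
    have "connected_component (- S) a b \<longleftrightarrow> homotopic_with_canon (\<lambda>x. True) S (sphere 0 1) ?A ?B"
      using Borsuk_maps_homotopic_in_connected_component_eq[OF S] by simp
    also have "\<dots> \<longleftrightarrow> (\<exists>c. homotopic_with_canon (\<lambda>x. True) S (sphere 0 1) (\<lambda>x. ?A x / ?B x) (\<lambda>x. c))"
      using homotopic_circlemaps_divide[of S ?A ?B] cont sph by blast
    also have "\<dots> \<longleftrightarrow> (\<exists>g. continuous_on S g \<and> (\<forall>x\<in>S. ?A x / ?B x = exp (\<i> * of_real (g x))))"
      by (rule inessential_eq_continuous_logarithm_circle)
    finally show ?thesis .
  qed
  also have "\<dots> \<longleftrightarrow> (\<exists>h. continuous_on S h \<and> (\<forall>x\<in>S. exp (h x) = (x - a) / (x - b)))"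
  proof
    assume "\<exists>g. continuous_on S g \<and> (\<forall>x\<in>S. ?A x / ?B x = exp (\<i> * of_real (g x)))"
    then obtain g where g: "continuous_on S g" "\<And>x. x \<in> S \<Longrightarrow> ?A x / ?B x = exp (\<i> * of_real (g x))" by blast
    have pos: "0 < cmod (x - a)" "0 < cmod (x - b)" if "x \<in> S" for x using that S by auto
    show "\<exists>h. continuous_on S h \<and> (\<forall>x\<in>S. exp (h x) = (x - a) / (x - b))"
    proof (intro exI[of _ "\<lambda>x. of_real (ln (cmod (x - a)) - ln (cmod (x - b))) + \<i> * of_real (g x)"] conjI ballI)
      show "continuous_on S (\<lambda>x. of_real (ln (cmod (x - a)) - ln (cmod (x - b))) + \<i> * of_real (g x))"
        using pos by (intro continuous_intros g) (fastforce dest: pos)+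
      fix x assume x: "x \<in> S"
      have "exp (complex_of_real (ln (cmod (x - a)) - ln (cmod (x - b)))) = of_real (cmod (x - a) / cmod (x - b))"
        using pos[OF x] by (simp only: exp_of_real exp_diff exp_ln)
      then show "exp (of_real (ln (cmod (x - a)) - ln (cmod (x - b))) + \<i> * of_real (g x)) = (x - a) / (x - b)"
        unfolding exp_add g(2)[OF x, symmetric] using pos[OF x] by (simp add: scaleR_conv_of_real field_simps)
    qed
  next
    assume "\<exists>h. continuous_on S h \<and> (\<forall>x\<in>S. exp (h x) = (x - a) / (x - b))"
    then obtain h where h: "continuous_on S h" "\<And>x. x \<in> S \<Longrightarrow> exp (h x) = (x - a) / (x - b)" by blast
    show "\<exists>g. continuous_on S g \<and> (\<forall>x\<in>S. ?A x / ?B x = exp (\<i> * of_real (g x)))"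
    proof (intro exI[of _ "\<lambda>x. Im (h x)"] conjI ballI)
      show "continuous_on S (\<lambda>x. Im (h x))" by (intro continuous_intros h)
      fix x assume x: "x \<in> S"
      have ne: "x \<noteq> a" "x \<noteq> b" using x S by auto
      have "exp (Re (h x)) = cmod (x - a) / cmod (x - b)"
        using arg_cong[OF h(2)[OF x], of cmod] by (simp add: norm_divide)
      then have "of_real (exp (Re (h x))) = complex_of_real (cmod (x - a)) / of_real (cmod (x - b))" by simp
      moreover have "(x - a) / (x - b) = of_real (exp (Re (h x))) * exp (\<i> * of_real (Im (h x)))"
        using h(2)[OF x] exp_eq_polar[of "h x"] by (simp add: cis_conv_exp)
      moreover have "?A x / ?B x = (x - a) / (x - b) * (of_real (cmod (x - b)) / of_real (cmod (x - a)))"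
        using ne by (simp add: scaleR_conv_of_real divide_inverse)
      ultimately show "?A x / ?B x = exp (\<i> * of_real (Im (h x)))"
        using ne by simp
    qed
  qed
  finally show ?thesis .
qed

lemma Ln_near_1:
  fixes x u a :: complex
  assumes "dist x u \<le> \<tau> * dist u a" "\<tau> \<le> 1/4" "u \<noteq> a"
  shows "cmod (Ln ((x - a) / (u - a))) \<le> 2 * \<tau>" "exp (Ln ((x - a) / (u - a))) = (x - a) / (u - a)"
    "0 < Re ((x - a) / (u - a))"
proof -
  define q where "q = (x - u) / (u - a)"
  have eq: "(x - a) / (u - a) = 1 + q" using assms(3) by (simp add: q_def field_simps)
  have q: "cmod q \<le> \<tau>" using assms by (simp add: q_def norm_divide dist_norm pos_divide_le_eq)
  have "cmod (Ln (1 + q)) \<le> 2 * cmod q" by (rule norm_Ln_le) (use q assms in simp)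
  then show "cmod (Ln ((x - a) / (u - a))) \<le> 2 * \<tau>" using q eq by simp
  have "Re (1 + q) > 0" using abs_Re_le_cmod[of q] q assms(2) by simp
  then show "0 < Re ((x - a) / (u - a))" using eq by simp
  then have "(x - a) / (u - a) \<noteq> 0" by auto
  then show "exp (Ln ((x - a) / (u - a))) = (x - a) / (u - a)" by simp
qed

text \<open>Logarithms of the same number differ by multiples of 2 pi i. A choice that oscillates by
  less than 1 at small scale must therefore coincide locally with a continuous branch. This allows a
  logarithm to be pasted together from discontinuous choices.\<close>

lemma continuous_on_log_of_small_oscillation:
  fixes f h :: "complex \<Rightarrow> complex"
  assumes f: "continuous_on S f" and fh: "\<And>x. x \<in> S \<Longrightarrow> exp (h x) = f x"
    and \<rho>: "\<rho> > 0" and osc: "\<And>x y. x \<in> S \<Longrightarrow> y \<in> S \<Longrightarrow> dist x y < \<rho> \<Longrightarrow> cmod (h x - h y) < 1"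
  shows "continuous_on S h"
  unfolding continuous_on_eq_continuous_within
proof
  fix x assume x: "x \<in> S"
  have fx: "f x \<noteq> 0" using fh[OF x, symmetric] by simp
  define g where "g y = h x + Ln (f y / f x)" for y
  have "(f \<longlongrightarrow> f x) (at x within S)" using f x by (simp add: continuous_on_def)
  then have "((\<lambda>y. f y / f x) \<longlongrightarrow> f x / f x) (at x within S)" using fx by (intro tendsto_intros)
  moreover have "f x / f x \<notin> \<real>\<^sub>\<le>\<^sub>0" using fx by simp
  ultimately have gl: "(g \<longlongrightarrow> g x) (at x within S)" unfolding g_def by (intro tendsto_add tendsto_const tendsto_Ln)
  have gx: "g x = h x" using fx by (simp add: g_def)
  have "eventually (\<lambda>y. dist (g y) (g x) < 1) (at x within S)" using gl by (rule tendstoD) simp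
  moreover have "eventually (\<lambda>y. dist y x < \<rho>) (at x within S)" using \<rho> by (auto simp: eventually_at)
  moreover have "eventually (\<lambda>y. y \<in> S) (at x within S)" by (simp add: eventually_at_filter)
  ultimately have "eventually (\<lambda>y. g y = h y) (at x within S)"
  proof eventually_elim
    case (elim y)
    have fy: "f y \<noteq> 0" using fh[OF elim(3), symmetric] by simp
    have "exp (g y) = exp (h y)" using fh x elim fx fy by (simp add: g_def exp_add)
    moreover have "cmod (g y - h y) < 2 * pi"
    proof -
      have "cmod (g y - h y) \<le> cmod (g y - g x) + cmod (h x - h y)"
        using norm_triangle_ineq[of "g y - g x" "h x - h y"] gx by simp
      also have "\<dots> < 1 + 1" using elim osc[OF x elim(3)] by (intro add_strict_mono) (auto simp: dist_norm norm_minus_commute)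
      also have "\<dots> < 2 * pi" using pi_gt3 by simp
      finally show ?thesis .
    qed
    ultimately show ?case by (rule exp_eq_imp_eq)
  qed
  then have "(h \<longlongrightarrow> g x) (at x within S)" using gl by (rule Lim_transform_eventually[rotated])
  then show "continuous (at x within S) h" by (simp add: continuous_within gx)
qed

section \<open>Connecting exterior points at a distance from the boundary curve\<close>

context quasidisk_domain begin

lemma small_arc:
  assumes "u \<in> L" "v \<in> L"
  obtains A where "A \<subseteq> L" "connected A" "u \<in> A" "v \<in> A" "\<And>x. x \<in> A \<Longrightarrow> dist x u \<le> Cq * dist u v"
proof (cases "u = v")
  case True
  then show thesis using that[of "{u}"] assms by auto
next
  case False
  obtain \<gamma> where g: "continuous_on {0..1} \<gamma>" "\<gamma> 0 = u" "\<gamma> 1 = u" "L = \<gamma> ` {0..1::real}"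
    and inj: "\<And>s t. s \<in> {0..1} \<Longrightarrow> t \<in> {0..1} \<Longrightarrow> \<gamma> s = \<gamma> t \<Longrightarrow> s = t \<or> s = 0 \<and> t = 1 \<or> s = 1 \<and> t = 0"
    using based_param[OF assms(1)] by blast
  obtain s where s: "s \<in> {0..1}" "v = \<gamma> s" using assms g by auto
  have s': "0 < s" "s < 1" using s g False by (auto simp: less_le)
  have g01: "\<gamma> 0 = \<gamma> 1" using g by simp
  have con: "connected (\<gamma> ` {0..s})" "connected (\<gamma> ` {s..1})"
    using s by (auto intro!: connected_continuous_image continuous_on_subset[OF g(1)])
  from three_point_arcs0[OF g(1) g01 g(4) inj s'] show thesis
  proof
    assume *: "\<forall>x\<in>\<gamma> ` {0..s}. \<forall>y\<in>\<gamma> ` {0..s}. dist x y \<le> Cq * dist (\<gamma> 0) (\<gamma> s)"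
    have m: "\<gamma> 0 \<in> \<gamma> ` {0..s}" "\<gamma> s \<in> \<gamma> ` {0..s}" using s' by auto
    show thesis by (rule that[of "\<gamma> ` {0..s}"]) (use con m s g * in auto)
  next
    assume *: "\<forall>x\<in>\<gamma> ` {s..1}. \<forall>y\<in>\<gamma> ` {s..1}. dist x y \<le> Cq * dist (\<gamma> 0) (\<gamma> s)"
    have m: "\<gamma> 1 \<in> \<gamma> ` {s..1}" "\<gamma> s \<in> \<gamma> ` {s..1}" using s' by auto
    show thesis
    proof (rule that[of "\<gamma> ` {s..1}"])
      show "u \<in> \<gamma> ` {s..1}" using m g by simp
      show "dist x u \<le> Cq * dist u v" if "x \<in> \<gamma> ` {s..1}" for x
        using *[rule_format, OF that m(1)] s g by simp
    qed (use con m s g in auto)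
  qed
qed

text \<open>A point of the arc between \<open>y1\<close> and \<open>y2\<close> has one of these two
  on each of its arcs to \<open>z\<close>; hence the smaller of those arcs has diameter at least
  \<rho>.\<close>

lemma far_arc:
  assumes z: "z \<in> L" and y: "y1 \<in> L" "y2 \<in> L" "\<rho> \<le> dist z y1" "\<rho> \<le> dist z y2" and \<rho>: "0 < \<rho>"
  obtains A where "A \<subseteq> L" "connected A" "y1 \<in> A" "y2 \<in> A" "\<And>x. x \<in> A \<Longrightarrow> \<rho> \<le> Cq * dist z x"
proof -
  obtain \<gamma> where g: "continuous_on {0..1} \<gamma>" "\<gamma> 0 = z" "\<gamma> 1 = z" "L = \<gamma> ` {0..1::real}"
    and inj: "\<And>s t. s \<in> {0..1} \<Longrightarrow> t \<in> {0..1} \<Longrightarrow> \<gamma> s = \<gamma> t \<Longrightarrow> s = t \<or> s = 0 \<and> t = 1 \<or> s = 1 \<and> t = 0"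
    using based_param[OF z] by blast
  have g01: "\<gamma> 0 = \<gamma> 1" using g by simp
  obtain s1 where s1: "s1 \<in> {0..1}" "y1 = \<gamma> s1" using y g by auto
  obtain s2 where s2: "s2 \<in> {0..1}" "y2 = \<gamma> s2" using y g by auto
  define a where "a = min s1 s2"
  define b where "b = max s1 s2"
  have ab: "0 < a" "a \<le> b" "b < 1" "\<rho> \<le> dist z (\<gamma> a)" "\<rho> \<le> dist z (\<gamma> b)"
    using s1 s2 y g \<rho> by (auto simp: a_def b_def min_def max_def less_le)
  have "\<rho> \<le> Cq * dist z (\<gamma> s)" if s: "s \<in> {a..b}" for s
  proof -
    have "0 < s" "s < 1" using s ab by auto
    from three_point_arcs0[OF g(1) g01 g(4) inj this] show ?thesis
    proof
      assume *: "\<forall>x\<in>\<gamma> ` {0..s}. \<forall>y\<in>\<gamma> ` {0..s}. dist x y \<le> Cq * dist (\<gamma> 0) (\<gamma> s)"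
      have "\<gamma> 0 \<in> \<gamma> ` {0..s}" "\<gamma> a \<in> \<gamma> ` {0..s}" using s ab by auto
      from *[rule_format, OF this] show ?thesis using ab g by simp
    next
      assume *: "\<forall>x\<in>\<gamma> ` {s..1}. \<forall>y\<in>\<gamma> ` {s..1}. dist x y \<le> Cq * dist (\<gamma> 0) (\<gamma> s)"
      have "\<gamma> 1 \<in> \<gamma> ` {s..1}" "\<gamma> b \<in> \<gamma> ` {s..1}" using s ab by auto
      from *[rule_format, OF this] show ?thesis using ab g by simp
    qed
  qed
  moreover have "connected (\<gamma> ` {a..b})"
    using ab by (auto intro!: connected_continuous_image continuous_on_subset[OF g(1)])
  moreover have "y1 \<in> \<gamma> ` {a..b}" "y2 \<in> \<gamma> ` {a..b}" using s1 s2 by (auto simp: a_def b_def)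
  moreover have "\<gamma> ` {a..b} \<subseteq> L" using g(4) ab by auto
  ultimately show thesis by (intro that[of "\<gamma> ` {a..b}"]) auto
qed

text \<open>A continuous logarithm of \<open>(x - m) / (x - m')\<close> on \<open>L\<close> extends to a neighbourhood of \<open>L\<close> of width
  comparable to \<open>r\<close>, because by the three point condition nearby points of \<open>L\<close> are joined by a short arc,
  along which the quotient hardly varies. It also extends by the principal branch to a large circle.
  So this neighbourhood together with the circle does not separate \<open>m\<close> from \<open>m'\<close>.\<close>
lemma wide_connection:
  assumes c: "0 < c" and A: "1 \<le> A"
    and z: "z \<in> L" and r: "0 < r"
    and m: "m \<in> Ext" "dist z m \<le> A * r" "c * r \<le> infdist m L"
    and m': "m' \<in> Ext" "dist z m' \<le> A * r" "c * r \<le> infdist m' L"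
  obtains Q where "connected Q" "m \<in> Q" "m' \<in> Q" "Q \<subseteq> Ext" "Q \<subseteq> ball z (66 * A * Cq * r)"
    "\<And>w. w \<in> Q \<Longrightarrow> c / (64 * Cq) * r \<le> infdist w L"
proof -
  \<comment> \<open>Points of \<open>L\<close> at distance up to 4 \<epsilon> are joined by an arc
    within 4 Cq \<epsilon> = c r / 16 of one of them, that is within 1/16 of its distances to
    \<open>m\<close> and \<open>m'\<close>, where the logarithms of the quotients are small.\<close>
  define \<epsilon> where "\<epsilon> = c / (64 * Cq) * r"
  \<comment> \<open>\<open>far_arc\<close> loses a factor \<open>Cq\<close>, so points of
    \<open>L\<close> beyond R / 2 are joined inside \<open>L\<close> at distance at least 33 A r
    from \<open>z\<close>. There (x - m) / (x - m') is within 1/16 of 1 and the principal logarithm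
    is small.\<close>
  define R where "R = 66 * A * Cq * r"
  have e: "0 < \<epsilon>" "64 * Cq * \<epsilon> = c * r" "64 * \<epsilon> \<le> c * r"
  proof -
    show "0 < \<epsilon>" "64 * Cq * \<epsilon> = c * r" using c r Cq1 by (auto simp: \<epsilon>_def)
    have "1 * \<epsilon> \<le> Cq * \<epsilon>" using Cq1 \<open>0 < \<epsilon>\<close> by (intro mult_right_mono) auto
    then show "64 * \<epsilon> \<le> c * r" using \<open>64 * Cq * \<epsilon> = c * r\<close> by simp
  qed
  have AC: "A * r > 0" "A * r \<le> A * Cq * r" "66 * (A * r) \<le> R"
    using A r Cq1 by (auto simp: R_def mult_le_cancel_right)
  have cr: "c * r \<le> A * r"
  proof -
    have "c * r \<le> dist m z" using m(3) infdist_le[OF z, of m] by linarith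
    then show ?thesis using m(2) by (simp add: dist_commute)
  qed
  have mL: "m \<notin> L" "m' \<notin> L" using m m' notin_closure_G by auto
  have dm: "c * r \<le> dist u m" "c * r \<le> dist u m'" if "u \<in> L" for u
    using that m(3) m'(3) infdist_le[of u L m] infdist_le[of u L m'] by (auto simp: dist_commute)
  define f where "f x = (x - m) / (x - m')" for x
  have "connected_component (- L) m m'"
    unfolding connected_component_def using m m' connected_Ext L_closure by (intro exI[of _ Ext]) auto
  then obtain l0 where l0: "continuous_on L l0" "\<And>x. x \<in> L \<Longrightarrow> exp (l0 x) = f x"
    unfolding connected_component_iff_log[OF compact_L mL] f_def by blast
  have far: "cmod (Ln (f x)) \<le> 1/4 \<and> exp (Ln (f x)) = f x \<and> 0 < Re (f x)" if x: "33 * (A * r) \<le> dist z x" for x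
  proof -
    have d: "32 * (A * r) \<le> dist x m'" using x m'(2) dist_triangle[of z x m'] by (simp add: dist_commute)
    have mm: "dist m m' \<le> 2 * (A * r)" using m(2) m'(2) dist_triangle2[of m m' z] by (simp add: dist_commute)
    have "dist (m' - m) 0 \<le> 1/16 * dist x m'" using d mm AC by (simp add: dist_norm norm_minus_commute)
    then have "dist (x + (m' - m)) x \<le> 1/16 * dist x m'" by (simp add: dist_norm)
    moreover have "x \<noteq> m'" using d AC by auto
    ultimately have "cmod (Ln (((x + (m' - m)) - m') / (x - m'))) \<le> 2 * (1/16)"
      "exp (Ln (((x + (m' - m)) - m') / (x - m'))) = ((x + (m' - m)) - m') / (x - m')"
      "0 < Re (((x + (m' - m)) - m') / (x - m'))"
      by (intro Ln_near_1[where \<tau>="1/16"]; simp)+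
    then show ?thesis by (simp add: f_def)
  qed
  have fcont: "continuous_on S f" if "m' \<notin> S" for S unfolding f_def using that by (auto intro!: continuous_intros)
  have f0: "f x \<noteq> 0" if "x \<noteq> m" "x \<noteq> m'" for x using that by (simp add: f_def)
  \<comment> \<open>The branch on \<open>L\<close> is shifted by a multiple of 2 pi i so that it
    agrees with the principal branch on the far part of \<open>L\<close>; then it fits the choice on
    the large circle. A single shift works because far points are connected by far arcs.\<close>
  have "\<exists>l. continuous_on L l \<and> (\<forall>x\<in>L. exp (l x) = f x) \<and> (\<forall>x\<in>L. R / 2 \<le> dist z x \<longrightarrow> l x = Ln (f x))"
  proof (cases "\<exists>y0\<in>L. R / 2 \<le> dist z y0")
    case False
    then show ?thesis using l0 by (intro exI[of _ l0]) auto
  next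
    case True
    then obtain y0 where y0: "y0 \<in> L" "R / 2 \<le> dist z y0" by blast
    define k where "k = l0 y0 - Ln (f y0)"
    have R2: "33 * (A * r) \<le> R / 2" "0 < R / 2" using AC by auto
    have k: "exp k = 1" using far[of y0] y0 R2 l0(2)[OF y0(1)] f0[of y0] y0(1) mL by (auto simp: k_def exp_diff)
    have "l0 x - k = Ln (f x)" if x: "x \<in> L" "R / 2 \<le> dist z x" for x
    proof -
      obtain B where B: "B \<subseteq> L" "connected B" "y0 \<in> B" "x \<in> B" "\<And>x. x \<in> B \<Longrightarrow> R / 2 \<le> Cq * dist z x"
        using far_arc[OF z y0(1) x(1) y0(2) x(2) R2(2)] by blast
      have Bf: "33 * (A * r) \<le> dist z y" if "y \<in> B" for y
      proof -
        have "Cq * (33 * (A * r)) \<le> Cq * dist z y" using B(5)[OF that] by (simp add: R_def mult_ac)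
        then show ?thesis using Cq1 by simp
      qed
      have "l0 y0 - Ln (f y0) = l0 x - Ln (f x)"
      proof (rule log_branches_differ_by_constant[OF B(2) _ _ _ B(3,4)])
        show "continuous_on B l0" using continuous_on_subset[OF l0(1) B(1)] .
        show "continuous_on B (\<lambda>x. Ln (f x))"
        proof (rule continuous_on_Ln')
          show "continuous_on B f" by (rule fcont) (use B(1) mL in auto)
          show "f y \<notin> \<real>\<^sub>\<le>\<^sub>0" if "y \<in> B" for y using far[OF Bf[OF that]] by (auto simp: complex_nonpos_Reals_iff)
        qed
        show "exp (l0 y) = exp (Ln (f y))" if "y \<in> B" for y using far[OF Bf[OF that]] l0(2)[of y] B(1) that by auto
      qed
      then show ?thesis by (simp add: k_def)
    qed
    moreover have "exp (l0 x - k) = f x" if "x \<in> L" for x using l0(2)[OF that] k by (simp add: exp_diff)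
    ultimately show ?thesis using l0(1) by (intro exI[of _ "\<lambda>x. l0 x - k"]) (auto intro!: continuous_intros)
  qed
  then obtain l where l: "continuous_on L l" "\<And>x. x \<in> L \<Longrightarrow> exp (l x) = f x"
    "\<And>x. x \<in> L \<Longrightarrow> R / 2 \<le> dist z x \<Longrightarrow> l x = Ln (f x)" by blast
  define lam where "lam x u = Ln ((x - m) / (u - m)) - Ln ((x - m') / (u - m'))" for x u
  have lam: "cmod (lam x u) \<le> 1/4 \<and> exp (lam x u) = f x / f u \<and> 0 < Re ((x - m) / (u - m)) \<and> 0 < Re ((x - m') / (u - m'))"
    if "u \<in> L" "dist x u \<le> 4 * Cq * \<epsilon>" for x u
  proof -
    have "u \<noteq> m" "u \<noteq> m'" using that mL by auto
    have d: "dist x u \<le> 1/16 * dist u m" "dist x u \<le> 1/16 * dist u m'" using dm[OF that(1)] that(2) e by auto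
    note 1 = Ln_near_1[OF d(1) _ \<open>u \<noteq> m\<close>] and 2 = Ln_near_1[OF d(2) _ \<open>u \<noteq> m'\<close>]
    have "cmod (lam x u) \<le> 2 * (1/16) + 2 * (1/16)"
      unfolding lam_def by (rule order.trans[OF norm_triangle_ineq4 add_mono]) (use 1 2 in auto)
    moreover have "exp (lam x u) = f x / f u" using 1 2 by (simp add: lam_def exp_diff f_def)
    ultimately show ?thesis using 1 2 by simp
  qed
  have losc: "cmod (l v - l u) \<le> 1/4" if uv: "u \<in> L" "v \<in> L" "dist u v \<le> 4 * \<epsilon>" for u v
  proof -
    obtain B where B: "B \<subseteq> L" "connected B" "u \<in> B" "v \<in> B" "\<And>x. x \<in> B \<Longrightarrow> dist x u \<le> Cq * dist u v"
      using small_arc[OF uv(1,2)] by blast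
    have Bd: "dist x u \<le> 4 * Cq * \<epsilon>" if "x \<in> B" for x
    proof -
      have "Cq * dist u v \<le> Cq * (4 * \<epsilon>)" using uv(3) Cq1 by (intro mult_left_mono) auto
      then show ?thesis using B(5)[OF that] by simp
    qed
    have "l u - (l u + lam u u) = l v - (l u + lam v u)"
    proof (rule log_branches_differ_by_constant[OF B(2) _ _ _ B(3,4)])
      show "continuous_on B l" using continuous_on_subset[OF l(1) B(1)] .
      have "u \<noteq> m" "u \<noteq> m'" using uv mL by auto
      moreover have "(x - m) / (u - m) \<notin> \<real>\<^sub>\<le>\<^sub>0" "(x - m') / (u - m') \<notin> \<real>\<^sub>\<le>\<^sub>0" if "x \<in> B" for x
        using lam[OF uv(1) Bd[OF that]] by (auto simp: complex_nonpos_Reals_iff)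
      ultimately have "continuous_on B (\<lambda>x. lam x u)" unfolding lam_def
        by (intro continuous_on_diff continuous_on_Ln' continuous_on_divide continuous_on_const continuous_on_id) auto
      then show "continuous_on B (\<lambda>x. l u + lam x u)" by (intro continuous_intros)
      fix x assume x: "x \<in> B"
      have "f u \<noteq> 0" using f0[of u] uv mL by auto
      then show "exp (l x) = exp (l u + lam x u)"
        using lam[OF uv(1) Bd[OF x]] l(2)[of x] l(2)[OF uv(1)] x B(1) by (auto simp: exp_add)
    qed
    moreover have "lam u u = 0" using uv mL by (auto simp: lam_def)
    ultimately have "l v - l u = lam v u" by simp
    then show ?thesis using lam[OF uv(1) Bd[OF B(4)]] by simp
  qed
  define X where "X = {w. infdist w L \<le> \<epsilon>} \<union> sphere z R"
  have "compact {w. infdist w L \<le> \<epsilon>}"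
    using e compact_infdist_le[OF L_ne compact_L, of \<epsilon>] by simp
  then have cX: "compact X" unfolding X_def by (intro compact_Un compact_sphere)
  have Rp: "0 < R" "A * r < R" using AC by auto
  have mX: "m \<notin> X" "m' \<notin> X" using m m' e Rp c r by (auto simp: X_def)
  have "\<forall>w. \<exists>p. p \<in> L \<and> infdist w L = dist w p" using infdist_attains_inf[OF closed_L L_ne] by blast
  then obtain p where p: "\<And>w. p w \<in> L" "\<And>w. infdist w L = dist w (p w)" by metis
  \<comment> \<open>The nearest point \<open>p w\<close> is chosen without any continuity in
    \<open>w\<close>. Continuity of \<open>h\<close> comes afterwards from its oscillation being
    less than 1 at scale \<epsilon>.\<close>
  define h where "h w = (if infdist w L \<le> \<epsilon> then l (p w) + lam w (p w) else Ln (f w))" for w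
  have C1: "\<epsilon> \<le> Cq * \<epsilon>" using Cq1 e by simp
  have tube: "cmod (h w - l (p w)) \<le> 1/4 \<and> exp (h w) = f w" if w: "infdist w L \<le> \<epsilon>" for w
  proof -
    have "dist w (p w) \<le> 4 * Cq * \<epsilon>" using w p(2)[of w] C1 e by simp
    from lam[OF p(1) this] show ?thesis
      using w l(2)[OF p(1)] f0[of "p w"] p(1)[of w] mL by (auto simp: h_def exp_add)
  qed
  have sph: "cmod (h w) \<le> 1/4 \<and> exp (h w) = f w" if w: "w \<in> sphere z R" "\<not> infdist w L \<le> \<epsilon>" for w
    using far[of w] w AC by (simp add: h_def)
  have ts: "cmod (h w - h w') < 1" if w: "infdist w L \<le> \<epsilon>" "w' \<in> sphere z R" "\<not> infdist w' L \<le> \<epsilon>" "dist w w' < \<epsilon>" for w w'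
  proof -
    have "dist w' (p w) \<le> 2 * \<epsilon>" using w p(2)[of w] dist_triangle[of w' "p w" w] by (simp add: dist_commute)
    then have "R - 2 * \<epsilon> \<le> dist z (p w)" using w dist_triangle[of z w' "p w"] by (simp add: dist_commute)
    then have "R / 2 \<le> dist z (p w)" using e cr AC by linarith
    then have "cmod (l (p w)) \<le> 1/4" using l(3)[OF p(1)] far[of "p w"] AC by simp
    moreover have "cmod (h w - h w') \<le> cmod (h w - l (p w)) + cmod (l (p w)) + cmod (h w')"
      using norm_triangle_ineq[of "h w - l (p w)" "l (p w) - h w'"] norm_triangle_ineq4[of "l (p w)" "h w'"] by simp
    ultimately show ?thesis using tube[OF w(1)] sph[OF w(2,3)] by linarith
  qed
  have "continuous_on X h"
  proof (rule continuous_on_log_of_small_oscillation[OF fcont _ e(1)])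
    show "m' \<notin> X" by fact
    show "exp (h x) = f x" if "x \<in> X" for x using that tube[of x] sph[of x] by (auto simp: X_def)
    fix x y assume xy: "x \<in> X" "y \<in> X" "dist x y < \<epsilon>"
    consider "infdist x L \<le> \<epsilon>" "infdist y L \<le> \<epsilon>" | "infdist x L \<le> \<epsilon>" "\<not> infdist y L \<le> \<epsilon>"
      | "\<not> infdist x L \<le> \<epsilon>" "infdist y L \<le> \<epsilon>" | "\<not> infdist x L \<le> \<epsilon>" "\<not> infdist y L \<le> \<epsilon>" by blast
    then show "cmod (h x - h y) < 1"
    proof cases
      case 1
      have "dist (p y) (p x) \<le> 4 * \<epsilon>"
        using 1 xy(3) p(2)[of x] p(2)[of y] e dist_triangle[of "p y" "p x" x] dist_triangle[of "p y" x y]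
        by (simp add: dist_commute)
      then have "cmod (l (p x) - l (p y)) \<le> 1/4" by (intro losc p)
      moreover have "cmod (h x - h y) \<le> cmod (h x - l (p x)) + cmod (l (p x) - l (p y)) + cmod (h y - l (p y))"
        using norm_triangle_ineq[of "h x - l (p x)" "(l (p x) - l (p y)) - (h y - l (p y))"]
          norm_triangle_ineq4[of "l (p x) - l (p y)" "h y - l (p y)"] by simp
      ultimately show ?thesis using tube[OF 1(1)] tube[OF 1(2)] by linarith
    next
      case 2 then show ?thesis using ts[of x y] xy by (auto simp: X_def)
    next
      case 3 then show ?thesis using ts[of y x] xy by (auto simp: X_def dist_commute norm_minus_commute)
    next
      case 4 
      then have "cmod (h x) \<le> 1/4" "cmod (h y) \<le> 1/4" using sph xy by (auto simp: X_def)
      then show ?thesis using norm_triangle_ineq4[of "h x" "h y"] by linarith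
    qed
  qed
  moreover have "exp (h x) = (x - m) / (x - m')" if "x \<in> X" for x
    using that tube[of x] sph[of x] by (auto simp: X_def f_def)
  ultimately have "connected_component (- X) m m'"
    unfolding connected_component_iff_log[OF cX mX] by blast
  then obtain Q where Q: "connected Q" "Q \<subseteq> - X" "m \<in> Q" "m' \<in> Q" by (auto simp: connected_component_def)
  show thesis
  proof (rule that[OF Q(1,3,4)])
    show "Q \<subseteq> Ext"
    proof (rule ccontr)
      assume "\<not> Q \<subseteq> Ext"
      then have "Q \<inter> frontier Ext \<noteq> {}" using Q m by (intro connected_Int_frontier) auto
      then obtain w where "w \<in> Q" "w \<in> L" using frontier_Ext by auto
      then show False using Q(2) e by (auto simp: X_def)
    qed
    show "Q \<subseteq> ball z (66 * A * Cq * r)"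
    proof (rule ccontr)
      assume "\<not> Q \<subseteq> ball z (66 * A * Cq * r)"
      then have "Q \<inter> frontier (ball z R) \<noteq> {}" using Q m Rp unfolding R_def[symmetric]
        by (intro connected_Int_frontier) auto
      then show False using Q(2) Rp by (auto simp: X_def)
    qed
    show "c / (64 * Cq) * r \<le> infdist w L" if "w \<in> Q" for w
      using that Q(2) by (force simp: X_def \<epsilon>_def)
  qed
qed

end

section \<open>Estimates for \<open>1 - 1 / |\<Phi>|\<close> near the boundary\<close>

locale quasidisk_chart = exterior_chart G \<Phi> w0 \<phi> + quasidisk_domain G Cq for G \<Phi> w0 \<phi> Cq
begin

lemma ball_infdist_Ext:
  assumes x: "x \<in> Ext" and y: "dist x y < infdist x L" shows "y \<in> Ext"
proof (rule ccontr)
  assume "y \<notin> Ext"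
  then have "closed_segment x y \<inter> frontier Ext \<noteq> {}"
    using x by (intro connected_Int_frontier) auto
  then obtain p where p: "p \<in> closed_segment x y" "p \<in> L" using frontier_Ext by auto
  have "infdist x L \<le> dist x p" by (rule infdist_le[OF p(2)])
  also have "\<dots> \<le> dist x y" using p(1) segment_bound1[of p x y] by (simp add: dist_norm norm_minus_commute)
  finally show False using y by simp
qed

text \<open>The constant 3 is (1 + 1/2) / (1 - 1/2). The estimate is reduced to the moduli a and b,
  for which |a - b| <= (1 - a b) / 2 and 1 - a b <= (1 - a) + (1 - b).\<close>

lemma pseudo_hyperbolic_half:
  assumes s: "cmod s < 1" and v: "cmod v < 1" and le: "cmod ((v - s) / (1 - cnj s * v)) \<le> 1/2"
  shows "1 - cmod v \<le> 3 * (1 - cmod s)" "1 - cmod s \<le> 3 * (1 - cmod v)"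
proof -
  define a where "a = cmod s"
  define b where "b = cmod v"
  have ab: "0 \<le> a" "a < 1" "0 \<le> b" "b < 1" using s v by (auto simp: a_def b_def)
  have "a * b < 1" using mult_strict_mono[of a 1 b 1] ab by auto
  have D: "1 - a * b \<le> cmod (1 - cnj s * v)"
    using norm_triangle_ineq2[of 1 "cnj s * v"] by (simp add: norm_mult a_def b_def)
  have Dp: "0 < cmod (1 - cnj s * v)" using D \<open>a * b < 1\<close> by linarith
  have "(cmod ((v - s) / (1 - cnj s * v)))\<^sup>2 \<le> (1/2)\<^sup>2" using le by (intro power_mono) auto
  also have "(1/2)\<^sup>2 = (1/4::real)" by (simp add: power_divide)
  finally have "3/4 \<le> (1 - a\<^sup>2) * (1 - b\<^sup>2) / (cmod (1 - cnj s * v))\<^sup>2"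
    unfolding a_def b_def norm_moebius_identity[OF s v, symmetric] by linarith
  then have "3/4 * (cmod (1 - cnj s * v))\<^sup>2 \<le> (1 - a\<^sup>2) * (1 - b\<^sup>2)"
    using Dp by (simp add: pos_le_divide_eq)
  moreover have "(1 - a * b)\<^sup>2 \<le> (cmod (1 - cnj s * v))\<^sup>2" using D \<open>a * b < 1\<close> by (intro power_mono) auto
  ultimately have "3/4 * (1 - a * b)\<^sup>2 \<le> (1 - a\<^sup>2) * (1 - b\<^sup>2)" by linarith
  moreover have "(1 - a\<^sup>2) * (1 - b\<^sup>2) = (1 - a * b)\<^sup>2 - (a - b)\<^sup>2" by (simp add: power2_eq_square algebra_simps)
  ultimately have "(a - b)\<^sup>2 \<le> ((1 - a * b) / 2)\<^sup>2" by (simp add: power2_eq_square)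
  then have "\<bar>a - b\<bar> \<le> (1 - a * b) / 2" using abs_le_square_iff[of "a - b" "(1 - a*b)/2"] \<open>a * b < 1\<close> by simp
  moreover have "1 - a * b \<le> (1 - a) + (1 - b)"
    using mult_nonneg_nonneg[of "1 - a" "1 - b"] ab by (simp add: algebra_simps)
  ultimately have "1 - b \<le> 3 * (1 - a) \<and> 1 - a \<le> 3 * (1 - b)" unfolding abs_le_iff by argo
  then show "1 - cmod v \<le> 3 * (1 - cmod s)" "1 - cmod s \<le> 3 * (1 - cmod v)"
    by (simp_all add: a_def b_def)
qed

text \<open>The Schwarz-Pick lemma for \<open>u\<close> on the disc of radius
  \<open>infdist x L\<close> about \<open>x\<close> takes the place of Harnack's inequality:
  \<open>y\<close> has relative distance at most 1/2, hence pseudo-hyperbolic distance at most 1/2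
  after applying \<open>u\<close>.\<close>

lemma eta_Harnack:
  assumes x: "x \<in> Ext" and y: "dist x y \<le> infdist x L / 2"
  shows "y \<in> Ext" "eta y \<le> 3 * eta x" "eta x \<le> 3 * eta y"
proof -
  define d where "d = infdist x L"
  have d: "d > 0" using infdist_pos x notin_closure_G by (simp add: d_def)
  have inE: "x + of_real d * t \<in> Ext" if "t \<in> ball 0 1" for t
    by (rule ball_infdist_Ext[OF x]) (use that d in \<open>auto simp: dist_norm norm_mult d_def[symmetric]\<close>)
  show yE: "y \<in> Ext" by (rule ball_infdist_Ext[OF x]) (use y d d_def in auto)
  define g where "g t = Moebius_function 0 (u x) (u (x + of_real d * t))" for t
  have hg: "g holomorphic_on ball 0 1"
  proof -
    have "(u \<circ> (\<lambda>t. x + of_real d * t)) holomorphic_on ball 0 1"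
      by (intro holomorphic_on_compose_gen[OF _ u_hol] holomorphic_intros) (use inE in auto)
    then have "(Moebius_function 0 (u x) \<circ> (u \<circ> (\<lambda>t. x + of_real d * t))) holomorphic_on ball 0 1"
      by (rule holomorphic_on_compose_gen[OF _ Moebius_function_holomorphic[OF u_bounds(2)[OF x]]])
         (use u_bounds(2) inE in auto)
    then show ?thesis by (simp add: g_def[abs_def] o_def)
  qed
  define t where "t = (y - x) / of_real d"
  have t: "cmod t \<le> 1/2" "x + of_real d * t = y"
    using y d by (auto simp: t_def norm_divide d_def[symmetric] dist_norm norm_minus_commute pos_divide_le_eq)
  have "cmod (g t) \<le> cmod t"
    by (rule Schwarz_Lemma(1)[OF hg, of t])
       (use Moebius_function_norm_lt_1 u_bounds(2) x inE t in \<open>auto simp: g_def Moebius_function_eq_zero\<close>)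
  then have "cmod ((u y - u x) / (1 - cnj (u x) * u y)) \<le> 1/2"
    using t by (simp add: g_def Moebius_function_simple)
  from pseudo_hyperbolic_half[OF u_bounds(2)[OF x] u_bounds(2)[OF yE] this]
  show "eta y \<le> 3 * eta x" "eta x \<le> 3 * eta y" using x yE by (simp_all add: eta_def)
qed

text \<open>\<open>N\<close> is the number of small balls that cover the ball containing Q. A rise
  of ln \<open>eta\<close> by more than N ln 3 over the connected set Q yields N + 1 points whose
  values are more than ln 3 apart; two of them share a small ball, which contradicts
  \<open>eta_Harnack\<close>.\<close>

lemma eta_connected_Harnack:
  assumes K: "K > 0"
  obtains N where "\<And>z \<rho> Q m m'. 0 < \<rho> \<Longrightarrow> connected Q \<Longrightarrow> Q \<subseteq> Ext \<Longrightarrow> Q \<subseteq> ball z \<rho> \<Longrightarrow>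
     (\<And>w. w \<in> Q \<Longrightarrow> \<rho> / K \<le> infdist w L) \<Longrightarrow> m \<in> Q \<Longrightarrow> m' \<in> Q \<Longrightarrow> eta m \<le> 3 ^ N * eta m'"
proof -
  have "compact (cball (0::complex) 1)" by simp
  then obtain F where F: "finite F" "cball (0::complex) 1 \<subseteq> (\<Union>c\<in>F. ball c (1 / (4 * K)))"
    using K unfolding compact_eq_totally_bounded by (metis divide_pos_pos mult_pos_pos zero_less_numeral zero_less_one)
  define N where "N = card F"
  have "F \<noteq> {}" using F(2) by (auto dest: subsetD[of _ _ 0])
  then have N: "N > 0" using F(1) by (simp add: N_def card_gt_0_iff)
  have "eta m \<le> 3 ^ N * eta m'"
    if \<rho>: "0 < \<rho>" and Q: "connected Q" "Q \<subseteq> Ext" "Q \<subseteq> ball z \<rho>" "\<And>w. w \<in> Q \<Longrightarrow> \<rho> / K \<le> infdist w L"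
      and m: "m \<in> Q" "m' \<in> Q" for z \<rho> Q m m'
  proof (rule ccontr)
    assume neg: "\<not> eta m \<le> 3 ^ N * eta m'"
    define e where "e w = ln (eta w)" for w
    have ep: "eta w > 0" if "w \<in> Q" for w using eta_pos that Q by auto
    have near: "e w - e w' \<le> ln 3" if "w \<in> Q" "w' \<in> Q" "dist w w' \<le> \<rho> / (2 * K)" for w w'
    proof -
      have "dist w w' \<le> infdist w L / 2" using that(3) Q(4)[OF that(1)] by simp
      then have "eta w \<le> 3 * eta w'" using eta_Harnack(3)[of w w'] that Q by auto
      then have "ln (eta w) \<le> ln (3 * eta w')" using ep that by simp
      then show ?thesis using ep[OF that(2)] by (simp add: e_def ln_mult)
    qed
    define h where "h = (e m - e m') / N"
    have "ln (3 ^ N * eta m') < ln (eta m)" using neg ep m by simp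
    then have "N * ln 3 < e m - e m'" using ep[OF m(2)] by (simp add: e_def ln_mult ln_realpow)
    then have h: "ln 3 < h" using N by (simp add: h_def pos_less_divide_eq mult.commute)
    have h0: "h > 0" using h ln_gt_zero[of "3::real"] by linarith
    have "connected (e ` Q)"
      unfolding e_def using ep
      by (intro connected_continuous_image Q continuous_on_ln continuous_on_subset[OF eta_continuous]) force+
    have "\<exists>w\<in>Q. e w = e m' + real j * h" if "j \<le> N" for j
    proof -
      have "real j * h \<le> real N * h" using that h0 by (intro mult_right_mono) auto
      also have "\<dots> = e m - e m'" using N by (simp add: h_def)
      finally have "e m' + real j * h \<le> e m" by simp
      moreover have "e m' \<le> e m' + real j * h" using h0 by simp
      ultimately have "e m' + real j * h \<in> e ` Q"
        using connectedD_interval[OF \<open>connected (e ` Q)\<close>, of "e m'" "e m"] m by auto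
      then show ?thesis by (auto simp: image_iff)
    qed
    then obtain w where w: "\<And>j. j \<le> N \<Longrightarrow> w j \<in> Q" "\<And>j. j \<le> N \<Longrightarrow> e (w j) = e m' + real j * h" by metis
    have "\<exists>c\<in>F. (w j - z) / of_real \<rho> \<in> ball c (1 / (4 * K))" if "j \<le> N" for j
    proof -
      have "w j \<in> ball z \<rho>" using w(1)[OF that] Q by auto
      then have "(w j - z) / of_real \<rho> \<in> cball 0 1" using \<rho> by (simp add: norm_divide dist_norm norm_minus_commute)
      then show ?thesis using F by blast
    qed
    then obtain c where c: "\<And>j. j \<le> N \<Longrightarrow> c j \<in> F" "\<And>j. j \<le> N \<Longrightarrow> (w j - z) / of_real \<rho> \<in> ball (c j) (1 / (4 * K))" by metis
    have "\<not> inj_on c {..N}"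
    proof
      assume "inj_on c {..N}"
      then have "card {..N} \<le> card F" using c F by (intro card_inj_on_le[of c]) auto
      then show False by (simp add: N_def)
    qed
    then obtain i j where ij: "i \<le> N" "j \<le> N" "i \<noteq> j" "c i = c j" by (auto simp: inj_on_def)
    have ord: False if "i \<le> N" "j \<le> N" "i < j" "c i = c j" for i j
    proof -
      have "dist ((w j - z) / of_real \<rho>) ((w i - z) / of_real \<rho>) < 1 / (4 * K) + 1 / (4 * K)"
        using c(2)[OF that(1)] c(2)[OF that(2)] that(4)
          dist_triangle2[of "(w j - z) / of_real \<rho>" "(w i - z) / of_real \<rho>" "c j"] by (simp add: dist_commute)
      moreover have "dist ((w j - z) / of_real \<rho>) ((w i - z) / of_real \<rho>) = dist (w j) (w i) / \<rho>"
        using \<rho> by (simp add: dist_norm norm_divide flip: diff_divide_distrib)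
      ultimately have "dist (w j) (w i) \<le> \<rho> / (2 * K)" using \<rho> K by (simp add: field_simps)
      then have "e (w j) - e (w i) \<le> ln 3" using near w(1) that by blast
      moreover have "e (w j) - e (w i) = (real j - real i) * h" using w(2) that by (simp add: algebra_simps)
      moreover have "1 * h \<le> (real j - real i) * h" using that h0 by (intro mult_right_mono) auto
      ultimately show False using h by linarith
    qed
    show False using ord[of i j] ord[of j i] ij by (cases "i < j") auto
  qed
  then show thesis by (rule that)
qed

lemma eta_scale_Harnack:
  assumes c: "0 < c" and A: "1 \<le> A"
  obtains N where "\<And>z r m m'. z \<in> L \<Longrightarrow> r > 0 \<Longrightarrow> m \<in> Ext \<Longrightarrow> dist z m \<le> A * r \<Longrightarrow> c * r \<le> infdist m L \<Longrightarrow>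
     m' \<in> Ext \<Longrightarrow> dist z m' \<le> A * r \<Longrightarrow> c * r \<le> infdist m' L \<Longrightarrow> eta m \<le> 3 ^ N * eta m'"
proof -
  \<comment> \<open>The ratio of the radius \<open>66 * A * Cq * r\<close> to the distance
    \<open>c / (64 * Cq) * r\<close> from \<open>L\<close> in \<open>wide_connection\<close>; it
    does not depend on \<open>r\<close>.\<close>
  define K where "K = 66 * A * Cq * (64 * Cq) / c"
  have K: "K > 0" using c A Cq1 by (simp add: K_def)
  obtain N where N: "\<And>z \<rho> Q m m'. 0 < \<rho> \<Longrightarrow> connected Q \<Longrightarrow> Q \<subseteq> Ext \<Longrightarrow> Q \<subseteq> ball z \<rho> \<Longrightarrow>
     (\<And>w. w \<in> Q \<Longrightarrow> \<rho> / K \<le> infdist w L) \<Longrightarrow> m \<in> Q \<Longrightarrow> m' \<in> Q \<Longrightarrow> eta m \<le> 3 ^ N * eta m'"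
    by (fact eta_connected_Harnack[OF K])
  have "eta m \<le> 3 ^ N * eta m'"
    if "z \<in> L" "r > 0" "m \<in> Ext" "dist z m \<le> A * r" "c * r \<le> infdist m L"
      "m' \<in> Ext" "dist z m' \<le> A * r" "c * r \<le> infdist m' L" for z r m m'
  proof -
    note hyps = that
    obtain Q where Q: "connected Q" "m \<in> Q" "m' \<in> Q" "Q \<subseteq> Ext" "Q \<subseteq> ball z (66 * A * Cq * r)"
      "\<And>w. w \<in> Q \<Longrightarrow> c / (64 * Cq) * r \<le> infdist w L"
      by (fact wide_connection[OF c A hyps])
    have eq: "66 * A * Cq * r / K = c / (64 * Cq) * r" using c A Cq1 by (simp add: K_def)
    have pos: "0 < 66 * A * Cq * r" using A Cq1 that by simp
    show ?thesis by (rule N[OF pos Q(1,4,5) _ Q(2,3)]) (use Q(6) eq in simp)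
  qed
  then show thesis by (rule that)
qed

end

text \<open>On a common radius \<open>hypdist\<close> is controlled by the quotient of the distances
  to the unit circle, so the distortion theorem becomes a power law in \<open>eta\<close>.\<close>

lemma hypdist_radial:
  assumes e: "cmod e = 1" and t: "0 \<le> t" "t \<le> S" "S < 1"
  shows "hypdist (of_real S * e) (of_real t * e) \<le> 2 * ((1 - t) / (1 - S))"
proof -
  have "cnj (of_real S * e) * (of_real t * e) = of_real (t * S) * (e * cnj e)" by simp
  also have "e * cnj e = 1" using e by (simp add: of_real_cmod_power2[symmetric])
  finally have "1 - cnj (of_real S * e) * (of_real t * e) = of_real (1 - t * S)" by simp
  then have hd: "hypdist (of_real S * e) (of_real t * e) = (1 - t * S)\<^sup>2 / ((1 - S\<^sup>2) * (1 - t\<^sup>2))"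
    using e t by (simp add: hypdist_def norm_mult del: of_real_diff)
  have p1: "0 < 1 - S\<^sup>2" "0 < 1 - t\<^sup>2" "1 - S \<le> 1 - S\<^sup>2" "1 - t\<^sup>2 \<le> 2 * (1 - t)"
  proof -
    show "0 < 1 - S\<^sup>2" "0 < 1 - t\<^sup>2" using t by (auto simp: power_less_one_iff)
    show "1 - S \<le> 1 - S\<^sup>2" using t by (simp add: power2_eq_square mult_left_le)
    have "1 - t\<^sup>2 = (1 - t) * (1 + t)" by (simp add: power2_eq_square algebra_simps)
    also have "\<dots> \<le> (1 - t) * 2" using t by (intro mult_left_mono) auto
    finally show "1 - t\<^sup>2 \<le> 2 * (1 - t)" by simp
  qed
  have "t * S \<ge> t\<^sup>2" using t by (simp add: power2_eq_square mult_left_mono)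
  moreover have "t * S < 1" using t mult_left_le[of S t] by linarith
  ultimately have "(1 - t * S)\<^sup>2 \<le> (1 - t\<^sup>2)\<^sup>2" by (intro power_mono) auto
  then have "hypdist (of_real S * e) (of_real t * e) \<le> (1 - t\<^sup>2)\<^sup>2 / ((1 - S\<^sup>2) * (1 - t\<^sup>2))"
    unfolding hd using p1 by (intro divide_right_mono) auto
  also have "\<dots> = (1 - t\<^sup>2) / (1 - S\<^sup>2)" using p1 by (simp add: power2_eq_square)
  also have "\<dots> \<le> 2 * (1 - t) / (1 - S)" using p1 t by (intro frac_le) auto
  finally show ?thesis by (simp only: times_divide_eq_right)
qed

context quasidisk_domain begin

text \<open>The quotient of the two quantities r / (16 Cq^2) and r / (4 Cq) in
  \<open>corkscrew\<close>.\<close>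

definition ck :: real where "ck = 1 / (4 * Cq)"

lemma ck: "0 < ck" "ck \<le> 1" using Cq1 by (auto simp: ck_def field_simps)

lemma corkscrew_uniform:
  obtains r0 where "r0 > 0" "\<And>W z r. connected W \<Longrightarrow> frontier W = L \<Longrightarrow> W \<inter> L = {} \<Longrightarrow>
     z \<in> L \<Longrightarrow> 0 < r \<Longrightarrow> r \<le> r0 \<Longrightarrow> \<exists>m\<in>W. dist z m \<le> r \<and> ck * r \<le> infdist m L"
proof -
  obtain D where D: "D > 0" "\<And>a e. a \<in> L \<Longrightarrow> 0 < e \<Longrightarrow> e \<le> D \<Longrightarrow> \<exists>b\<in>L. dist a b = e"
    using L_sphere by metis
  have "\<exists>m\<in>W. dist z m \<le> r \<and> ck * r \<le> infdist m L"
    if W: "connected W" "frontier W = L" "W \<inter> L = {}" and z: "z \<in> L" and r: "0 < r" "r \<le> D / (8 * Cq)" for W z r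
  proof -
    \<comment> \<open>\<open>corkscrew\<close> is used at radius 4 Cq r, so that the point found is
      at distance r from \<open>z\<close>. The bound r <= D / (8 Cq) ensures that this
      \<open>x\<close> lies beyond that radius.\<close>
    obtain x where x: "x \<in> L" "dist z x = D" using D(2)[OF z D(1)] by blast
    have "4 * Cq * r < D"
    proof -
      have "4 * Cq * r \<le> 4 * Cq * (D / (8 * Cq))" using r Cq1 by (intro mult_left_mono) auto
      also have "\<dots> = D / 2" using Cq1 by simp
      finally show ?thesis using D by simp
    qed
    then obtain m where m: "m \<in> W" "dist z m = (4 * Cq * r) / (4 * Cq)" "(4 * Cq * r) / (16 * Cq\<^sup>2) \<le> infdist m L"
      using corkscrew[OF W z x(1), of "4 * Cq * r"] x r Cq1 by auto
    then have "dist z m = r" "ck * r \<le> infdist m L" using Cq1 by (simp_all add: ck_def power2_eq_square)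
    then show ?thesis using m by auto
  qed
  moreover have "D / (8 * Cq) > 0" using D Cq1 by simp
  ultimately show thesis by (rule that[rotated])
qed

end

section \<open>Harnack chains, Hoelder decay and Carleson's estimate\<close>

context quasidisk_chart begin

lemma corkscrew_Ext:
  obtains r0 where "r0 > 0" "\<And>z r. z \<in> L \<Longrightarrow> 0 < r \<Longrightarrow> r \<le> r0 \<Longrightarrow> \<exists>m\<in>Ext. dist z m \<le> r \<and> ck * r \<le> infdist m L"
proof -
  have E: "Ext \<inter> L = {}" using L_closure by auto
  obtain r0 where r0: "r0 > 0" "\<And>W z r. connected W \<Longrightarrow> frontier W = L \<Longrightarrow> W \<inter> L = {} \<Longrightarrow>
     z \<in> L \<Longrightarrow> 0 < r \<Longrightarrow> r \<le> r0 \<Longrightarrow> \<exists>m\<in>W. dist z m \<le> r \<and> ck * r \<le> infdist m L"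
    by (fact corkscrew_uniform)
  show thesis by (rule that[OF r0(1) r0(2)[OF connected_Ext frontier_Ext E]])
qed

lemma corkscrew_G:
  obtains r0 where "r0 > 0" "\<And>z r. z \<in> L \<Longrightarrow> 0 < r \<Longrightarrow> r \<le> r0 \<Longrightarrow> \<exists>m\<in>G. dist z m \<le> r \<and> ck * r \<le> infdist m L"
proof -
  obtain r0 where r0: "r0 > 0" "\<And>W z r. connected W \<Longrightarrow> frontier W = L \<Longrightarrow> W \<inter> L = {} \<Longrightarrow>
     z \<in> L \<Longrightarrow> 0 < r \<Longrightarrow> r \<le> r0 \<Longrightarrow> \<exists>m\<in>W. dist z m \<le> r \<and> ck * r \<le> infdist m L"
    by (fact corkscrew_uniform)
  show thesis by (rule that[OF r0(1) r0(2)[OF connected_G refl G_L_disjoint]])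
qed

text \<open>Starting from \<open>b\<close>, the chain climbs through corkscrew points over the
  nearest boundary point at scales 2^j \<open>infdist b L\<close>. Each doubling costs a fixed
  factor \<open>B <= 2 ^ K\<close>, and about log2 (r / infdist b L) doublings reach scale r, so the
  total cost is a K-th power.\<close>

lemma eta_Harnack_chain:
  obtains r0 C and K :: nat where "r0 > 0" "C \<ge> 1"
    "\<And>z r a b. z \<in> L \<Longrightarrow> 0 < r \<Longrightarrow> r \<le> r0 \<Longrightarrow> a \<in> Ext \<Longrightarrow> dist z a \<le> r \<Longrightarrow> ck * r \<le> infdist a L \<Longrightarrow>
     b \<in> Ext \<Longrightarrow> dist z b \<le> 4 * r \<Longrightarrow> eta b \<le> C * (r / infdist b L) ^ K * eta a"
proof -
  obtain r0 where r0: "r0 > 0" "\<And>z r. z \<in> L \<Longrightarrow> 0 < r \<Longrightarrow> r \<le> r0 \<Longrightarrow> \<exists>m\<in>Ext. dist z m \<le> r \<and> ck * r \<le> infdist m L"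
    by (fact corkscrew_Ext)
  \<comment> \<open>Consecutive scales of the chain differ by a factor 2, so a corkscrew point of
    one scale serves at the next one with \<open>ck / 2\<close>.\<close>
  have c2: "0 < ck / 2" using ck by simp
  obtain N1 where N1: "\<And>z r m m'. z \<in> L \<Longrightarrow> r > 0 \<Longrightarrow> m \<in> Ext \<Longrightarrow> dist z m \<le> 1 * r \<Longrightarrow> ck / 2 * r \<le> infdist m L \<Longrightarrow>
     m' \<in> Ext \<Longrightarrow> dist z m' \<le> 1 * r \<Longrightarrow> ck / 2 * r \<le> infdist m' L \<Longrightarrow> eta m \<le> 3 ^ N1 * eta m'"
    by (fact eta_scale_Harnack[OF c2 order.refl[of 1]])
  \<comment> \<open>9 = 8 + 1: the boundary point nearest to \<open>b\<close> is within 8 r of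
    \<open>z\<close>, and the chain over it ends within r of that point.\<close>
  have nine: "1 \<le> (9::real)" by simp
  obtain N2 where N2: "\<And>z r m m'. z \<in> L \<Longrightarrow> r > 0 \<Longrightarrow> m \<in> Ext \<Longrightarrow> dist z m \<le> 9 * r \<Longrightarrow> ck / 2 * r \<le> infdist m L \<Longrightarrow>
     m' \<in> Ext \<Longrightarrow> dist z m' \<le> 9 * r \<Longrightarrow> ck / 2 * r \<le> infdist m' L \<Longrightarrow> eta m \<le> 3 ^ N2 * eta m'"
    by (fact eta_scale_Harnack[OF c2 nine])
  define B :: real where "B = 3 ^ N1"
  obtain K where K: "B \<le> 2 ^ K" using real_arch_pow[of 2 B] by (auto intro: less_imp_le)
  have B1: "B \<ge> 1" by (simp add: B_def)
  define C where "C = 3 ^ N2 * 4 ^ K * (1::real)"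
  have C1: "C \<ge> 1"
    using mult_mono[of 1 "3 ^ N2::real" 1 "4 ^ K"] by (simp add: C_def)
  have chain: "\<exists>a\<in>Ext. dist p a \<le> 2 ^ j * infdist b L \<and> ck * (2 ^ j * infdist b L) \<le> infdist a L \<and> eta b \<le> B ^ j * eta a"
    if b: "b \<in> Ext" "p \<in> L" "infdist b L = dist b p" "2 ^ j * infdist b L \<le> r0" for b p j
    using b(4)
  proof (induction j)
    case 0
    have "ck * infdist b L \<le> 1 * infdist b L" using ck infdist_nonneg by (intro mult_right_mono) auto
    then show ?case using b by (intro bexI[of _ b]) (simp_all add: dist_commute)
  next
    case (Suc j)
    define d where "d = infdist b L"
    have d: "d > 0" unfolding d_def using b(1) notin_closure_G by (intro infdist_pos) auto
    have "2 ^ j * d \<le> 2 ^ Suc j * d" using d by simp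
    then have "2 ^ j * infdist b L \<le> r0" using Suc.prems unfolding d_def by linarith
    from Suc.IH[OF this] obtain a where a: "a \<in> Ext" "dist p a \<le> 2 ^ j * d" "ck * (2 ^ j * d) \<le> infdist a L" "eta b \<le> B ^ j * eta a"
      unfolding d_def by blast
    define r where "r = 2 ^ Suc j * d"
    have r: "0 < r" "r \<le> r0" using d Suc.prems by (auto simp: r_def d_def)
    obtain a' where a': "a' \<in> Ext" "dist p a' \<le> r" "ck * r \<le> infdist a' L" using r0(2)[OF b(2) r] by blast
    have "ck / 2 * r \<le> ck * r" using ck r by (intro mult_right_mono) auto
    then have 1: "ck / 2 * r \<le> infdist a' L" using a' by linarith
    have 2: "ck / 2 * r \<le> infdist a L" using a(3) by (simp add: r_def)
    have "dist p a \<le> 1 * r" using a(2) \<open>2 ^ j * d \<le> 2 ^ Suc j * d\<close> unfolding r_def by linarith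
    then have "eta a \<le> B * eta a'" unfolding B_def
      using N1[OF b(2) r(1) a(1) _ 2 a'(1) _ 1] a'(2) by simp
    then have "B ^ j * eta a \<le> B ^ j * (B * eta a')" using B1 by (intro mult_left_mono) auto
    then show ?case using a a' by (intro bexI[of _ a']) (auto simp: r_def d_def mult_ac)
  qed
  have "eta b \<le> C * (r / infdist b L) ^ K * eta a"
    if z: "z \<in> L" and r: "0 < r" "r \<le> r0" and a: "a \<in> Ext" "dist z a \<le> r" "ck * r \<le> infdist a L"
      and b: "b \<in> Ext" "dist z b \<le> 4 * r" for z r a b
  proof -
    define d where "d = infdist b L"
    have d: "d > 0" using infdist_pos b notin_closure_G by (simp add: d_def)
    have d4: "d \<le> 4 * r" using infdist_le[OF z, of b] b by (simp add: d_def dist_commute)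
    obtain p where p: "p \<in> L" "infdist b L = dist b p" using infdist_attained by blast
    have pz: "dist z p \<le> 8 * r" using p b d4 dist_triangle[of z p b] by (simp add: d_def)
    have ck2: "ck / 2 * r \<le> ck * r" using ck r by (intro mult_right_mono) auto
    show ?thesis
    proof (cases "d \<le> r")
      case False
      have "ck / 2 * r \<le> 1 * r" using ck r by (intro mult_right_mono) auto
      then have 1: "ck / 2 * r \<le> infdist b L" using False unfolding d_def by linarith
      have 2: "ck / 2 * r \<le> infdist a L" using ck2 a by linarith
      have "eta b \<le> 3 ^ N2 * eta a"
        using N2[OF z r(1) b(1) _ 1 a(1) _ 2] b a r by simp
      also have "\<dots> \<le> C * (r / d) ^ K * eta a"
      proof (intro mult_right_mono eta_nonneg)
        have "1 / 4 \<le> r / d" using d d4 by (simp add: field_simps)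
        then have "(1 / 4) ^ K \<le> (r / d) ^ K" by (intro power_mono) auto
        then have "C * (1 / 4) ^ K \<le> C * (r / d) ^ K" using C1 by (intro mult_left_mono) auto
        then show "3 ^ N2 \<le> C * (r / d) ^ K" by (simp add: C_def power_divide)
      qed
      finally show ?thesis by (simp add: d_def)
    next
      case True
      obtain k where k: "r < 2 ^ k * d"
        using real_arch_pow[of 2 "r / d"] d by (auto simp: pos_divide_less_eq)
      define j where "j = (LEAST k. r < 2 ^ k * d) - 1"
      have lk: "r < 2 ^ (LEAST k. r < 2 ^ k * d) * d" using k by (rule LeastI)
      have "(LEAST k. r < 2 ^ k * d) \<noteq> 0"
      proof
        assume "(LEAST k. r < 2 ^ k * d) = 0"
        then show False using lk True by simp
      qed
      then have Sj: "(LEAST k. r < 2 ^ k * d) = Suc j" by (simp add: j_def)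
      have j: "2 ^ j * d \<le> r" "r < 2 ^ Suc j * d"
        using not_less_Least[of j "\<lambda>k. r < 2 ^ k * d"] lk Sj by auto
      obtain a1 where a1: "a1 \<in> Ext" "dist p a1 \<le> 2 ^ j * d" "ck * (2 ^ j * d) \<le> infdist a1 L" "eta b \<le> B ^ j * eta a1"
        using chain[OF b(1) p, of j] j r by (auto simp: d_def)
      have "ck / 2 * r \<le> ck / 2 * (2 ^ Suc j * d)" using j ck by (intro mult_left_mono) auto
      then have "ck / 2 * r \<le> infdist a1 L" using a1(3) by simp
      moreover have "dist z a1 \<le> 9 * r" using pz a1 j dist_triangle[of z a1 p] by simp
      moreover have "ck / 2 * r \<le> infdist a L" using ck2 a by linarith
      ultimately have "eta a1 \<le> 3 ^ N2 * eta a"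
        using N2[OF z r(1) a1(1) _ _ a(1)] a r by simp
      then have "eta b \<le> B ^ j * (3 ^ N2 * eta a)" using a1(4) B1 by (smt (verit) mult_left_mono zero_le_power)
      also have "\<dots> \<le> (r / d) ^ K * (C * eta a)"
      proof (intro mult_mono)
        have "B ^ j \<le> (2 ^ K) ^ j" using K B1 by (intro power_mono) auto
        also have "\<dots> = (2 ^ j) ^ K" by (simp add: power_mult[symmetric] mult.commute)
        also have "\<dots> \<le> (r / d) ^ K" using j d by (intro power_mono) (auto simp: field_simps)
        finally show "B ^ j \<le> (r / d) ^ K" .
        show "(3::real) ^ N2 \<le> C" by (simp add: C_def)
      qed (use d r eta_nonneg order_trans[OF zero_le_one C1] in auto)
      finally show ?thesis by (simp add: d_def mult_ac)
    qed
  qed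
  then show thesis by (rule that[OF r0(1) C1])
qed

text \<open>From \<open>u x\<close> one moves along the radius towards 0 until the image under
  \<open>V\<close> is at distance D from \<open>z\<close>; this image is y. The distortion theorem
  with w = \<open>z\<close> bounds D / dist z x by a power of eta y / eta x, which is Hoelder decay
  of \<open>eta\<close> at \<open>z\<close>.\<close>

lemma eta_Hoelder:
  obtains D0 C and K :: nat where "D0 > 0" "C \<ge> 1" "K > 0"
    "\<And>z x D. z \<in> L \<Longrightarrow> x \<in> Ext \<Longrightarrow> dist z x \<le> D \<Longrightarrow> D \<le> D0 \<Longrightarrow>
     \<exists>y\<in>Ext. dist z y = D \<and> eta x ^ K * D \<le> C * dist z x * eta y ^ K"
proof -
  obtain K :: nat where K: "K > 0" "\<And>w s t. w \<in> closure G \<Longrightarrow> cmod s < 1 \<Longrightarrow> cmod t < 1 \<Longrightarrow>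
     cmod (kappa w s) \<le> (2 * hypdist s t) ^ K * cmod (kappa w t)"
    using kappa_distortion by blast
  \<comment> \<open>Points with \<open>eta\<close> at least 1/2 keep a distance \<open>D1\<close>
    from \<open>L\<close>. So the radial path has left the disc of radius D before |s| drops to 1/2,
    and all parameters on it stay above 1/2.\<close>
  have "L \<inter> {x. 1/2 \<le> eta x} = {}" using eta_eq_0 L_closure by fastforce
  then obtain D1 where D1: "D1 > 0" "\<And>z x. z \<in> L \<Longrightarrow> 1/2 \<le> eta x \<Longrightarrow> D1 \<le> dist z x"
    using separate_compact_closed[OF compact_L superlevel_closed[of "1/2"]] by auto
  have "\<exists>y\<in>Ext. dist z y = D \<and> eta x ^ K * D \<le> (2 * 4 ^ K) * dist z x * eta y ^ K"
    if z: "z \<in> L" and x: "x \<in> Ext" and D: "dist z x \<le> D" "D \<le> D1 / 2" for z x D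
  proof -
    define s where "s = u x"
    have s: "cmod s < 1" "s \<noteq> 0" "V s = x" "eta x = 1 - cmod s"
      using u_bounds[OF x] V_u[OF x] x by (auto simp: s_def eta_def)
    have sh: "1/2 < cmod s"
    proof (rule ccontr)
      assume "\<not> 1/2 < cmod s"
      then have "D1 \<le> dist z x" using D1(2)[OF z, of x] s by simp
      then show False using D D1(1) by simp
    qed
    define e where "e = s / of_real (cmod s)"
    have e: "cmod e = 1" "of_real (cmod s) * e = s" using s by (auto simp: e_def norm_divide)
    have te: "cmod (of_real t * e) = t" if "t \<ge> 0" for t using that e by (simp add: norm_mult)
    have te0: "of_real t * e \<noteq> 0" if "t > 0" for t using that e by auto
    have cont: "continuous_on {1/2..cmod s} (\<lambda>t. dist z (V (of_real t * e)))"
      by (intro continuous_intros continuous_on_compose2[OF holomorphic_on_imp_continuous_on[OF V_hol]])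
         (use te te0 s e in \<open>auto simp: norm_mult\<close>)
    have "eta (V (of_real (1/2) * e)) = 1/2" using eta_V[of "of_real (1/2) * e"] te[of "1/2"] te0[of "1/2"] by simp
    then have "D \<le> dist z (V (of_real (1/2) * e))" using D1(2)[OF z, of "V (of_real (1/2) * e)"] D D1(1) by simp
    moreover have "dist z (V (of_real (cmod s) * e)) \<le> D" using e s D by simp
    ultimately obtain t where t: "1/2 \<le> t" "t \<le> cmod s" "dist z (V (of_real t * e)) = D"
      using IVT2'[of "\<lambda>t. dist z (V (of_real t * e))" "cmod s" D "1/2"] cont sh by auto
    define q where "q = of_real t * e"
    have q: "cmod q = t" "q \<noteq> 0" "cmod q < 1" using te[of t] te0[of t] t s by (auto simp: q_def)
    have yE: "V q \<in> Ext" using V_Ext q by blast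
    have etay: "eta (V q) = 1 - t" using eta_V q by simp
    have zc: "z \<in> closure G" using z L_closure by auto
    have xz: "dist z x > 0" using x z notin_closure_G by auto
    have "cmod (kappa z s) = 1 / (cmod s * dist z x)"
      using kappa_V[OF zc s(1,2)] s by (simp add: norm_divide norm_mult dist_norm norm_minus_commute)
    moreover have "cmod (kappa z q) = 1 / (t * D)"
      using kappa_V[OF zc q(3,2)] q t by (simp add: norm_divide norm_mult dist_norm norm_minus_commute q_def)
    ultimately have k: "1 / (cmod s * dist z x) \<le> (2 * hypdist s q) ^ K * (1 / (t * D))"
      using K(2)[OF zc s(1) q(3)] by simp
    have Dp: "D > 0" using xz D by linarith
    define S where "S = cmod s"
    have S: "t \<le> S" "S < 1" "1/2 < S" using t s sh by (auto simp: S_def)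
    have "hypdist s q \<le> 2 * ((1 - t) / (1 - S))"
      using hypdist_radial[OF e(1), of t S] t S e(2) by (simp add: q_def S_def)
    then have h: "2 * hypdist s q \<le> 4 * ((1 - t) / (1 - S))" by linarith
    have h0: "hypdist s q \<ge> 0" using hypdist_ge_1[OF s(1) q(3)] by simp
    have "t * D \<le> (2 * hypdist s q) ^ K * (S * dist z x)"
      using k xz Dp t S by (simp add: S_def[symmetric] field_simps)
    also have "\<dots> \<le> (4 * ((1 - t) / (1 - S))) ^ K * (1 * dist z x)"
    proof (intro mult_mono)
      show "(2 * hypdist s q) ^ K \<le> (4 * ((1 - t) / (1 - S))) ^ K" by (rule power_mono[OF h]) (use h0 in simp)
    qed (use S in auto)
    finally have "t * D \<le> (4 * ((1 - t) / (1 - S))) ^ K * dist z x" by simp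
    moreover have "1/2 * D \<le> t * D" using t Dp by (intro mult_right_mono) auto
    ultimately have "D \<le> 2 * ((4 * ((1 - t) / (1 - S))) ^ K * dist z x)" by linarith
    also have "\<dots> = 2 * 4 ^ K * (1 - t) ^ K / (1 - S) ^ K * dist z x"
      unfolding power_mult_distrib power_divide by simp
    finally have "D \<le> 2 * 4 ^ K * (1 - t) ^ K / (1 - S) ^ K * dist z x" .
    then have "(1 - S) ^ K * D \<le> (1 - S) ^ K * (2 * 4 ^ K * (1 - t) ^ K / (1 - S) ^ K * dist z x)"
      using S by (intro mult_left_mono) auto
    also have "\<dots> = (2 * 4 ^ K) * dist z x * (1 - t) ^ K" using S by simp
    finally show ?thesis using yE t etay s by (intro bexI[of _ "V q"]) (auto simp: q_def S_def)
  qed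
  note main = this
  have "1 \<le> 2 * (4::real) ^ K" using one_le_power[of "4::real" K] by linarith
  moreover have "D1 / 2 > 0" using D1 by simp
  ultimately show thesis using that[OF _ _ K(1) main] by blast
qed

text \<open>Carleson's estimate. The weight \<open>(4 r - dist z b) ^ K\<close> keeps the maximum point \<open>b\<close> either
  away from \<open>L\<close>, where the Harnack chain applies, or so close to \<open>L\<close> that the Hoelder decay of \<open>eta\<close>
  contradicts maximality.\<close>
lemma eta_Carleson:
  obtains r0 C where "r0 > 0" "C \<ge> 1"
    "\<And>z r a b. z \<in> L \<Longrightarrow> 0 < r \<Longrightarrow> r \<le> r0 \<Longrightarrow> a \<in> Ext \<Longrightarrow> dist z a \<le> r \<Longrightarrow> ck * r \<le> infdist a L \<Longrightarrow>
     dist z b \<le> 2 * r \<Longrightarrow> eta b \<le> C * eta a"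
proof -
  obtain r1 C1 and K :: nat where c: "r1 > 0" "C1 \<ge> 1"
    "\<And>z r a b. z \<in> L \<Longrightarrow> 0 < r \<Longrightarrow> r \<le> r1 \<Longrightarrow> a \<in> Ext \<Longrightarrow> dist z a \<le> r \<Longrightarrow> ck * r \<le> infdist a L \<Longrightarrow>
     b \<in> Ext \<Longrightarrow> dist z b \<le> 4 * r \<Longrightarrow> eta b \<le> C1 * (r / infdist b L) ^ K * eta a"
    by (fact eta_Harnack_chain)
  obtain D0 C2 and k :: nat where h: "D0 > 0" "C2 \<ge> 1" "k > 0"
    "\<And>z x D. z \<in> L \<Longrightarrow> x \<in> Ext \<Longrightarrow> dist z x \<le> D \<Longrightarrow> D \<le> D0 \<Longrightarrow>
       \<exists>y\<in>Ext. dist z y = D \<and> eta x ^ k * D \<le> C2 * dist z x * eta y ^ k"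
    by (fact eta_Hoelder)
  \<comment> \<open>Chosen so that Hoelder decay from distance \<epsilon> t, together with the loss
    2^(K k) from halving the weight, leaves 1/8, which is below the 1/4 required at distance t /
    4.\<close>
  define \<epsilon> where "\<epsilon> = 1 / (8 * C2 * 2 ^ (k * K))"
  have e: "0 < \<epsilon>" "C2 * \<epsilon> * 2 ^ (K * k) = 1/8" "\<epsilon> \<le> 1/8"
  proof -
    show "0 < \<epsilon>" "C2 * \<epsilon> * 2 ^ (K * k) = 1/8" using h(2) by (simp_all add: \<epsilon>_def mult.commute)
    have "1 * 1 \<le> C2 * 2 ^ (k * K)" using h(2) by (intro mult_mono) auto
    then show "\<epsilon> \<le> 1/8" unfolding \<epsilon>_def by (intro divide_left_mono) auto
  qed
  define C where "C = C1 / (2 * \<epsilon>) ^ K"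
  have "eta b' \<le> C * eta a"
    if z: "z \<in> L" and r: "0 < r" "r \<le> min r1 D0" and a: "a \<in> Ext" "dist z a \<le> r" "ck * r \<le> infdist a L"
      and b': "dist z b' \<le> 2 * r" for z r a b'
  proof -
    define P where "P x = eta x * (4 * r - dist z x) ^ K" for x
    have "continuous_on (cball z (4 * r)) P"
      unfolding P_def by (intro continuous_intros continuous_on_subset[OF eta_continuous]) auto
    then obtain b where b: "b \<in> cball z (4 * r)" "\<And>x. x \<in> cball z (4 * r) \<Longrightarrow> P x \<le> P b"
      using continuous_attains_sup[of "cball z (4 * r)" P] r by auto
    define t where "t = 4 * r - dist z b"
    have t0: "t \<ge> 0" "t \<le> 4 * r" using b by (auto simp: t_def)
    have lower: "eta b' * (2 * r) ^ K \<le> P b"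
    proof -
      have "eta b' * (2 * r) ^ K \<le> P b'" unfolding P_def using b' r eta_nonneg
        by (intro mult_left_mono power_mono) auto
      also have "\<dots> \<le> P b" using b' r by (intro b) auto
      finally show ?thesis .
    qed
    show ?thesis
    proof (cases "P b \<le> 0")
      case True
      then have "eta b' * (2 * r) ^ K \<le> 0" using lower by linarith
      moreover have "(2 * r) ^ K > 0" using r by simp
      ultimately have "eta b' \<le> 0" by (metis mult_pos_pos not_le)
      moreover have "0 \<le> C * eta a" using c(2) e(1) eta_nonneg[of a] by (simp add: C_def)
      ultimately show ?thesis by linarith
    next
      case False
      then have Pb: "P b > 0" by simp
      have eb: "eta b > 0" using Pb eta_nonneg[of b] unfolding P_def by (metis less_eq_real_def mult_zero_left not_less_iff_gr_or_eq)
      then have bE: "b \<in> Ext" by (auto simp: eta_def split: if_splits)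
      define d where "d = infdist b L"
      have d: "d > 0" using infdist_pos bE notin_closure_G by (simp add: d_def)
      have far: "\<epsilon> * t \<le> d"
      proof (rule ccontr)
        assume "\<not> \<epsilon> * t \<le> d"
        then have dl: "d < \<epsilon> * t" by simp
        then have t: "t > 0" using d t0 e by (auto simp: less_le)
        have dt: "d \<le> t / 4"
        proof -
          have "\<epsilon> * t \<le> 1/8 * t" using e t by (intro mult_right_mono) auto
          then show ?thesis using dl t by linarith
        qed
        obtain p where p: "p \<in> L" "infdist b L = dist b p" using infdist_attained by blast
        \<comment> \<open>At distance t / 4 from the nearest boundary point there is a y with much
          larger \<open>eta\<close>. It is still at distance at least t / 2 from the rim of the disc
          of radius 4 r, so maximality of \<open>b\<close> bounds \<open>eta y\<close> by 2^K
          \<open>eta b\<close>.\<close>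
        have "t / 4 \<le> D0" using t0 r by simp
        then obtain y where y: "y \<in> Ext" "dist p y = t / 4" "eta b ^ k * (t / 4) \<le> C2 * dist p b * eta y ^ k"
          using h(4)[OF p(1) bE, of "t/4"] p(2) dt by (auto simp: d_def dist_commute)
        have zy: "dist z y \<le> 4 * r - t / 2"
        proof -
          have "dist z y \<le> dist z b + dist b p + dist p y"
            using dist_triangle[of z y b] dist_triangle[of b y p] by linarith
          also have "\<dots> \<le> dist z b + t / 4 + t / 4" using y(2) dt p(2) by (simp add: d_def)
          also have "\<dots> = 4 * r - t / 2" by (simp add: t_def field_simps)
          finally show ?thesis .
        qed
        have "eta y * (t / 2) ^ K \<le> P y" unfolding P_def using zy t eta_nonneg
          by (intro mult_left_mono power_mono) auto
        also have "\<dots> \<le> P b" using zy t by (intro b) auto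
        also have "\<dots> = eta b * t ^ K" by (simp add: P_def t_def)
        finally have "eta y \<le> 2 ^ K * eta b" using t by (simp add: power_divide field_simps)
        then have "eta y ^ k \<le> (2 ^ K * eta b) ^ k" using eta_nonneg by (intro power_mono) auto
        then have "C2 * dist p b * eta y ^ k \<le> C2 * dist p b * (2 ^ K * eta b) ^ k"
          using h(2) by (intro mult_left_mono) auto
        also have "\<dots> \<le> C2 * (\<epsilon> * t) * (2 ^ K * eta b) ^ k"
          using h(2) dl p eta_nonneg by (intro mult_right_mono mult_left_mono) (auto simp: d_def dist_commute)
        also have "\<dots> = (C2 * \<epsilon> * 2 ^ (K * k)) * t * eta b ^ k" by (simp add: power_mult_distrib power_mult)
        also have "\<dots> = eta b ^ k * (t / 8)" using e by simp
        finally have "eta b ^ k * (t / 4) \<le> eta b ^ k * (t / 8)" using y(3) by linarith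
        then show False using eb t by simp
      qed
      have "eta b \<le> C1 * (r / d) ^ K * eta a"
        unfolding d_def using c(3)[OF z r(1) _ a bE] r b by auto
      then have "eta b * t ^ K \<le> C1 * (r / d) ^ K * eta a * t ^ K" using t0 by (intro mult_right_mono) auto
      also have "\<dots> = C1 * eta a * r ^ K * (t / d) ^ K" by (simp add: power_divide)
      also have "\<dots> \<le> C1 * eta a * r ^ K * (1 / \<epsilon>) ^ K"
        using far d e t0 c(2) eta_nonneg r by (intro mult_left_mono power_mono) (auto simp: field_simps)
      finally have "P b \<le> C1 * eta a * r ^ K * (1 / \<epsilon>) ^ K" by (simp add: P_def t_def)
      then have "eta b' * (2 * r) ^ K \<le> C1 * eta a * r ^ K * (1 / \<epsilon>) ^ K" using lower by linarith
      then have "eta b' \<le> C1 * eta a * r ^ K * (1 / \<epsilon>) ^ K / (2 * r) ^ K" using r by (simp add: pos_le_divide_eq)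
      also have "\<dots> = C * eta a" using r e by (simp add: C_def power_mult_distrib power_divide)
      finally show ?thesis .
    qed
  qed
  note main = this
  have C1': "C \<ge> 1"
  proof -
    have "(2 * \<epsilon>) ^ K \<le> 1" using e by (intro power_le_one) auto
    then show ?thesis unfolding C_def using c(2) e(1) by (simp add: pos_le_divide_eq)
  qed
  have pos: "min r1 D0 > 0" using c h by simp
  show thesis by (rule that[OF pos C1' main])
qed

end

section \<open>Distances to the level lines\<close>

context quasidisk_chart begin

definition rn :: "nat \<Rightarrow> complex \<Rightarrow> real" where "rn n z = rho G \<Phi> (1 / real n) z"

text \<open>The level is 1 / (n + 1) and not 1 / n, because 1 - 1 / (1 + 1/n) = 1 / (n + 1).\<close>

lemma level_line_eta:
  assumes n: "n \<ge> 1" shows "level_line G \<Phi> (1 / real n) = {x. eta x = 1 / (real n + 1)}"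
proof -
  have "cmod (\<Phi> x) = 1 + 1 / real n \<longleftrightarrow> eta x = 1 / (real n + 1)" if x: "x \<in> Ext" for x
  proof -
    have "eta x = 1 - 1 / cmod (\<Phi> x)" using x by (simp add: eta_def u_def norm_divide)
    moreover have "1 / (real n + 1) = 1 - 1 / (1 + 1 / real n)" using n by (simp add: field_simps)
    ultimately have "eta x = 1 / (real n + 1) \<longleftrightarrow> 1 / cmod (\<Phi> x) = 1 / (1 + 1 / real n)" by auto
    moreover have "cmod (\<Phi> x) > 0" "1 + 1 / real n > 0" using Phi_gt1[OF x] by (auto intro: add_pos_nonneg)
    ultimately show ?thesis by (simp only: divide_cancel_left) auto
  qed
  moreover have "eta x \<noteq> 1 / (real n + 1)" if "x \<notin> Ext" for x using that by (auto simp: eta_def)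
  ultimately show ?thesis unfolding level_line_def by (auto simp del: Compl_iff)
qed

lemma V_circle: "n \<ge> 1 \<Longrightarrow> cmod s = real n / (real n + 1) \<Longrightarrow> cmod s < 1 \<and> s \<noteq> 0 \<and> 1/2 \<le> cmod s \<and> eta (V s) = 1 / (real n + 1)"
proof -
  assume n: "n \<ge> 1" and s: "cmod s = real n / (real n + 1)"
  have 1: "cmod s = 1 - 1 / (real n + 1)" using s by (simp add: field_simps)
  have "0 < 1 / (real n + 1)" "1 / (real n + 1) \<le> 1 / 2" using n by (auto intro!: divide_left_mono)
  then have "cmod s < 1" "1/2 \<le> cmod s" using 1 by auto
  moreover from this have "s \<noteq> 0" by auto
  ultimately show ?thesis using eta_V[of s] 1 by simp
qed

lemma rn_attained:
  assumes n: "n \<ge> 1" and z: "z \<in> L"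
  obtains x where "x \<in> Ext" "eta x = 1 / (real n + 1)" "dist z x = rn n z"
proof -
  have "closed {x. eta x = 1 / (real n + 1)}"
    using continuous_closed_preimage[OF eta_continuous, of "{1 / (real n + 1)}"] by (simp add: vimage_def)
  moreover have "V (of_real (real n / (real n + 1))) \<in> {x. eta x = 1 / (real n + 1)}"
    using V_circle[OF n, of "of_real (real n / (real n + 1))"] by (simp add: norm_divide del: of_real_divide)
  ultimately obtain x where x: "eta x = 1 / (real n + 1)" "infdist z {x. eta x = 1 / (real n + 1)} = dist z x"
    using infdist_attains_inf[of "{x. eta x = 1 / (real n + 1)}" z] by blast
  moreover have "x \<in> Ext" using x by (auto simp: eta_def split: if_splits)
  ultimately show thesis by (intro that[of x]) (auto simp: rn_def rho_def level_line_eta[OF n])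
qed

lemma rn_le: "n \<ge> 1 \<Longrightarrow> eta x = 1 / (real n + 1) \<Longrightarrow> rn n z \<le> dist z x"
  unfolding rn_def rho_def level_line_eta by (rule infdist_le) simp

lemma rn_pos: "n \<ge> 1 \<Longrightarrow> z \<in> L \<Longrightarrow> rn n z > 0"
  by (erule (1) rn_attained) (metis notin_closure_G zero_less_dist_iff)

text \<open>\<open>eta\<close> vanishes at \<open>z\<close>, and along the segment from
  \<open>z\<close> to \<open>x\<close> it cannot pass the level 1 / (n + 1) before the distance
  \<open>rn n z\<close>.\<close>

lemma eta_inside:
  assumes n: "n \<ge> 1" and z: "z \<in> L" and x: "dist z x < rn n z" shows "eta x < 1 / (real n + 1)"
proof (rule ccontr)
  assume "\<not> eta x < 1 / (real n + 1)"
  moreover have "eta z = 0" using eta_eq_0 z L_closure by auto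
  moreover have "connected (eta ` closed_segment z x)"
    by (intro connected_continuous_image continuous_on_subset[OF eta_continuous]) auto
  ultimately have "1 / (real n + 1) \<in> eta ` closed_segment z x"
    using connectedD_interval[of "eta ` closed_segment z x" "eta z" "eta x" "1 / (real n + 1)"] by auto
  then obtain y where y: "y \<in> closed_segment z x" "eta y = 1 / (real n + 1)" by auto
  have "dist z y \<le> dist z x" using segment_bound1[OF y(1)] by (simp add: dist_norm norm_minus_commute)
  then show False using rn_le[OF n y(2), of z] x by simp
qed

lemma rn_bounded: obtains B where "B > 0" "\<And>n z. n \<ge> 1 \<Longrightarrow> z \<in> L \<Longrightarrow> rn n z \<le> B"
proof -
  obtain B1 where B1: "B1 > 0" "\<And>s. 1/2 \<le> cmod s \<Longrightarrow> cmod s < 1 \<Longrightarrow> cmod (V s - w0) \<le> B1"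
    using V_bounded[of "1/2"] by auto
  obtain B2 where B2: "\<And>z. z \<in> L \<Longrightarrow> dist w0 z \<le> B2"
    using compact_imp_bounded[OF compact_L] bounded_any_center[of L w0] by auto
  have "rn n z \<le> B1 + \<bar>B2\<bar>" if n: "n \<ge> 1" and z: "z \<in> L" for n z
  proof -
    define s where "s = complex_of_real (real n / (real n + 1))"
    have s: "cmod s < 1 \<and> s \<noteq> 0 \<and> 1/2 \<le> cmod s \<and> eta (V s) = 1 / (real n + 1)"
      by (rule V_circle[OF n]) (simp add: s_def norm_divide del: of_real_divide)
    have "rn n z \<le> dist z (V s)" using rn_le[OF n] s by simp
    also have "\<dots> \<le> dist z w0 + dist w0 (V s)" by (rule dist_triangle)
    also have "\<dots> \<le> \<bar>B2\<bar> + B1"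
      using B2[OF z] B1(2)[of s] s by (intro add_mono) (auto simp: dist_commute dist_norm norm_minus_commute)
    finally show ?thesis by simp
  qed
  moreover have "B1 + \<bar>B2\<bar> > 0" using B1 by simp
  ultimately show thesis by (intro that[of "B1 + \<bar>B2\<bar>"])
qed

text \<open>From the nearest point of the level line for \<open>n\<close> one moves radially to the
  level line for \<open>n'\<close>, and the distortion theorem with w = \<open>z\<close> bounds the
  new distance. It serves to replace degree M n by degree n.\<close>

lemma rn_coarser:
  obtains C and K :: nat where "C \<ge> 1"
    "\<And>n n' z. 1 \<le> n' \<Longrightarrow> n' \<le> n \<Longrightarrow> z \<in> L \<Longrightarrow> rn n' z \<le> C * ((real n + 1) / (real n' + 1)) ^ K * rn n z"
proof -
  obtain K :: nat where K: "\<And>w s t. w \<in> closure G \<Longrightarrow> cmod s < 1 \<Longrightarrow> cmod t < 1 \<Longrightarrow>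
     cmod (kappa w s) \<le> (2 * hypdist s t) ^ K * cmod (kappa w t)"
    using kappa_distortion by blast
  have "rn n' z \<le> (2 * 4 ^ K) * ((real n + 1) / (real n' + 1)) ^ K * rn n z"
    if n: "1 \<le> n'" "n' \<le> n" and z: "z \<in> L" for n n' z
  proof -
    have n1: "1 \<le> n" using n by simp
    obtain x where x: "x \<in> Ext" "eta x = 1 / (real n + 1)" "dist z x = rn n z" using rn_attained[OF n1 z] .
    define s where "s = u x"
    have s: "cmod s < 1" "s \<noteq> 0" "V s = x" "1 - cmod s = 1 / (real n + 1)"
      using u_bounds[OF x(1)] V_u[OF x(1)] x by (auto simp: s_def eta_def)
    define e where "e = s / of_real (cmod s)"
    have e: "cmod e = 1" "of_real (cmod s) * e = s" using s by (auto simp: e_def norm_divide)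
    define t where "t = real n' / (real n' + 1)"
    define q where "q = of_real t * e"
    have t0: "0 \<le> t" by (simp add: t_def)
    have "cmod q = real n' / (real n' + 1)" using e t0 by (simp add: q_def norm_mult) (simp add: t_def)
    from V_circle[OF n(1) this] have q: "cmod q < 1" "q \<noteq> 0" "1/2 \<le> cmod q" "eta (V q) = 1 / (real n' + 1)" by auto
    have qt: "cmod q = t" "1 - t = 1 / (real n' + 1)" "0 \<le> t"
      using e t0 by (simp add: q_def norm_mult, simp add: t_def field_simps, simp add: t_def)
    have "1 / (real n + 1) \<le> 1 / (real n' + 1)" using n by (intro divide_left_mono) auto
    then have ts: "t \<le> cmod s" using s(4) qt by linarith
    have "hypdist s q \<le> 2 * ((1 - t) / (1 - cmod s))"
      using hypdist_radial[OF e(1) qt(3) ts s(1)] e(2) by (simp add: q_def)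
    also have "(1 - t) / (1 - cmod s) = (real n + 1) / (real n' + 1)" by (simp add: s(4) qt(2))
    finally have h: "2 * hypdist s q \<le> 4 * ((real n + 1) / (real n' + 1))" by linarith
    have h0: "0 \<le> hypdist s q" using hypdist_ge_1[OF s(1) q(1)] by simp
    have zc: "z \<in> closure G" using z L_closure by auto
    have VE: "V q \<in> Ext" using V_Ext q by blast
    have pos: "dist z x > 0" "dist z (V q) > 0" using x(1) VE z notin_closure_G by auto
    have "cmod (kappa z s) = 1 / (cmod s * dist z x)"
      using kappa_V[OF zc s(1,2)] s by (simp add: norm_divide norm_mult dist_norm norm_minus_commute)
    moreover have "cmod (kappa z q) = 1 / (cmod q * dist z (V q))"
      using kappa_V[OF zc q(1,2)] by (simp add: norm_divide norm_mult dist_norm norm_minus_commute)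
    ultimately have "1 / (cmod s * dist z x) \<le> (2 * hypdist s q) ^ K * (1 / (cmod q * dist z (V q)))"
      using K[OF zc s(1) q(1)] by simp
    then have "cmod q * dist z (V q) \<le> (2 * hypdist s q) ^ K * (cmod s * dist z x)"
      using pos q s by (simp add: field_simps)
    also have "\<dots> \<le> (4 * ((real n + 1) / (real n' + 1))) ^ K * (1 * dist z x)"
    proof (intro mult_mono)
      show "(2 * hypdist s q) ^ K \<le> (4 * ((real n + 1) / (real n' + 1))) ^ K" by (rule power_mono[OF h]) (use h0 in simp)
    qed (use s in auto)
    finally have *: "cmod q * dist z (V q) \<le> (4 * ((real n + 1) / (real n' + 1))) ^ K * rn n z" using x by simp
    have "1/2 * dist z (V q) \<le> cmod q * dist z (V q)" using q pos by (intro mult_right_mono) auto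
    moreover have "rn n' z \<le> dist z (V q)" using rn_le[OF n(1)] q by simp
    ultimately have "rn n' z \<le> 2 * ((4 * ((real n + 1) / (real n' + 1))) ^ K * rn n z)" using * by linarith
    then show ?thesis unfolding power_mult_distrib by (simp add: mult_ac)
  qed
  note main = this
  have "1 \<le> 2 * (4::real) ^ K" using one_le_power[of "4::real" K] by linarith
  then show thesis by (rule that[OF _ main])
qed

text \<open>Compactness of the set of exterior points at bounded distance from \<open>L\<close> and
  at distance at least \<open>e\<close> from it. It covers scales above those for which corkscrew
  points are available.\<close>

lemma eta_deep:
  assumes e: "e > 0"
  obtains c where "0 < c" "c \<le> 1" "\<And>z a. z \<in> L \<Longrightarrow> a \<in> Ext \<Longrightarrow> dist z a \<le> B \<Longrightarrow> e \<le> infdist a L \<Longrightarrow> c \<le> eta a"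
proof -
  obtain B2 where B2: "\<And>z. z \<in> L \<Longrightarrow> dist w0 z \<le> B2"
    using compact_imp_bounded[OF compact_L] bounded_any_center[of L w0] by auto
  define T where "T = {x. e \<le> infdist x L} \<inter> (- G) \<inter> cball w0 (B + B2)"
  have "closed {x. e \<le> infdist x L}" by (intro closed_Collect_le continuous_intros)
  then have cT: "compact T" unfolding T_def
    using open_G by (intro closed_Int_compact closed_Int) (auto simp: closed_Compl)
  have TE: "x \<in> Ext" if "x \<in> T" for x
  proof -
    have "x \<notin> L" using that e by (auto simp: T_def)
    then show ?thesis using that notin_closure_G by (auto simp: T_def)
  qed
  have inT: "a \<in> T" if "z \<in> L" "a \<in> Ext" "dist z a \<le> B" "e \<le> infdist a L" for z a
    using that B2[OF that(1)] dist_triangle[of w0 a z] notin_closure_G by (auto simp: T_def)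
  show thesis
  proof (cases "T = {}")
    case True
    have "1/2 \<le> eta a" if "z \<in> L" "a \<in> Ext" "dist z a \<le> B" "e \<le> infdist a L" for z a
      using inT[OF that] True by blast
    then show thesis by (rule that[rotated 2]) auto
  next
    case False
    obtain m where m: "m \<in> T" "\<And>x. x \<in> T \<Longrightarrow> eta m \<le> eta x"
      using continuous_attains_inf[OF cT False, of eta] continuous_on_subset[OF eta_continuous] by blast
    show thesis
    proof (rule that)
      show "0 < eta m" using eta_pos TE m by blast
      show "eta m \<le> 1" using eta_less1[of m] by simp
      show "eta m \<le> eta a" if "z \<in> L" "a \<in> Ext" "dist z a \<le> B" "e \<le> infdist a L" for z a
        using m(2)[OF inT[OF that]] .
    qed
  qed
qed

text \<open>At a corkscrew point of scale rn n z / 2 Carleson's estimate is compared with the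
  nearest point of the level line, where \<open>eta\<close> is exactly 1 / (n + 1). The strict
  inequality for dist z a places a below that level, so \<open>eta a\<close> is of order 1 / (n + 1)
  from both sides.\<close>

lemma good_exterior_point:
  obtains c where "0 < c" "c \<le> 1"
    "\<And>n z. n \<ge> 1 \<Longrightarrow> z \<in> L \<Longrightarrow> \<exists>a\<in>Ext. dist z a < rn n z \<and> c * rn n z \<le> infdist a L \<and> c / (real n + 1) \<le> eta a"
proof -
  obtain r1 where r1: "r1 > 0" "\<And>z r. z \<in> L \<Longrightarrow> 0 < r \<Longrightarrow> r \<le> r1 \<Longrightarrow> \<exists>m\<in>Ext. dist z m \<le> r \<and> ck * r \<le> infdist m L"
    by (fact corkscrew_Ext)
  obtain r2 C where r2: "r2 > 0" "C \<ge> 1"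
    "\<And>z r a b. z \<in> L \<Longrightarrow> 0 < r \<Longrightarrow> r \<le> r2 \<Longrightarrow> a \<in> Ext \<Longrightarrow> dist z a \<le> r \<Longrightarrow> ck * r \<le> infdist a L \<Longrightarrow>
     dist z b \<le> 2 * r \<Longrightarrow> eta b \<le> C * eta a"
    by (fact eta_Carleson)
  obtain B where B: "B > 0" "\<And>n z. n \<ge> 1 \<Longrightarrow> z \<in> L \<Longrightarrow> rn n z \<le> B" by (fact rn_bounded)
  define r0 where "r0 = min r1 r2"
  have r0: "r0 > 0" "r0 \<le> r1" "r0 \<le> r2" using r1 r2 by (auto simp: r0_def)
  have e: "ck * r0 > 0" using ck r0 by simp
  obtain c1 where c1: "0 < c1" "c1 \<le> 1" "\<And>z a. z \<in> L \<Longrightarrow> a \<in> Ext \<Longrightarrow> dist z a \<le> r0 \<Longrightarrow> ck * r0 \<le> infdist a L \<Longrightarrow> c1 \<le> eta a"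
    by (fact eta_deep[OF e])
  define c where "c = Min {ck / 2, 1 / C, ck * r0 / B, c1}"
  have c: "0 < c" "c \<le> ck / 2" "c \<le> 1 / C" "c \<le> ck * r0 / B" "c \<le> c1" "c \<le> 1"
  proof -
    show "0 < c" using ck r2(2) r0 B(1) c1 by (simp add: c_def)
    show "c \<le> ck / 2" "c \<le> 1 / C" "c \<le> ck * r0 / B" and cc: "c \<le> c1" unfolding c_def by (rule Min_le; simp)+
    show "c \<le> 1" using cc c1 by linarith
  qed
  have "\<exists>a\<in>Ext. dist z a < rn n z \<and> c * rn n z \<le> infdist a L \<and> c / (real n + 1) \<le> eta a"
    if n: "n \<ge> 1" and z: "z \<in> L" for n z
  proof (cases "rn n z / 2 \<le> r0")
    case True
    define r where "r = rn n z / 2"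
    have r: "0 < r" "r \<le> r1" "r \<le> r2" "rn n z = 2 * r" using rn_pos[OF n z] True r0 by (auto simp: r_def)
    obtain a where a: "a \<in> Ext" "dist z a \<le> r" "ck * r \<le> infdist a L" using r1(2)[OF z r(1,2)] by blast
    obtain b where b: "eta b = 1 / (real n + 1)" "dist z b = rn n z" using rn_attained[OF n z] by metis
    have "1 / (real n + 1) \<le> C * eta a" using r2(3)[OF z r(1,3) a, of b] b(2) r(4) unfolding b(1) by simp
    then have "1 / C * (1 / (real n + 1)) \<le> 1 / C * (C * eta a)" using r2(2) by (intro mult_left_mono) auto
    then have "1 / C * (1 / (real n + 1)) \<le> eta a" using r2(2) by simp
    moreover have "c * (1 / (real n + 1)) \<le> 1 / C * (1 / (real n + 1))" using c by (intro mult_right_mono) auto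
    ultimately have "c / (real n + 1) \<le> eta a" by simp
    moreover have "c * rn n z \<le> infdist a L"
    proof -
    have "c * rn n z \<le> ck / 2 * rn n z" using c r by (intro mult_right_mono) auto
    also have "ck / 2 * rn n z = ck * r" using r(4) by simp
    finally show ?thesis using a by linarith
    qed
    ultimately show ?thesis using a r by (intro bexI[of _ a]) auto
  next
    case False
    obtain a where a: "a \<in> Ext" "dist z a \<le> r0" "ck * r0 \<le> infdist a L" using r1(2)[OF z r0(1,2)] by blast
    have "c * rn n z \<le> ck * r0 / B * B" using c B(1) B(2)[OF n z] rn_pos[OF n z] by (intro mult_mono) auto
    then have "c * rn n z \<le> infdist a L" using a B by simp
    moreover have "c / (real n + 1) \<le> c1 / 1" using c n by (intro frac_le) auto
    then have "c / (real n + 1) \<le> eta a" using c1(3)[OF z a] by simp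
    ultimately show ?thesis using a False rn_pos[OF n z] by (intro bexI[of _ a]) auto
  qed
  then show thesis by (rule that[OF c(1,6)])
qed

text \<open>Carleson's estimate is iterated: a corkscrew point at scale s lies in the disc where the
  previous bound holds and controls \<open>eta\<close> on the disc of radius 2 s. Each doubling
  costs \<open>C <= 2 ^ K\<close>, which gives a K-th power of the ratio of radii.\<close>

lemma eta_growth:
  obtains C and K :: nat where "C \<ge> 1"
    "\<And>n z D x. n \<ge> 1 \<Longrightarrow> z \<in> L \<Longrightarrow> rn n z \<le> D \<Longrightarrow> dist z x \<le> D \<Longrightarrow> eta x \<le> C * (D / rn n z) ^ K / (real n + 1)"
proof -
  obtain r1 where r1: "r1 > 0" "\<And>z r. z \<in> L \<Longrightarrow> 0 < r \<Longrightarrow> r \<le> r1 \<Longrightarrow> \<exists>m\<in>Ext. dist z m \<le> r \<and> ck * r \<le> infdist m L"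
    by (fact corkscrew_Ext)
  obtain r2 C where r2: "r2 > 0" "C \<ge> 1"
    "\<And>z r a b. z \<in> L \<Longrightarrow> 0 < r \<Longrightarrow> r \<le> r2 \<Longrightarrow> a \<in> Ext \<Longrightarrow> dist z a \<le> r \<Longrightarrow> ck * r \<le> infdist a L \<Longrightarrow>
     dist z b \<le> 2 * r \<Longrightarrow> eta b \<le> C * eta a"
    by (fact eta_Carleson)
  define r0 where "r0 = min r1 r2"
  have r0: "r0 > 0" "r0 \<le> r1" "r0 \<le> r2" using r1 r2 by (auto simp: r0_def)
  have e: "ck * r0 > 0" using ck r0 by simp
  obtain c1 where c1: "0 < c1" "c1 \<le> 1" "\<And>z a. z \<in> L \<Longrightarrow> a \<in> Ext \<Longrightarrow> dist z a \<le> r0 \<Longrightarrow> ck * r0 \<le> infdist a L \<Longrightarrow> c1 \<le> eta a"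
    by (fact eta_deep[OF e])
  obtain K where K: "C \<le> 2 ^ K" using real_arch_pow[of 2 C] by (auto intro: less_imp_le)
  have dbl: "eta x \<le> C ^ j / (real n + 1)"
    if n: "n \<ge> 1" and z: "z \<in> L" and j: "2 ^ j * (rn n z / 2) \<le> 2 * r0" and x: "dist z x \<le> 2 ^ j * (rn n z / 2)" for n z j x
    using j x
  proof (induction j arbitrary: x)
    case 0
    then have "dist z x < rn n z" using rn_pos[OF n z] by simp
    then show ?case using eta_inside[OF n z] by (simp add: less_imp_le)
  next
    case (Suc j)
    define s where "s = 2 ^ j * (rn n z / 2)"
    have s: "0 < s" "s \<le> r1" "s \<le> r2" "s \<le> 2 * r0" "dist z x \<le> 2 * s"
      using rn_pos[OF n z] Suc.prems r0 by (auto simp: s_def)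
    obtain a where a: "a \<in> Ext" "dist z a \<le> s" "ck * s \<le> infdist a L" using r1(2)[OF z s(1,2)] by blast
    have "eta x \<le> C * eta a" by (rule r2(3)[OF z s(1,3) a s(5)])
    also have "\<dots> \<le> C * (C ^ j / (real n + 1))"
      using Suc.IH[of a] a s r2(2) by (intro mult_left_mono) (auto simp: s_def)
    finally show ?case by simp
  qed
  have near: "eta x \<le> 4 ^ K * (D / rn n z) ^ K / (real n + 1)"
    if n: "n \<ge> 1" and z: "z \<in> L" and D: "rn n z \<le> D" "D \<le> r0" "dist z x \<le> D" for n z D x
  proof -
    define \<rho> where "\<rho> = rn n z"
    have rp: "\<rho> > 0" using rn_pos[OF n z] by (simp add: \<rho>_def)
    obtain k where "2 * D / \<rho> < 2 ^ k" using real_arch_pow[of 2 "2 * D / \<rho>"] by auto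
    then have k: "D \<le> 2 ^ k * (\<rho> / 2)" using rp by (simp add: pos_divide_less_eq)
    define J where "J = (LEAST k. D \<le> 2 ^ k * (\<rho> / 2))"
    have J: "D \<le> 2 ^ J * (\<rho> / 2)" unfolding J_def using k by (rule LeastI)
    have "J \<noteq> 0" using J D rp by (intro notI) (simp add: \<rho>_def)
    then obtain i where i: "J = Suc i" using not0_implies_Suc by blast
    have "\<not> D \<le> 2 ^ i * (\<rho> / 2)" using not_less_Least[of i "\<lambda>k. D \<le> 2 ^ k * (\<rho> / 2)"] i J_def by auto
    then have iD: "2 ^ i * \<rho> \<le> 2 * D" by simp
    have "2 ^ J * (\<rho> / 2) \<le> 2 * r0" using iD D(2) by (simp add: i)
    then have "eta x \<le> C ^ J / (real n + 1)" using dbl[OF n z, of J x] J D(3) by (simp add: \<rho>_def)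
    also have "\<dots> \<le> (4 * D / \<rho>) ^ K / (real n + 1)"
    proof (intro divide_right_mono)
      have "C ^ J \<le> (2 ^ K) ^ J" using K r2(2) by (intro power_mono) auto
      also have "\<dots> = (2 ^ J) ^ K" by (simp add: power_mult[symmetric] mult.commute)
      also have "\<dots> \<le> (4 * D / \<rho>) ^ K" using iD rp by (intro power_mono) (auto simp: i pos_le_divide_eq mult_ac)
      finally show "C ^ J \<le> (4 * D / \<rho>) ^ K" .
    qed simp
    finally show ?thesis by (simp add: \<rho>_def power_mult_distrib power_divide)
  qed
  \<comment> \<open>For D beyond r0 the right side is at least 1: a corkscrew point at scale r0 has
    \<open>eta\<close> at least c1, while its \<open>eta\<close> obeys the bound without the factor
    1 / c1.\<close>
  have "eta x \<le> (4 ^ K / c1) * (D / rn n z) ^ K / (real n + 1)"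
    if n: "n \<ge> 1" and z: "z \<in> L" and D: "rn n z \<le> D" and x: "dist z x \<le> D" for n z D x
  proof -
    have rp: "rn n z > 0" by (rule rn_pos[OF n z])
    have D1: "1 \<le> D / rn n z" using D rp by simp
    show ?thesis
    proof (cases "D \<le> r0")
      case True
      have "eta x \<le> 4 ^ K * (D / rn n z) ^ K / (real n + 1)" by (rule near[OF n z D True x])
      also have "\<dots> \<le> (4 ^ K / c1) * (D / rn n z) ^ K / (real n + 1)"
        using c1 D1 by (intro divide_right_mono mult_right_mono) (auto simp: pos_le_divide_eq mult_left_le)
      finally show ?thesis .
    next
      case False
      obtain a where a: "a \<in> Ext" "dist z a \<le> r0" "ck * r0 \<le> infdist a L" using r1(2)[OF z r0(1,2)] by blast
      have ca: "c1 \<le> eta a" by (rule c1(3)[OF z a])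
      have "c1 \<le> 4 ^ K * (D / rn n z) ^ K / (real n + 1)"
      proof (cases "rn n z \<le> r0")
        case True
        have "eta a \<le> 4 ^ K * (r0 / rn n z) ^ K / (real n + 1)" by (rule near[OF n z True order.refl a(2)])
        also have "\<dots> \<le> 4 ^ K * (D / rn n z) ^ K / (real n + 1)"
          using False rp r0 by (intro divide_right_mono mult_left_mono power_mono) auto
        finally show ?thesis using ca by simp
      next
        case F2: False
        then have "eta a < 1 / (real n + 1)" using eta_inside[OF n z, of a] a by simp
        also have "\<dots> \<le> 4 ^ K * (D / rn n z) ^ K / (real n + 1)"
        proof (intro divide_right_mono)
          have "1 * 1 \<le> 4 ^ K * (D / rn n z) ^ K" using D1 by (intro mult_mono one_le_power) auto
          then show "1 \<le> 4 ^ K * (D / rn n z) ^ K" by simp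
        qed simp
        finally show ?thesis using ca by simp
      qed
      then have "c1 / c1 \<le> 4 ^ K * (D / rn n z) ^ K / (real n + 1) / c1" using c1 by (intro divide_right_mono) auto
      then have "1 \<le> (4 ^ K / c1) * (D / rn n z) ^ K / (real n + 1)" using c1 by (simp add: mult_ac)
      then show ?thesis using eta_less1[of x] by linarith
    qed
  qed
  note main = this
  have "1 \<le> (4::real) ^ K" by simp
  then have "1 * c1 \<le> 4 ^ K" using c1(2) by linarith
  then have "1 \<le> 4 ^ K / c1" using c1(1) by (simp only: pos_le_divide_eq)
  then show thesis by (rule that[OF _ main])
qed

text \<open>Let y be at distance D from z'. Hoelder decay at z' bounds \<open>eta y\<close> from
  below in terms of rn n z', because the level-line point nearest to z' has \<open>eta\<close> equal
  to 1 / (n + 1); \<open>eta_growth\<close> at z bounds \<open>eta y\<close> from above. In the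
  comparison the powers of 1 / (n + 1) cancel.\<close>

lemma rn_compare:
  obtains C and k :: nat where "C \<ge> 1"
    "\<And>n z z'. n \<ge> 1 \<Longrightarrow> z \<in> L \<Longrightarrow> z' \<in> L \<Longrightarrow> rn n z \<le> C * ((dist z z' + rn n z) / rn n z) ^ k * rn n z'"
proof -
  obtain D0 C2 and k :: nat where h: "D0 > 0" "C2 \<ge> 1" "k > 0"
    "\<And>z x D. z \<in> L \<Longrightarrow> x \<in> Ext \<Longrightarrow> dist z x \<le> D \<Longrightarrow> D \<le> D0 \<Longrightarrow>
       \<exists>y\<in>Ext. dist z y = D \<and> eta x ^ k * D \<le> C2 * dist z x * eta y ^ k"
    by (fact eta_Hoelder)
  obtain C3 and K :: nat where g: "C3 \<ge> 1"
    "\<And>n z D x. n \<ge> 1 \<Longrightarrow> z \<in> L \<Longrightarrow> rn n z \<le> D \<Longrightarrow> dist z x \<le> D \<Longrightarrow> eta x \<le> C3 * (D / rn n z) ^ K / (real n + 1)"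
    by (fact eta_growth)
  obtain B where B: "B > 0" "\<And>n z. n \<ge> 1 \<Longrightarrow> z \<in> L \<Longrightarrow> rn n z \<le> B" by (fact rn_bounded)
  \<comment> \<open>Hoelder decay is available only up to D0, so D is capped there. As
    \<open>rn\<close> is bounded by \<open>B\<close>, the capped length is still at least \<theta>
    \<open>rn n z\<close>.\<close>
  define \<theta> where "\<theta> = min 1 (D0 / B)"
  have th: "0 < \<theta>" "\<theta> \<le> 1" using h B by (auto simp: \<theta>_def)
  define C where "C = C2 / \<theta> * (C3 * 2 ^ K) ^ k"
  have C: "1 / \<theta> \<le> C"
  proof -
    have "1 * 1 \<le> C3 * 2 ^ K" using g(1) by (intro mult_mono) auto
    then have "1 \<le> (C3 * 2 ^ K) ^ k" by (intro one_le_power) simp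
    then have "1 / \<theta> * 1 \<le> C2 / \<theta> * (C3 * 2 ^ K) ^ k"
      using h(2) th by (intro mult_mono divide_right_mono) auto
    then show ?thesis by (simp add: C_def)
  qed
  have "1 \<le> 1 / \<theta>" using th by simp
  then have C1: "1 \<le> C" using C by linarith
  have "rn n z \<le> C * ((dist z z' + rn n z) / rn n z) ^ (K * k) * rn n z'"
    if n: "n \<ge> 1" and z: "z \<in> L" and z': "z' \<in> L" for n z z'
  proof -
    define \<rho> where "\<rho> = rn n z"
    define \<rho>' where "\<rho>' = rn n z'"
    define D where "D = dist z z' + \<rho>"
    have rp: "\<rho> > 0" "\<rho>' > 0" using rn_pos[OF n] z z' by (auto simp: \<rho>_def \<rho>'_def)
    have D: "\<rho> \<le> D" "1 \<le> D / \<rho>" using rp by (auto simp: D_def)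
    define D2 where "D2 = min D D0"
    have D2: "\<theta> * \<rho> \<le> D2"
    proof -
      have "\<theta> * \<rho> \<le> 1 * \<rho>" using th rp by (intro mult_right_mono) auto
      moreover have "\<theta> * \<rho> \<le> D0 / B * B"
        using th rp B(1) B(2)[OF n z] h(1) by (intro mult_mono) (auto simp: \<theta>_def \<rho>_def)
      ultimately show ?thesis using D B(1) by (simp add: D2_def)
    qed
    have "\<theta> * \<rho> \<le> \<theta> * C * (D / \<rho>) ^ (K * k) * \<rho>'"
    proof (cases "D2 \<le> \<rho>'")
      case True
      have "1 * 1 \<le> (\<theta> * C) * (D / \<rho>) ^ (K * k)"
        using C th D by (intro mult_mono one_le_power) (auto simp: pos_divide_le_eq mult.commute)
      then have "1 * \<rho>' \<le> (\<theta> * C) * (D / \<rho>) ^ (K * k) * \<rho>'" using rp by (intro mult_right_mono) auto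
      then show ?thesis using D2 True by linarith
    next
      case False
      obtain x where x: "x \<in> Ext" "eta x = 1 / (real n + 1)" "dist z' x = \<rho>'"
        using rn_attained[OF n z'] unfolding \<rho>'_def by metis
      have D20: "D2 \<le> D0" by (simp add: D2_def)
      have xD: "dist z' x \<le> D2" using x False by simp
      obtain y where y: "y \<in> Ext" "dist z' y = D2" "eta x ^ k * D2 \<le> C2 * dist z' x * eta y ^ k"
        using h(4)[OF z' x(1) xD D20] by blast
      have "dist z y \<le> 2 * D" using dist_triangle[of z y z'] y rp by (simp add: D_def D2_def)
      then have "eta y \<le> C3 * (2 * D / \<rho>) ^ K / (real n + 1)"
        unfolding \<rho>_def using D rp by (intro g(2)[OF n z]) (auto simp: \<rho>_def)
      then have "eta y ^ k \<le> (C3 * (2 * D / \<rho>) ^ K / (real n + 1)) ^ k" using eta_nonneg by (intro power_mono) auto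
      then have "C2 * \<rho>' * eta y ^ k \<le> C2 * \<rho>' * (C3 * (2 * D / \<rho>) ^ K / (real n + 1)) ^ k"
        using h(2) rp by (intro mult_left_mono) auto
      then have "(1 / (real n + 1)) ^ k * D2 \<le> C2 * \<rho>' * (C3 * (2 * D / \<rho>) ^ K / (real n + 1)) ^ k"
        using y(3) unfolding x by linarith
      also have "(C3 * (2 * D / \<rho>) ^ K / (real n + 1)) ^ k = (1 / (real n + 1)) ^ k * (C3 * (2 * D / \<rho>) ^ K) ^ k"
        unfolding power_mult_distrib[symmetric] by simp
      finally have "(1 / (real n + 1)) ^ k * D2 \<le> (1 / (real n + 1)) ^ k * (C2 * \<rho>' * (C3 * (2 * D / \<rho>) ^ K) ^ k)"
        by (simp only: mult_ac)
      then have "D2 \<le> C2 * \<rho>' * (C3 * (2 * D / \<rho>) ^ K) ^ k"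
        by (rule mult_left_le_imp_le) simp
      also have "\<dots> = \<theta> * C * (D / \<rho>) ^ (K * k) * \<rho>'"
        using th by (simp add: C_def power_mult_distrib power_divide power_mult)
      finally show ?thesis using D2 by linarith
    qed
    then have "\<theta> * \<rho> \<le> \<theta> * (C * (D / \<rho>) ^ (K * k) * \<rho>')" by (simp add: mult.assoc)
    then show ?thesis using th by (simp add: \<rho>_def \<rho>'_def D_def)
  qed
  then show thesis by (rule that[OF C1])
qed

end

section \<open>Localizing polynomials\<close>

context quasidisk_chart begin

text \<open>The polynomial for 1 / (a - w), with a from \<open>good_exterior_point\<close>, is
  normalized at \<open>z\<close>. Since |a - z| < \<rho> and a is at distance at least c \<rho> from
  \<open>L\<close>, the distance |a - w| is comparable with |z - w| + \<rho>.\<close>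

lemma poly_localizing_linear:
  obtains C and M :: nat where "C \<ge> 1" "M \<ge> 1"
    "\<And>n z. n \<ge> 1 \<Longrightarrow> z \<in> L \<Longrightarrow> \<exists>q :: complex poly. degree q \<le> M * n \<and> poly q z = 1 \<and>
       (\<forall>w\<in>closure G. cmod (poly q w) \<le> C * (rn n z / (dist z w + rn n z)))"
proof -
  obtain c where c: "0 < c" "c \<le> 1"
    "\<And>n z. n \<ge> 1 \<Longrightarrow> z \<in> L \<Longrightarrow> \<exists>a\<in>Ext. dist z a < rn n z \<and> c * rn n z \<le> infdist a L \<and> c / (real n + 1) \<le> eta a"
    by (fact good_exterior_point)
  obtain M0 where M0: "M0 > 0" "\<And>s N. 1/2 \<le> cmod s \<Longrightarrow> cmod s < 1 \<Longrightarrow> M0 \<le> real N * (1 - cmod s) \<Longrightarrow>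
     \<exists>p. degree p \<le> N \<and> (\<forall>w\<in>closure G. cmod (poly p w - 1 / (V s - w)) \<le> 1/2 * (1 / cmod (V s - w)))"
    using poly_kernel by auto
  \<comment> \<open>With \<open>eta a >= c / (n + 1)\<close> and n / (n + 1) >= 1/2, this M gives M
    n (1 - |s|) >= M0, the condition of \<open>poly_kernel\<close>.\<close>
  obtain M :: nat where M: "2 * M0 / c \<le> real M" using real_arch_simple by blast
  have "0 < 2 * M0 / c" using M0 c by simp
  then have M1: "M \<ge> 1" using M by (cases M) auto
  have "\<exists>q. degree q \<le> M * n \<and> poly q z = 1 \<and>
       (\<forall>w\<in>closure G. cmod (poly q w) \<le> 3 * (1 + 2 / c) * (rn n z / (dist z w + rn n z)))"
    if n: "n \<ge> 1" and z: "z \<in> L" for n z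
  proof -
    define \<rho> where "\<rho> = rn n z"
    have rp: "\<rho> > 0" using rn_pos[OF n z] by (simp add: \<rho>_def)
    obtain a where a: "a \<in> Ext" "dist z a < \<rho>" "c * \<rho> \<le> infdist a L" "c / (real n + 1) \<le> eta a"
      using c(3)[OF n z] unfolding \<rho>_def by blast
    define s where "s = u a"
    have s: "cmod s < 1" "s \<noteq> 0" "V s = a" "1 - cmod s = eta a"
      using u_bounds[OF a(1)] V_u[OF a(1)] a(1) by (auto simp: s_def eta_def)
    have "eta a < 1 / (real n + 1)" using eta_inside[OF n z] a by (simp add: \<rho>_def)
    also have "\<dots> \<le> 1/2" using n by (intro divide_left_mono) auto
    finally have s2: "1/2 \<le> cmod s" using s(4) by linarith
    have "M0 \<le> real (M * n) * (1 - cmod s)"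
    proof -
      have "M0 = (2 * M0 / c) * (1/2 * c)" using c by simp
      also have "\<dots> \<le> real M * (real n * (c / (real n + 1)))"
      proof (rule mult_mono[OF M])
        have "1/2 * c * (real n + 1) \<le> real n * c" using n c(1) by (simp add: field_simps)
        then show "1/2 * c \<le> real n * (c / (real n + 1))" by (simp add: pos_le_divide_eq)
      qed (use c in auto)
      also have "\<dots> \<le> real M * (real n * eta a)" using a(4) by (intro mult_left_mono) auto
      finally show ?thesis by (simp add: s(4) mult.assoc)
    qed
    from M0(2)[OF s2 s(1) this] obtain p where p: "degree p \<le> M * n"
      "\<And>w. w \<in> closure G \<Longrightarrow> cmod (poly p w - 1 / (a - w)) \<le> 1/2 * (1 / cmod (a - w))" using s(3) by auto
    have up: "cmod (poly p w) \<le> 3/2 * (1 / cmod (a - w))" if "w \<in> closure G" for w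
      using p(2)[OF that] norm_triangle_ineq2[of "poly p w" "1 / (a - w)"] by (simp add: norm_divide)
    have zc: "z \<in> closure G" using z L_closure by auto
    have az: "cmod (a - z) > 0" using a(1) zc by auto
    have lo: "1/2 * (1 / cmod (a - z)) \<le> cmod (poly p z)"
      using p(2)[OF zc] norm_triangle_ineq3[of "1 / (a - z)" "poly p z"] by (simp add: norm_divide norm_minus_commute)
    have "0 < 1/2 * (1 / cmod (a - z))" using az by simp
    then have pz: "cmod (poly p z) > 0" using lo by linarith
    define q where "q = smult (1 / poly p z) p"
    have "degree q \<le> M * n" unfolding q_def using p(1) degree_smult_le order.trans by blast
    moreover have "poly q z = 1" using pz by (simp add: q_def)
    moreover have "cmod (poly q w) \<le> 3 * (1 + 2 / c) * (\<rho> / (dist z w + \<rho>))" if w: "w \<in> closure G" for w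
    proof -
      have aw: "c * \<rho> \<le> cmod (a - w)" using infdist_le_dist_closure[OF a(1) w] a(3) by (simp add: dist_norm)
      have awp: "cmod (a - w) > 0" using aw c rp by (smt (verit) mult_pos_pos)
      have ra: "\<rho> \<le> cmod (a - w) / c" using aw c by (simp add: pos_le_divide_eq mult.commute)
      have "dist z w \<le> dist z a + cmod (a - w)" using dist_triangle[of z w a] by (simp add: dist_norm)
      then have "dist z w + \<rho> \<le> cmod (a - w) + 2 * (cmod (a - w) / c)" using a(2) ra by linarith
      then have zw: "dist z w + \<rho> \<le> (1 + 2 / c) * cmod (a - w)" by (simp add: algebra_simps)
      have "cmod (poly q w) = cmod (poly p w) / cmod (poly p z)" by (simp add: q_def norm_divide)
      also have "\<dots> \<le> (3/2 * (1 / cmod (a - w))) / (1/2 * (1 / cmod (a - z)))"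
        using up[OF w] lo az by (intro frac_le) auto
      also have "\<dots> = 3 * (cmod (a - z) / cmod (a - w))" using az awp by (simp add: field_simps)
      also have "\<dots> \<le> 3 * (\<rho> / ((dist z w + \<rho>) / (1 + 2 / c)))"
        using a(2) rp c awp zw
        by (intro mult_left_mono frac_le)
           (auto simp: dist_norm norm_minus_commute pos_divide_le_eq mult.commute add_pos_pos add_nonneg_pos intro!: divide_pos_pos)
      also have "\<dots> = 3 * (1 + 2 / c) * (\<rho> / (dist z w + \<rho>))" by simp
      finally show ?thesis .
    qed
    ultimately show ?thesis unfolding \<rho>_def by blast
  qed
  note main = this
  have "3 * (1 + 2 / c) \<ge> 1" using c by (simp add: add_increasing)
  then show thesis by (rule that[OF _ M1 main])
qed

lemma poly_localizing:
  obtains C and M :: nat where "C \<ge> 1" "M \<ge> 1"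
    "\<And>n z. n \<ge> 1 \<Longrightarrow> z \<in> L \<Longrightarrow> \<exists>q :: complex poly. degree q \<le> M * n \<and> poly q z = 1 \<and>
       (\<forall>w\<in>closure G. cmod (poly q w) \<le> C * (rn n z / (dist z w + rn n z)) ^ k)"
proof -
  obtain C and M :: nat where M: "C \<ge> 1" "M \<ge> 1"
    "\<And>n z. n \<ge> 1 \<Longrightarrow> z \<in> L \<Longrightarrow> \<exists>q :: complex poly. degree q \<le> M * n \<and> poly q z = 1 \<and>
       (\<forall>w\<in>closure G. cmod (poly q w) \<le> C * (rn n z / (dist z w + rn n z)))"
    by (fact poly_localizing_linear)
  \<comment> \<open>\<open>Suc k\<close> instead of k keeps the degree factor at least 1 when k =
    0.\<close>
  have "\<exists>q :: complex poly. degree q \<le> (M * Suc k) * n \<and> poly q z = 1 \<and>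
       (\<forall>w\<in>closure G. cmod (poly q w) \<le> C ^ k * (rn n z / (dist z w + rn n z)) ^ k)"
    if n: "n \<ge> 1" and z: "z \<in> L" for n z
  proof -
    obtain q where q: "degree q \<le> M * n" "poly q z = 1"
      "\<And>w. w \<in> closure G \<Longrightarrow> cmod (poly q w) \<le> C * (rn n z / (dist z w + rn n z))" using M(3)[OF n z] by blast
    have "degree (q ^ k) \<le> degree q * k" by (rule degree_power_le)
    also have "\<dots> \<le> M * n * Suc k" using q(1) by (intro mult_mono) auto
    finally have "degree (q ^ k) \<le> (M * Suc k) * n" by (simp add: algebra_simps)
    moreover have "poly (q ^ k) z = 1" using q by simp
    moreover have "cmod (poly (q ^ k) w) \<le> C ^ k * (rn n z / (dist z w + rn n z)) ^ k" if "w \<in> closure G" for w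
      using power_mono[OF q(3)[OF that] norm_ge_zero, of k] by (simp only: poly_power norm_power power_mult_distrib)
    ultimately show ?thesis by blast
  qed
  note main = this
  have "C ^ k \<ge> 1" "M * Suc k \<ge> 1" using M by (auto intro: one_le_power)
  then show thesis by (rule that[OF _ _ main])
qed

text \<open>The polynomial is taken at level \<open>n div M\<close>, and \<open>rn_coarser\<close>
  shows that \<rho> at this level is at most a multiple of \<open>rn n z\<close>. For n < M there is
  no such level, but then \<open>rn n z\<close> is bounded below and the constant polynomial 1 has
  the required bound.\<close>

lemma poly_localizing_degree:
  obtains C where "C \<ge> 1"
    "\<And>n z. n \<ge> 1 \<Longrightarrow> z \<in> L \<Longrightarrow> \<exists>q :: complex poly. degree q \<le> n \<and> poly q z = 1 \<and>
       (\<forall>w\<in>closure G. cmod (poly q w) \<le> C * (rn n z / (dist z w + rn n z)) ^ k)"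
proof -
  obtain C1 and M :: nat where M: "C1 \<ge> 1" "M \<ge> 1"
    "\<And>n z. n \<ge> 1 \<Longrightarrow> z \<in> L \<Longrightarrow> \<exists>q :: complex poly. degree q \<le> M * n \<and> poly q z = 1 \<and>
       (\<forall>w\<in>closure G. cmod (poly q w) \<le> C1 * (rn n z / (dist z w + rn n z)) ^ k)"
    by (fact poly_localizing)
  obtain C2 and K :: nat where K: "C2 \<ge> 1"
    "\<And>n n' z. 1 \<le> n' \<Longrightarrow> n' \<le> n \<Longrightarrow> z \<in> L \<Longrightarrow> rn n' z \<le> C2 * ((real n + 1) / (real n' + 1)) ^ K * rn n z"
    by (fact rn_coarser)
  define A where "A = C2 * real M ^ K"
  have A1: "A \<ge> 1"
  proof -
    have "1 * 1 \<le> C2 * real M ^ K" using K M by (intro mult_mono one_le_power) auto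
    then show ?thesis by (simp add: A_def)
  qed
  have "L \<inter> {x. 1/2 \<le> eta x} = {}" using eta_eq_0 L_closure by fastforce
  then obtain \<epsilon> where e: "\<epsilon> > 0" "\<And>z x. z \<in> L \<Longrightarrow> 1/2 \<le> eta x \<Longrightarrow> \<epsilon> \<le> dist z x"
    using separate_compact_closed[OF compact_L superlevel_closed[of "1/2"]] by auto
  define A2 where "A2 = C2 * (real M + 1) ^ K"
  have A2: "A2 > 0" using K M by (simp add: A2_def)
  obtain B where B: "\<And>z. z \<in> closure G \<Longrightarrow> dist w0 z \<le> B"
    using bounded_closure[OF bounded_G] bounded_any_center[of "closure G" w0] by auto
  have B0: "B \<ge> 0" using B[of w0] w0 closure_G by auto
  define T where "T = 1 + 2 * B * A2 / \<epsilon>"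
  have T1: "T \<ge> 1" using B0 A2 e by (simp add: T_def)
  define C where "C = max (C1 * A ^ k) (T ^ k)"
  have "\<exists>q :: complex poly. degree q \<le> n \<and> poly q z = 1 \<and>
       (\<forall>w\<in>closure G. cmod (poly q w) \<le> C * (rn n z / (dist z w + rn n z)) ^ k)"
    if n: "n \<ge> 1" and z: "z \<in> L" for n z
  proof -
    define \<rho> where "\<rho> = rn n z"
    have rp: "\<rho> > 0" using rn_pos[OF n z] by (simp add: \<rho>_def)
    show ?thesis
    proof (cases "M \<le> n")
      case True
      define n' where "n' = n div M"
      have n': "1 \<le> n'" "n' \<le> n" "M * n' \<le> n" "n + 1 \<le> M * (n' + 1)"
      proof -
        show "1 \<le> n'" using True M(2) by (simp add: n'_def div_greater_zero_iff Suc_le_eq)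
        show "n' \<le> n" "M * n' \<le> n" by (simp_all add: n'_def)
        have "n mod M < M" using M(2) by simp
        moreover have "M * (n' + 1) = M * (n div M) + M" by (simp add: n'_def)
        ultimately show "n + 1 \<le> M * (n' + 1)" using mult_div_mod_eq[of M n] by linarith
      qed
      obtain q where q: "degree q \<le> M * n'" "poly q z = 1"
        "\<And>w. w \<in> closure G \<Longrightarrow> cmod (poly q w) \<le> C1 * (rn n' z / (dist z w + rn n' z)) ^ k"
        using M(3)[OF n'(1) z] by blast
      have rp': "rn n' z > 0" using rn_pos[OF n'(1) z] .
      have "(real n + 1) / (real n' + 1) \<le> real M"
      proof -
        have "real (n + 1) \<le> real (M * (n' + 1))" using n'(4) by (simp only: of_nat_le_iff)
        then show ?thesis by (simp add: pos_divide_le_eq algebra_simps)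
      qed
      then have "((real n + 1) / (real n' + 1)) ^ K \<le> real M ^ K" by (intro power_mono) auto
      then have "C2 * ((real n + 1) / (real n' + 1)) ^ K * \<rho> \<le> A * \<rho>"
        unfolding A_def using K(1) rp by (intro mult_right_mono mult_left_mono) auto
      then have rA: "rn n' z \<le> A * \<rho>" using K(2)[OF n'(1,2) z] by (simp add: \<rho>_def)
      have "cmod (poly q w) \<le> C * (\<rho> / (dist z w + \<rho>)) ^ k" if w: "w \<in> closure G" for w
      proof -
        have "rn n' z / (dist z w + rn n' z) \<le> A * (\<rho> / (dist z w + \<rho>))"
        proof -
          have p: "0 < dist z w + rn n' z" "0 < dist z w + \<rho>" using rp rp' by (auto intro: add_nonneg_pos)
          have "rn n' z * dist z w \<le> A * \<rho> * dist z w" using rA by (intro mult_right_mono) auto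
          moreover have "1 * (rn n' z * \<rho>) \<le> A * (rn n' z * \<rho>)" using A1 rp rp' by (intro mult_right_mono) auto
          ultimately have "rn n' z * (dist z w + \<rho>) \<le> (A * \<rho>) * (dist z w + rn n' z)" by (simp add: algebra_simps)
          then have "rn n' z / (dist z w + rn n' z) \<le> (A * \<rho>) / (dist z w + \<rho>)"
            using p by (simp add: divide_le_eq pos_le_divide_eq mult_ac)
          then show ?thesis by simp
        qed
        then have "(rn n' z / (dist z w + rn n' z)) ^ k \<le> (A * (\<rho> / (dist z w + \<rho>))) ^ k"
          using rp' by (intro power_mono) (auto intro!: divide_nonneg_nonneg)
        then have "C1 * (rn n' z / (dist z w + rn n' z)) ^ k \<le> C1 * (A * (\<rho> / (dist z w + \<rho>))) ^ k"
          using M(1) by (intro mult_left_mono) auto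
        also have "\<dots> = (C1 * A ^ k) * (\<rho> / (dist z w + \<rho>)) ^ k" unfolding power_mult_distrib by simp
        also have "\<dots> \<le> C * (\<rho> / (dist z w + \<rho>)) ^ k" unfolding C_def
          using rp by (intro mult_right_mono) auto
        finally show ?thesis using q(3)[OF w] by linarith
      qed
      then show ?thesis using q n'(3) by (intro exI[of _ q]) (auto simp: \<rho>_def)
    next
      case False
      obtain x where x: "eta x = 1 / (real 1 + 1)" "dist z x = rn 1 z" using rn_attained[of 1 z] z by (metis order_refl)
      have "\<epsilon> \<le> rn 1 z" using e(2)[OF z, of x] x by simp
      also have "\<dots> \<le> C2 * ((real n + 1) / (real 1 + 1)) ^ K * \<rho>" unfolding \<rho>_def by (rule K(2)) (use n z in auto)
      also have "\<dots> \<le> A2 * \<rho>"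
      proof -
        have "(real n + 1) / (real 1 + 1) \<le> real M + 1" using False by simp
        then have "((real n + 1) / (real 1 + 1)) ^ K \<le> (real M + 1) ^ K" by (intro power_mono) auto
        then show ?thesis unfolding A2_def using K(1) rp by (intro mult_right_mono mult_left_mono) auto
      qed
      finally have er: "\<epsilon> \<le> A2 * \<rho>" .
      have "1 \<le> C * (\<rho> / (dist z w + \<rho>)) ^ k" if w: "w \<in> closure G" for w
      proof -
        have "z \<in> closure G" using z L_closure by auto
        then have "dist z w \<le> 2 * B" using B[of z] B[OF w] dist_triangle2[of z w w0] by (simp add: dist_commute)
        also have "2 * B \<le> 2 * B * (A2 * \<rho> / \<epsilon>)" using er e B0 mult_left_mono[of 1 "A2 * \<rho> / \<epsilon>" "2 * B"] by simp
        finally have "dist z w + \<rho> \<le> T * \<rho>" by (simp add: T_def algebra_simps)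
        moreover have "0 < dist z w + \<rho>" using rp by (simp add: add_nonneg_pos)
        ultimately have "1 \<le> T * (\<rho> / (dist z w + \<rho>))" by (simp add: pos_le_divide_eq)
        then have "1 \<le> (T * (\<rho> / (dist z w + \<rho>))) ^ k" by (rule one_le_power)
        also have "\<dots> = T ^ k * (\<rho> / (dist z w + \<rho>)) ^ k" by (rule power_mult_distrib)
        also have "\<dots> \<le> C * (\<rho> / (dist z w + \<rho>)) ^ k" unfolding C_def using rp by (intro mult_right_mono) auto
        finally show ?thesis .
      qed
      then show ?thesis by (intro exI[of _ 1]) (auto simp: \<rho>_def)
    qed
  qed
  note main = this
  have "1 \<le> T ^ k" using T1 by (rule one_le_power)
  then have "C \<ge> 1" by (simp add: C_def)
  then show thesis by (rule that[OF _ main])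
qed

end

section \<open>Integrals of singular weights over the plane\<close>

lemma dyadic_bracket:
  fixes t :: real assumes "1 \<le> t" obtains j where "2 ^ j \<le> t" "t < 2 ^ Suc j"
proof -
  obtain k where k: "t < 2 ^ k" using real_arch_pow[of 2 t] by auto
  define J where "J = (LEAST k. t < 2 ^ k)"
  have J: "t < 2 ^ J" unfolding J_def using k by (rule LeastI)
  have "J \<noteq> 0" using J assms by (intro notI) simp
  then obtain i where i: "J = Suc i" using not0_implies_Suc by blast
  have "\<not> t < 2 ^ i" using not_less_Least[of i "\<lambda>k. t < 2 ^ k"] i J_def by auto
  then show thesis using that[of i] J i by simp
qed

text \<open>Replaces integration in polar coordinates: a radial function is dominated at each point
  by one term of a weighted series of disc indicators, whose integrals are explicit.\<close>

lemma nn_integral_dominated_by_discs: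
  fixes f :: "complex \<Rightarrow> ennreal"
  assumes c: "\<And>j. c j \<ge> 0" and r: "\<And>j. r j \<ge> 0"
    and S: "(\<lambda>j. c j * (pi * (r j)\<^sup>2)) sums S"
    and dom: "\<And>x. \<exists>j. f x \<le> ennreal (c j) * indicator (cball y (r j)) x"
  shows "(\<integral>\<^sup>+x. f x \<partial>lborel) \<le> ennreal S"
proof -
  have "(\<integral>\<^sup>+x. f x \<partial>lborel) \<le> (\<integral>\<^sup>+x. (\<Sum>j. ennreal (c j) * indicator (cball y (r j)) x) \<partial>lborel)"
  proof (rule nn_integral_mono)
    fix x
    obtain j where j: "f x \<le> ennreal (c j) * indicator (cball y (r j)) x" using dom by blast
    also have "\<dots> \<le> (\<Sum>j. ennreal (c j) * indicator (cball y (r j)) x)"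
    proof -
      have "F j \<le> (\<Sum>j. F j)" for F :: "nat \<Rightarrow> ennreal"
        using sum_le_suminf[OF summableI, of "{j}" F] by simp
      then show ?thesis .
    qed
    finally show "f x \<le> (\<Sum>j. ennreal (c j) * indicator (cball y (r j)) x)" .
  qed
  also have "\<dots> = (\<Sum>j. \<integral>\<^sup>+x. ennreal (c j) * indicator (cball y (r j)) x \<partial>lborel)"
  proof (rule nn_integral_suminf)
    have [measurable]: "cball y (r j) \<in> sets borel" for j by simp
    show "(\<lambda>x. ennreal (c j) * indicator (cball y (r j)) x) \<in> borel_measurable lborel" for j by measurable
  qed
  also have "\<dots> = (\<Sum>j. ennreal (c j * (pi * (r j)\<^sup>2)))"
  proof (rule suminf_cong)
    fix j
    have "emeasure lborel (cball y (r j)) = ennreal (pi * (r j)\<^sup>2)"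
      using emeasure_cball[OF r[of j], of y] by (simp add: unit_ball_vol_2)
    then show "(\<integral>\<^sup>+x. ennreal (c j) * indicator (cball y (r j)) x \<partial>lborel) = ennreal (c j * (pi * (r j)\<^sup>2))"
      using c[of j] by (simp add: nn_integral_cmult_indicator ennreal_mult')
  qed
  also have "\<dots> = ennreal S"
  proof -
    have "0 \<le> c j * (pi * (r j)\<^sup>2)" for j using c[of j] by simp
    then show ?thesis by (rule suminf_ennreal_eq[OF _ S])
  qed
  finally show ?thesis .
qed

text \<open>On the disc of radius \<rho> / 2^j the area shrinks like 4^(-j) while the singular
  factor grows like 2^(\<beta> j). The geometric ratio \<open>2 powr \<beta> / 4\<close> is below 1
  because \<beta> < 2.\<close>

lemma nn_integral_power_singularity:
  assumes \<beta>: "0 \<le> \<beta>" "\<beta> < 2"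
  obtains c where "0 \<le> c" "\<And>y \<rho>. 0 < \<rho> \<Longrightarrow>
    (\<integral>\<^sup>+(x::complex). ennreal (if dist y x \<le> \<rho> then (\<rho> / dist y x) powr \<beta> else 0) \<partial>lborel) \<le> ennreal (c * \<rho>\<^sup>2)"
proof -
  define q where "q = 2 powr \<beta> / 4"
  have q: "0 \<le> q" "q < 1"
  proof -
    have "2 powr \<beta> < 2 powr 2" using \<beta> by (intro powr_less_mono) auto
    then show "q < 1" by (simp add: q_def)
  qed (simp add: q_def)
  have "(\<integral>\<^sup>+(x::complex). ennreal (if dist y x \<le> \<rho> then (\<rho> / dist y x) powr \<beta> else 0) \<partial>lborel)
      \<le> ennreal (2 powr \<beta> * pi * (1 / (1 - q)) * \<rho>\<^sup>2)" if \<rho>: "0 < \<rho>" for y \<rho>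
  proof (rule nn_integral_dominated_by_discs[where c="\<lambda>j. (2 powr \<beta>) ^ Suc j" and r="\<lambda>j. \<rho> / 2 ^ j" and y=y])
    have "(\<lambda>j. 2 powr \<beta> * pi * \<rho>\<^sup>2 * q ^ j) sums (2 powr \<beta> * pi * \<rho>\<^sup>2 * (1 / (1 - q)))"
      by (intro sums_mult geometric_sums) (use q in auto)
    moreover have "2 powr \<beta> * pi * \<rho>\<^sup>2 * q ^ j = (2 powr \<beta>) ^ Suc j * (pi * (\<rho> / 2 ^ j)\<^sup>2)" for j
    proof -
      have "(4::real) ^ j = (2 ^ j)\<^sup>2" by (metis power2_eq_square power_mult_distrib mult_2 numeral_Bit0)
      then show ?thesis by (simp add: q_def power_divide)
    qed
    moreover have "2 powr \<beta> * pi * \<rho>\<^sup>2 * (1 / (1 - q)) = 2 powr \<beta> * pi * (1 / (1 - q)) * \<rho>\<^sup>2" by simp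
    ultimately show "(\<lambda>j. (2 powr \<beta>) ^ Suc j * (pi * (\<rho> / 2 ^ j)\<^sup>2)) sums (2 powr \<beta> * pi * (1 / (1 - q)) * \<rho>\<^sup>2)"
      by (simp only:)
    fix x
    show "\<exists>j. ennreal (if dist y x \<le> \<rho> then (\<rho> / dist y x) powr \<beta> else 0)
        \<le> ennreal ((2 powr \<beta>) ^ Suc j) * indicator (cball y (\<rho> / 2 ^ j)) x"
    proof (cases "dist y x \<le> \<rho> \<and> x \<noteq> y")
      case True
      define t where "t = \<rho> / dist y x"
      have d: "dist y x > 0" using True by (metis zero_less_dist_iff)
      have "1 \<le> t" using True d by (simp add: t_def)
      then obtain j where j: "2 ^ j \<le> t" "t < 2 ^ Suc j" by (rule dyadic_bracket)
      have "2 ^ j * dist y x \<le> \<rho>" using j(1) d by (simp add: t_def pos_le_divide_eq)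
      then have "x \<in> cball y (\<rho> / 2 ^ j)" by (simp add: pos_le_divide_eq mult.commute)
      moreover have "t powr \<beta> \<le> (2 powr \<beta>) ^ Suc j"
      proof -
        have "t powr \<beta> \<le> (2 ^ Suc j) powr \<beta>" using j \<beta> \<open>1 \<le> t\<close> by (intro powr_mono2) auto
        also have "\<dots> = (2 powr \<beta>) ^ Suc j" by (simp add: powr_power powr_realpow[symmetric] powr_powr mult.commute powr_mult)
        finally show ?thesis .
      qed
      ultimately show ?thesis using True by (intro exI[of _ j]) (simp add: t_def ennreal_leI)
    next
      case False
      then have "ennreal (if dist y x \<le> \<rho> then (\<rho> / dist y x) powr \<beta> else 0) = 0" by auto
      then show ?thesis by (metis zero_le)
    qed
  qed (use \<rho> in auto)
  moreover have "0 \<le> 2 powr \<beta> * pi * (1 / (1 - q))" using q by simp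
  ultimately show thesis by (intro that)
qed

text \<open>On dyadic discs of radius 2^j \<rho> the fourth power decays like 16^(-j) against an
  area growing like 4^j.\<close>

lemma nn_integral_quartic_decay:
  assumes \<rho>: "0 < \<rho>"
  shows "(\<integral>\<^sup>+(x::complex). ennreal ((\<rho> / (dist y x + \<rho>)) ^ 4) \<partial>lborel) \<le> ennreal (64 / 3 * pi * \<rho>\<^sup>2)"
proof (rule nn_integral_dominated_by_discs[where c="\<lambda>j. 16 / 16 ^ j" and r="\<lambda>j. 2 ^ j * \<rho>" and y=y])
  have "(\<lambda>j. 16 * pi * \<rho>\<^sup>2 * (1/4) ^ j) sums (16 * pi * \<rho>\<^sup>2 * (1 / (1 - 1/4)))"
    by (intro sums_mult geometric_sums) auto
  moreover have "16 * pi * \<rho>\<^sup>2 * (1/4) ^ j = 16 / 16 ^ j * (pi * (2 ^ j * \<rho>)\<^sup>2)" for j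
  proof -
    have "(2 ^ j)\<^sup>2 = (4::real) ^ j" "(16::real) ^ j = 4 ^ j * 4 ^ j"
      by (metis power2_eq_square power_mult_distrib mult_2 numeral_Bit0)
         (metis power_mult_distrib[of 4 4] mult_numeral_1_right numeral_times_numeral semiring_norm(13) semiring_norm(12))
    then show ?thesis by (simp add: power_mult_distrib power_divide)
  qed
  moreover have "16 * pi * \<rho>\<^sup>2 * (1 / (1 - 1/4)) = 64 / 3 * pi * \<rho>\<^sup>2" by simp
  ultimately show "(\<lambda>j. 16 / 16 ^ j * (pi * (2 ^ j * \<rho>)\<^sup>2)) sums (64 / 3 * pi * \<rho>\<^sup>2)" by (simp only:)
  fix x
  show "\<exists>j. ennreal ((\<rho> / (dist y x + \<rho>)) ^ 4) \<le> ennreal (16 / 16 ^ j) * indicator (cball y (2 ^ j * \<rho>)) x"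
  proof (cases "dist y x \<le> \<rho>")
    case True
    have "\<rho> / (dist y x + \<rho>) \<le> 1" using \<rho> by (simp add: divide_le_eq_1 add_nonneg_pos)
    then have "(\<rho> / (dist y x + \<rho>)) ^ 4 \<le> 1" using \<rho> by (intro power_le_one) auto
    then show ?thesis using True by (intro exI[of _ 0]) (simp add: ennreal_leI flip: ennreal_numeral)
  next
    case False
    define t where "t = dist y x / \<rho>"
    have "1 \<le> t" using False \<rho> by (simp add: t_def)
    then obtain i where i: "2 ^ i \<le> t" "t < 2 ^ Suc i" by (rule dyadic_bracket)
    have "dist y x \<le> 2 ^ Suc i * \<rho>" using i(2) \<rho> by (simp add: t_def pos_divide_less_eq)
    moreover have "(\<rho> / (dist y x + \<rho>)) ^ 4 \<le> 16 / 16 ^ Suc i"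
    proof -
      have "\<rho> / (dist y x + \<rho>) \<le> \<rho> / (2 ^ i * \<rho>)"
        using i(1) \<rho> by (intro divide_left_mono) (auto simp: t_def pos_le_divide_eq add_nonneg_pos)
      also have "\<dots> = 1 / 2 ^ i" using \<rho> by simp
      finally have "(\<rho> / (dist y x + \<rho>)) ^ 4 \<le> (1 / 2 ^ i) ^ 4" using \<rho> by (intro power_mono) auto
      also have "(1 / 2 ^ i) ^ 4 = 1 / (16::real) ^ i"
        by (simp add: power_divide flip: power_mult) (simp add: power_mult mult.commute[of i 4])
      finally show ?thesis by simp
    qed
    ultimately show ?thesis by (intro exI[of _ "Suc i"]) (simp add: ennreal_leI)
  qed
qed (use \<rho> in auto)

text \<open>Here d and a stand for the distances of a variable point and of z to a singularity, and
  x for the distance of the two points. Replacing d by a + \<rho> costs a power of (x + \<rho>) /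
  \<rho>; a negative exponent also leaves the singular factor, which is the only part unbounded as d
  tends to 0.\<close>

lemma powr_ratio_bound:
  fixes a d x \<rho> \<alpha> \<beta> :: real
  assumes \<rho>: "0 < \<rho>" and d: "0 < d" and x: "0 \<le> x" and a: "0 \<le> a"
    and tri: "d \<le> x + a" "a \<le> x + d" and \<beta>: "0 \<le> \<beta>" "- \<alpha> \<le> \<beta>"
  shows "d powr \<alpha> \<le> (a + \<rho>) powr \<alpha> * ((x + \<rho>) / \<rho>) powr \<bar>\<alpha>\<bar> * (1 + \<rho> / d) powr \<beta>"
proof -
  define Y where "Y = (x + \<rho>) / \<rho>"
  have Y: "1 \<le> Y" "Y * \<rho> = x + \<rho>" using \<rho> x by (auto simp: Y_def)
  have S: "1 \<le> 1 + \<rho> / d" using \<rho> d by simp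
  have "0 \<le> a * (Y - 1)" "0 \<le> d * (Y - 1)" using a d Y by auto
  then have m: "d \<le> (a + \<rho>) * Y" "a + \<rho> \<le> Y * (d + \<rho>)"
    using tri Y(2) \<rho> by (auto simp: algebra_simps)
  show ?thesis
  proof (cases "0 \<le> \<alpha>")
    case True
    have "d powr \<alpha> \<le> ((a + \<rho>) * Y) powr \<alpha>" using m d True by (intro powr_mono2) auto
    also have "\<dots> = (a + \<rho>) powr \<alpha> * Y powr \<bar>\<alpha>\<bar> * 1" using a \<rho> Y True by (simp add: powr_mult)
    also have "\<dots> \<le> (a + \<rho>) powr \<alpha> * Y powr \<bar>\<alpha>\<bar> * (1 + \<rho> / d) powr \<beta>"
      using S \<beta> by (intro mult_left_mono ge_one_powr_ge_zero) auto
    finally show ?thesis by (simp add: Y_def)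
  next
    case False
    define b where "b = - \<alpha>"
    have b: "0 \<le> b" "b \<le> \<beta>" "\<alpha> = - b" "\<bar>\<alpha>\<bar> = b" using False \<beta> by (auto simp: b_def)
    have ap: "0 < a + \<rho>" using a \<rho> by simp
    have "d + \<rho> = (1 + \<rho> / d) * d" using d by (simp add: distrib_right)
    then have "Y * (d + \<rho>) = Y * (1 + \<rho> / d) * d" by (metis mult.assoc)
    then have "(a + \<rho>) / d \<le> Y * (1 + \<rho> / d)" using m(2) d by (simp only: pos_divide_le_eq)
    then have "((a + \<rho>) / d) powr b \<le> (Y * (1 + \<rho> / d)) powr b" using ap d b by (intro powr_mono2) auto
    also have "\<dots> = Y powr b * (1 + \<rho> / d) powr b" using Y S by (simp add: powr_mult)
    also have "\<dots> \<le> Y powr b * (1 + \<rho> / d) powr \<beta>" using S b by (intro mult_left_mono powr_mono) auto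
    finally have "(a + \<rho>) powr \<alpha> * ((a + \<rho>) / d) powr b \<le> (a + \<rho>) powr \<alpha> * (Y powr b * (1 + \<rho> / d) powr \<beta>)"
      by (intro mult_left_mono) auto
    moreover have "(a + \<rho>) powr \<alpha> * ((a + \<rho>) / d) powr b = d powr \<alpha>"
      using ap d b by (simp add: powr_divide powr_minus divide_simps)
    ultimately show ?thesis using b(4) by (simp add: Y_def mult.assoc)
  qed
qed

text \<open>The \<open>zs j\<close> are \<sigma>-separated, so a point is within \<sigma> / 2 of at
  most one of them and all other factors are at most E. This bounds the product by a sum, and only
  single exponents \<beta> < 2 have to be integrated.\<close>

lemma prod_singular_factors_bound:
  fixes zs :: "nat \<Rightarrow> complex"
  assumes inj: "inj_on zs {1..m}" and B: "0 < B" and \<beta>: "0 \<le> \<beta>" "\<beta> < 2"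
  obtains C where "0 < C" "\<And>x \<rho>. 0 < \<rho> \<Longrightarrow> \<rho> \<le> B \<Longrightarrow> (\<And>j. j \<in> {1..m} \<Longrightarrow> x \<noteq> zs j) \<Longrightarrow>
     (\<Prod>j=1..m. (1 + \<rho> / dist (zs j) x) powr \<beta>)
       \<le> C * (1 + (\<Sum>j=1..m. if dist (zs j) x \<le> \<rho> then (\<rho> / dist (zs j) x) powr \<beta> else 0))"
proof -
  define \<sigma> where "\<sigma> = Min (insert 1 ((\<lambda>(i, j). dist (zs i) (zs j)) ` {(i, j). i \<in> {1..m} \<and> j \<in> {1..m} \<and> i \<noteq> j}))"
  have fin: "finite {(i, j). i \<in> {1..m} \<and> j \<in> {1..m} \<and> i \<noteq> j}"
    by (rule finite_subset[of _ "{1..m} \<times> {1..m}"]) auto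
  have "\<forall>y\<in>insert 1 ((\<lambda>(i, j). dist (zs i) (zs j)) ` {(i, j). i \<in> {1..m} \<and> j \<in> {1..m} \<and> i \<noteq> j}). 0 < y"
    using inj by (auto dest: inj_onD)
  then have s: "0 < \<sigma>" unfolding \<sigma>_def using fin by (subst Min_gr_iff) auto
  have sep: "\<sigma> \<le> dist (zs i) (zs j)" if "i \<in> {1..m}" "j \<in> {1..m}" "i \<noteq> j" for i j
    unfolding \<sigma>_def using fin that by (intro Min_le) auto
  define E where "E = (1 + 2 * B / \<sigma>) powr \<beta>"
  have E1: "1 \<le> E" unfolding E_def using B s \<beta> by (intro ge_one_powr_ge_zero) auto
  have "(\<Prod>j=1..m. (1 + \<rho> / dist (zs j) x) powr \<beta>)
       \<le> (4 * E ^ m) * (1 + (\<Sum>j=1..m. if dist (zs j) x \<le> \<rho> then (\<rho> / dist (zs j) x) powr \<beta> else 0))"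
    if \<rho>: "0 < \<rho>" "\<rho> \<le> B" and x: "\<And>j. j \<in> {1..m} \<Longrightarrow> x \<noteq> zs j" for x \<rho>
  proof -
    define g where "g j = (1 + \<rho> / dist (zs j) x) powr \<beta>" for j
    define t where "t j = (if dist (zs j) x \<le> \<rho> then (\<rho> / dist (zs j) x) powr \<beta> else 0)" for j
    have t0: "t j \<ge> 0" for j by (simp add: t_def)
    have g0: "g j \<ge> 0" for j by (simp add: g_def)
    have dp: "0 < dist (zs j) x" if "j \<in> {1..m}" for j using x[OF that] by simp
    have gE: "g j \<le> E" if "j \<in> {1..m}" "\<sigma> / 2 \<le> dist (zs j) x" for j
    proof -
      have "\<rho> / dist (zs j) x \<le> B / (\<sigma> / 2)" using \<rho> that s by (intro frac_le) auto
      then show ?thesis unfolding g_def E_def using \<beta> \<rho> dp[OF that(1)] by (intro powr_mono2) (auto simp: mult.commute)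
    qed
    have gt: "g j \<le> 4 * (1 + t j)" if j: "j \<in> {1..m}" for j
    proof -
      have four: "2 powr \<beta> \<le> 4" using powr_mono[of \<beta> 2 2] \<beta> by simp
      show ?thesis
      proof (cases "dist (zs j) x \<le> \<rho>")
        case True
        then have "1 \<le> \<rho> / dist (zs j) x" using dp[OF j] by simp
        then have "g j \<le> (2 * (\<rho> / dist (zs j) x)) powr \<beta>" unfolding g_def using \<beta> by (intro powr_mono2) auto
        also have "\<dots> = 2 powr \<beta> * t j" using True powr_mult[of 2 "\<rho> / dist (zs j) x" \<beta>] \<rho> by (simp add: t_def)
        also have "\<dots> \<le> 4 * t j" using four t0 by (intro mult_right_mono) auto
        finally show ?thesis by simp
      next
        case False
        then have "\<rho> / dist (zs j) x \<le> 1" using dp[OF j] by simp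
        then have "g j \<le> 2 powr \<beta>" unfolding g_def using \<beta> \<rho> by (intro powr_mono2) auto
        then show ?thesis using four t0[of j] by simp
      qed
    qed
    have St: "0 \<le> (\<Sum>j=1..m. t j)" using t0 by (intro sum_nonneg) auto
    have Em: "E ^ i \<le> E ^ m" if "i \<le> m" for i using E1 that by (intro power_increasing) auto
    have "(\<Prod>j=1..m. g j) \<le> (4 * E ^ m) * (1 + (\<Sum>j=1..m. t j))"
    proof (cases "\<exists>i\<in>{1..m}. dist (zs i) x < \<sigma> / 2")
      case False
      have "(\<Prod>j=1..m. g j) \<le> (\<Prod>j=1..m. E)" using False gE g0 by (intro prod_mono) (auto simp: not_less)
      also have "\<dots> = E ^ m" by simp
      also have "\<dots> \<le> (4 * E ^ m) * 1" using E1 by simp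
      also have "\<dots> \<le> (4 * E ^ m) * (1 + (\<Sum>j=1..m. t j))" using E1 St by (intro mult_left_mono) auto
      finally show ?thesis .
    next
      case True
      then obtain i where i: "i \<in> {1..m}" "dist (zs i) x < \<sigma> / 2" by blast
      have far: "\<sigma> / 2 \<le> dist (zs j) x" if "j \<in> {1..m} - {i}" for j
        using sep[of i j] that i dist_triangle2[of "zs i" "zs j" x] by auto
      have "(\<Prod>j=1..m. g j) = g i * (\<Prod>j\<in>{1..m} - {i}. g j)" using i by (simp add: prod.remove)
      also have "\<dots> \<le> (4 * (1 + t i)) * (\<Prod>j\<in>{1..m} - {i}. E)"
        using gt[OF i(1)] far gE g0 t0 by (intro mult_mono prod_mono prod_nonneg) auto
      also have "(\<Prod>j\<in>{1..m} - {i}. E) = E ^ (m - 1)" using i by simp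
      also have "(4 * (1 + t i)) * E ^ (m - 1) \<le> (4 * (1 + (\<Sum>j=1..m. t j))) * E ^ m"
        using Em[of "m - 1"] member_le_sum[of i "{1..m}" t] i t0 E1 St by (intro mult_mono) auto
      finally show ?thesis by (simp add: mult_ac)
    qed
    then show ?thesis by (simp add: g_def t_def)
  qed
  note main = this
  have "0 < 4 * E ^ m" using E1 by simp
  then show thesis by (rule that[OF _ main])
qed

text \<open>The weight is moved from the integration point to \<open>z\<close> factor by factor: the
  polynomial loss is absorbed by the kernel, the singular factors are replaced by a sum. The
  exponent \<beta> < 2 dominates all - \<alpha> j at once.\<close>

lemma singular_weight_integral:
  fixes zs :: "nat \<Rightarrow> complex" and \<alpha> :: "nat \<Rightarrow> real"
  assumes inj: "inj_on zs {1..m}" and \<alpha>: "\<forall>j\<in>{1..m}. \<alpha> j > -2" and B: "0 < B"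
  obtains C and k :: nat where "0 < C"
    "\<And>z \<rho>. 0 < \<rho> \<Longrightarrow> \<rho> \<le> B \<Longrightarrow>
      (\<integral>\<^sup>+x. ennreal ((\<rho> / (dist z x + \<rho>)) ^ k * (\<Prod>j=1..m. norm (x - zs j) powr \<alpha> j)) \<partial>lborel)
        \<le> ennreal (C * \<rho>\<^sup>2 * (\<Prod>j=1..m. (norm (z - zs j) + \<rho>) powr \<alpha> j))"
proof -
  define \<beta> where "\<beta> = Max (insert 0 ((\<lambda>j. - \<alpha> j) ` {1..m}))"
  have \<beta>: "0 \<le> \<beta>" "\<beta> < 2" "\<And>j. j \<in> {1..m} \<Longrightarrow> - \<alpha> j \<le> \<beta>"
  proof -
    show "0 \<le> \<beta>" unfolding \<beta>_def by (rule Max_ge) auto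
    show "\<beta> < 2" unfolding \<beta>_def using \<alpha> by (subst Max_less_iff) force+
    show "- \<alpha> j \<le> \<beta>" if "j \<in> {1..m}" for j unfolding \<beta>_def using that by (intro Max_ge) auto
  qed
  obtain C1 where C1: "0 < C1" "\<And>x \<rho>. 0 < \<rho> \<Longrightarrow> \<rho> \<le> B \<Longrightarrow> (\<And>j. j \<in> {1..m} \<Longrightarrow> x \<noteq> zs j) \<Longrightarrow>
     (\<Prod>j=1..m. (1 + \<rho> / dist (zs j) x) powr \<beta>)
       \<le> C1 * (1 + (\<Sum>j=1..m. if dist (zs j) x \<le> \<rho> then (\<rho> / dist (zs j) x) powr \<beta> else 0))"
    by (fact prod_singular_factors_bound[OF inj B \<beta>(1,2)])
  obtain c where c: "0 \<le> c" "\<And>y \<rho>. 0 < \<rho> \<Longrightarrow>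
    (\<integral>\<^sup>+(x::complex). ennreal (if dist y x \<le> \<rho> then (\<rho> / dist y x) powr \<beta> else 0) \<partial>lborel) \<le> ennreal (c * \<rho>\<^sup>2)"
    by (fact nn_integral_power_singularity[OF \<beta>(1,2)])
  define A where "A = (\<Sum>j=1..m. \<bar>\<alpha> j\<bar>)"
  obtain k0 :: nat where k0: "A \<le> real k0" using real_arch_simple by blast
  define C where "C = C1 * (64 / 3 * pi + real m * c)"
  \<comment> \<open>The k0 powers of the kernel cancel the loss of order \<open>A\<close>, the sum
    of the |\<alpha> j|; the other 4 make the decay integrable over the plane.\<close>
  have "(\<integral>\<^sup>+x. ennreal ((\<rho> / (dist z x + \<rho>)) ^ (k0 + 4) * (\<Prod>j=1..m. norm (x - zs j) powr \<alpha> j)) \<partial>lborel)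
        \<le> ennreal (C * \<rho>\<^sup>2 * (\<Prod>j=1..m. (norm (z - zs j) + \<rho>) powr \<alpha> j))"
    if \<rho>: "0 < \<rho>" "\<rho> \<le> B" for z \<rho>
  proof -
    define D where "D = (\<Prod>j=1..m. (norm (z - zs j) + \<rho>) powr \<alpha> j)"
    have D0: "0 \<le> D" unfolding D_def by (intro prod_nonneg) auto
    define t where "t j x = (if dist (zs j) x \<le> \<rho> then (\<rho> / dist (zs j) x) powr \<beta> else 0)" for j x
    have t0: "t j x \<ge> 0" for j x by (simp add: t_def)
    have [measurable]: "(\<lambda>x. t j x) \<in> borel_measurable borel" for j unfolding t_def by measurable
    have pt: "(\<rho> / (dist z x + \<rho>)) ^ (k0 + 4) * (\<Prod>j=1..m. norm (x - zs j) powr \<alpha> j)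
        \<le> D * C1 * ((\<rho> / (dist z x + \<rho>)) ^ 4 + (\<Sum>j=1..m. t j x))" for x
    proof (cases "\<exists>j\<in>{1..m}. x = zs j")
      case True
      then have P0: "(\<Prod>j=1..m. norm (x - zs j) powr \<alpha> j) = 0" by (auto intro!: prod_zero)
      have "0 \<le> D * C1 * ((\<rho> / (dist z x + \<rho>)) ^ 4 + (\<Sum>j=1..m. t j x))"
        using D0 C1 \<rho> t0 by (intro mult_nonneg_nonneg add_nonneg_nonneg sum_nonneg) auto
      then show ?thesis unfolding P0 mult_zero_right by simp
    next
      case False
      define Y where "Y = (dist z x + \<rho>) / \<rho>"
      have Y: "1 \<le> Y" "\<rho> / (dist z x + \<rho>) = 1 / Y" using \<rho> by (auto simp: Y_def)
      have dp: "0 < dist (zs j) x" if "j \<in> {1..m}" for j using False that by auto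
      have "(\<Prod>j=1..m. norm (x - zs j) powr \<alpha> j)
          \<le> (\<Prod>j=1..m. (norm (z - zs j) + \<rho>) powr \<alpha> j * Y powr \<bar>\<alpha> j\<bar> * (1 + \<rho> / dist (zs j) x) powr \<beta>)"
      proof (rule prod_mono, intro conjI)
        fix j assume j: "j \<in> {1..m}"
        show "0 \<le> norm (x - zs j) powr \<alpha> j" by simp
        have "norm (x - zs j) = dist (zs j) x" by (simp add: dist_norm norm_minus_commute)
        moreover have "dist (zs j) x powr \<alpha> j \<le> (dist z (zs j) + \<rho>) powr \<alpha> j * Y powr \<bar>\<alpha> j\<bar> * (1 + \<rho> / dist (zs j) x) powr \<beta>"
          unfolding Y_def using dp[OF j] \<beta>(1) \<beta>(3)[OF j] \<rho> dist_triangle[of "zs j" x z] dist_triangle[of z "zs j" x]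
          by (intro powr_ratio_bound) (auto simp: dist_commute)
        ultimately show "norm (x - zs j) powr \<alpha> j \<le> (norm (z - zs j) + \<rho>) powr \<alpha> j * Y powr \<bar>\<alpha> j\<bar> * (1 + \<rho> / dist (zs j) x) powr \<beta>"
          by (simp add: dist_norm)
      qed
      also have "\<dots> = D * (\<Prod>j=1..m. Y powr \<bar>\<alpha> j\<bar>) * (\<Prod>j=1..m. (1 + \<rho> / dist (zs j) x) powr \<beta>)"
        by (simp add: D_def prod.distrib)
      also have "(\<Prod>j=1..m. Y powr \<bar>\<alpha> j\<bar>) = Y powr A" using Y(1) by (simp add: A_def powr_sum)
      also have "D * Y powr A * (\<Prod>j=1..m. (1 + \<rho> / dist (zs j) x) powr \<beta>) \<le> D * Y ^ k0 * (C1 * (1 + (\<Sum>j=1..m. t j x)))"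
      proof (intro mult_mono)
        have "Y powr A \<le> Y powr real k0" using Y k0 by (intro powr_mono) auto
        also have "\<dots> = Y ^ k0" using Y by (intro powr_realpow) auto
        finally show "Y powr A \<le> Y ^ k0" .
        show "(\<Prod>j=1..m. (1 + \<rho> / dist (zs j) x) powr \<beta>) \<le> C1 * (1 + (\<Sum>j=1..m. t j x))"
          unfolding t_def using False by (intro C1(2) \<rho>) auto
      qed (use D0 Y in \<open>auto intro!: prod_nonneg\<close>)
      finally have "(1 / Y) ^ (k0 + 4) * (\<Prod>j=1..m. norm (x - zs j) powr \<alpha> j)
          \<le> (1 / Y) ^ (k0 + 4) * (D * Y ^ k0 * (C1 * (1 + (\<Sum>j=1..m. t j x))))"
        using Y by (intro mult_left_mono) auto
      also have "\<dots> = D * C1 * ((1 / Y) ^ 4 * (1 + (\<Sum>j=1..m. t j x)))"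
        using Y by (simp add: power_add power_divide)
      also have "\<dots> \<le> D * C1 * ((1 / Y) ^ 4 + (\<Sum>j=1..m. t j x))"
      proof (intro mult_left_mono)
        have "(1 / Y) ^ 4 * (\<Sum>j=1..m. t j x) \<le> 1 * (\<Sum>j=1..m. t j x)"
          using Y t0 by (intro mult_right_mono power_le_one sum_nonneg) auto
        then show "(1 / Y) ^ 4 * (1 + (\<Sum>j=1..m. t j x)) \<le> (1 / Y) ^ 4 + (\<Sum>j=1..m. t j x)"
          by (simp only: distrib_left mult_1_right)
      qed (use D0 C1 in auto)
      finally show ?thesis by (simp only: Y(2))
    qed
    have "(\<integral>\<^sup>+x. ennreal ((\<rho> / (dist z x + \<rho>)) ^ (k0 + 4) * (\<Prod>j=1..m. norm (x - zs j) powr \<alpha> j)) \<partial>lborel)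
       \<le> (\<integral>\<^sup>+x. ennreal (D * C1) * (ennreal ((\<rho> / (dist z x + \<rho>)) ^ 4) + (\<Sum>j=1..m. ennreal (t j x))) \<partial>lborel)"
    proof (rule nn_integral_mono)
      fix x
      have "ennreal (D * C1 * ((\<rho> / (dist z x + \<rho>)) ^ 4 + (\<Sum>j=1..m. t j x)))
          = ennreal (D * C1) * (ennreal ((\<rho> / (dist z x + \<rho>)) ^ 4) + (\<Sum>j=1..m. ennreal (t j x)))"
        using D0 C1 t0 \<rho> by (simp add: ennreal_mult' ennreal_plus sum_nonneg sum_ennreal)
      then show "ennreal ((\<rho> / (dist z x + \<rho>)) ^ (k0 + 4) * (\<Prod>j=1..m. norm (x - zs j) powr \<alpha> j))
          \<le> ennreal (D * C1) * (ennreal ((\<rho> / (dist z x + \<rho>)) ^ 4) + (\<Sum>j=1..m. ennreal (t j x)))"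
        using ennreal_leI[OF pt[of x]] by simp
    qed
    also have "\<dots> = ennreal (D * C1) * ((\<integral>\<^sup>+x. ennreal ((\<rho> / (dist z x + \<rho>)) ^ 4) \<partial>lborel) + (\<Sum>j=1..m. \<integral>\<^sup>+x. ennreal (t j x) \<partial>lborel))"
    proof -
      have m1: "(\<lambda>x. ennreal (t j x)) \<in> borel_measurable lborel" for j by measurable
      have m2: "(\<lambda>x. ennreal ((\<rho> / (dist z x + \<rho>)) ^ 4)) \<in> borel_measurable lborel" by measurable
      have m3: "(\<lambda>x. \<Sum>j=1..m. ennreal (t j x)) \<in> borel_measurable lborel" using m1 by (rule borel_measurable_sum)
      show ?thesis
        by (simp only: nn_integral_cmult[OF borel_measurable_add[OF m2 m3]] nn_integral_add[OF m2 m3] nn_integral_sum[OF m1])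
    qed
    also have "\<dots> \<le> ennreal (D * C1) * (ennreal (64 / 3 * pi * \<rho>\<^sup>2) + (\<Sum>j=1..m. ennreal (c * \<rho>\<^sup>2)))"
      unfolding t_def by (intro mult_left_mono add_mono sum_mono nn_integral_quartic_decay c \<rho>) auto
    also have "\<dots> = ennreal (D * C1) * ennreal (64 / 3 * pi * \<rho>\<^sup>2 + real m * (c * \<rho>\<^sup>2))"
      using c(1) by (simp add: ennreal_plus ennreal_mult' ennreal_of_nat_eq_real_of_nat)
    also have "\<dots> = ennreal (C * \<rho>\<^sup>2 * D)"
      using D0 C1 c(1) by (simp add: C_def algebra_simps flip: ennreal_mult')
    finally show ?thesis by (simp add: D_def)
  qed
  note main = this
  have "0 < 64 / 3 * pi + real m * c" using c(1) by (intro add_pos_nonneg) auto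
  then have "0 < C" using C1(1) by (simp add: C_def)
  then show thesis by (rule that[OF _ main])
qed

section \<open>Bounds for the Christoffel function\<close>

context quasidisk_chart begin

lemma rn_lipschitz: "rn n z \<le> rn n z' + dist z z'"
  unfolding rn_def rho_def by (rule infdist_triangle)

lemma poly_bound_inside:
  assumes "\<And>w. w \<in> L \<Longrightarrow> cmod (poly R w) \<le> M" "x \<in> closure G"
  shows "cmod (poly R x) \<le> M"
proof (cases "x \<in> L")
  case False
  then have x: "x \<in> G" using assms(2) closure_G by auto
  show ?thesis
    by (rule maximum_modulus_frontier[where S=G and f="poly R"])
       (use assms(1) x bounded_G in \<open>auto intro!: holomorphic_intros continuous_intros\<close>)
qed (use assms(1) in blast)

text \<open>The function R(V s) s^N extends over s = 0 because the pole of \<open>V\<close> there is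
  simple; \<open>H\<close> is this extension, written in terms of \<phi> and \<open>phi1\<close>.
  The maximum principle is applied on circles approaching the unit circle, on which |R| is close to
  at most M.\<close>

lemma bernstein_walsh:
  assumes deg: "degree R \<le> N" and M: "\<And>w. w \<in> L \<Longrightarrow> cmod (poly R w) \<le> M" and x: "x \<in> Ext"
  shows "cmod (poly R x) * cmod (u x) ^ N \<le> M"
proof -
  define R0 where "R0 = pcompose R [:w0, 1:]"
  have R0: "poly R (w0 + y) = (\<Sum>k\<le>N. coeff R0 k * y ^ k)" for y
  proof -
    have d: "degree R0 \<le> N" using deg degree_pcompose_le[of R "[:w0, 1:]"] by (simp add: R0_def)
    have "poly R (w0 + y) = poly R0 y" by (simp add: R0_def poly_pcompose)
    also have "\<dots> = (\<Sum>k\<le>N. coeff R0 k * y ^ k)" unfolding poly_altdef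
      by (rule sum.mono_neutral_left) (use d in \<open>auto intro: le_degree\<close>)
    finally show ?thesis .
  qed
  define H where "H s = (\<Sum>k\<le>N. coeff R0 k * \<phi> s ^ (N - k)) / phi1 s ^ N" for s
  have p1: "phi1 s \<noteq> 0" if "cmod s < 1" for s using phi_nz[OF that] dphi_0 by (auto simp: phi1_def)
  have Hhol: "H holomorphic_on ball 0 1" unfolding H_def
    using p1 by (intro holomorphic_intros phi_hol phi1_hol) auto
  have HV: "H s = poly R (V s) * s ^ N" if s: "cmod s < 1" "s \<noteq> 0" for s
  proof -
    have p: "\<phi> s \<noteq> 0" using phi_nz s by blast
    have "(\<Sum>k\<le>N. coeff R0 k * \<phi> s ^ (N - k)) = \<phi> s ^ N * (\<Sum>k\<le>N. coeff R0 k * (1 / \<phi> s) ^ k)"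
      unfolding sum_distrib_left
    proof (rule sum.cong)
      fix k assume "k \<in> {..N}"
      then show "coeff R0 k * \<phi> s ^ (N - k) = \<phi> s ^ N * (coeff R0 k * (1 / \<phi> s) ^ k)"
        using p by (simp add: power_diff power_divide)
    qed simp
    then show ?thesis using p s by (simp add: H_def V_def R0 phi1_def power_divide)
  qed
  obtain B where B: "\<And>s. 1/2 \<le> cmod s \<Longrightarrow> cmod s < 1 \<Longrightarrow> cmod (V s - w0) \<le> B"
    using V_bounded[of "1/2"] by auto
  define s where "s = u x"
  have s: "cmod s < 1" "s \<noteq> 0" "V s = x" using u_bounds[OF x] V_u[OF x] by (auto simp: s_def)
  have "cmod (H s) \<le> M + e" if e: "e > 0" for e
  proof -
    \<comment> \<open>The bad points, where |R| is at least M + e outside G, form a compact subset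
      of \<open>Ext\<close>, so \<open>eta\<close> has a positive lower bound d on them. A circle
      with 1 - r < d is mapped by \<open>V\<close> past all of them.\<close>
    define T where "T = {y. M + e \<le> cmod (poly R y)} \<inter> (- G) \<inter> cball w0 B"
    have "closed {y. M + e \<le> cmod (poly R y)}" by (intro closed_Collect_le continuous_intros)
    then have cT: "compact T" unfolding T_def
      using open_G by (intro closed_Int_compact closed_Int) (auto simp: closed_Compl)
    have TE: "y \<in> Ext" if "y \<in> T" for y
    proof -
      have "y \<notin> L" using that e M[of y] by (auto simp: T_def)
      then show ?thesis using that notin_closure_G by (auto simp: T_def)
    qed
    obtain d where d: "d > 0" "\<And>y. y \<in> T \<Longrightarrow> d \<le> eta y"
    proof (cases "T = {}")
      case False
      obtain m where m: "m \<in> T" "\<And>y. y \<in> T \<Longrightarrow> eta m \<le> eta y"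
        using continuous_attains_inf[OF cT False, of eta] continuous_on_subset[OF eta_continuous] by blast
      show thesis by (rule that[OF eta_pos[OF TE[OF m(1)]] m(2)])
    qed (use that[of 1] in auto)
    define r where "r = Max {cmod s, 1/2, 1 - d/2}"
    have r: "cmod s \<le> r" "1/2 \<le> r" "r < 1" "1 - r < d" 
    proof -
      show "cmod s \<le> r" "1/2 \<le> r" unfolding r_def by (rule Max_ge; simp)+
      have dr: "1 - d/2 \<le> r" unfolding r_def by (rule Max_ge; simp)
      show "r < 1" using s d by (simp add: r_def)
      show "1 - r < d" using dr d by linarith
    qed
    show ?thesis
    proof (rule maximum_modulus_frontier[where S="cball 0 r" and f=H])
      show "H holomorphic_on interior (cball 0 r)" by (rule holomorphic_on_subset[OF Hhol]) (use r in auto)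
      show "continuous_on (closure (cball 0 r)) H"
        by (rule holomorphic_on_imp_continuous_on[OF holomorphic_on_subset[OF Hhol]]) (use r in auto)
      show "s \<in> cball 0 r" using r by simp
      fix t :: complex assume "t \<in> frontier (cball 0 r)"
      then have t: "cmod t = r" using r by (simp add: frontier_cball)
      have t': "cmod t < 1" "t \<noteq> 0" "1/2 \<le> cmod t" using t r by auto
      have VE: "V t \<in> Ext" using V_Ext t' by blast
      have "V t \<notin> T" using d(2)[of "V t"] eta_V[OF t'(1,2)] t r by auto
      then have "cmod (poly R (V t)) \<le> M + e"
        using VE B[OF t'(3,1)] notin_closure_G by (auto simp: T_def dist_norm norm_minus_commute)
      moreover have "cmod (H t) \<le> cmod (poly R (V t)) * 1"
        unfolding HV[OF t'(1,2)] norm_mult norm_power using t r by (intro mult_left_mono power_le_one) auto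
      ultimately show "cmod (H t) \<le> M + e" by simp
    qed simp
  qed
  then have "cmod (H s) \<le> M" by (rule field_le_epsilon)
  then show ?thesis using HV[OF s(1,2)] s(3) by (simp add: s_def norm_mult norm_power)
qed

text \<open>Within distance \<open>rn n \<zeta>\<close> of \<zeta> one has |u| >= n / (n + 1), and
  (1 + 1/n)^(K n) is at most \<open>exp K\<close>; so the Bernstein-Walsh factor is bounded
  independently of n.\<close>

lemma poly_bound_collar:
  assumes deg: "degree R \<le> K * n" and n: "n \<ge> 1" and M: "\<And>w. w \<in> L \<Longrightarrow> cmod (poly R w) \<le> M"
    and \<zeta>: "\<zeta> \<in> L" and x: "dist \<zeta> x < rn n \<zeta>"
  shows "cmod (poly R x) \<le> exp (real K) * M"
proof -
  have M0: "0 \<le> M" using M[OF \<zeta>] norm_ge_zero order.trans by blast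
  show ?thesis
  proof (cases "x \<in> Ext")
    case False
    then have "cmod (poly R x) \<le> M" using poly_bound_inside[of R M x] M by auto
    also have "\<dots> \<le> exp (real K) * M" using M0 by (simp add: mult_le_cancel_right1)
    finally show ?thesis .
  next
    case True
    have ux: "real n / (real n + 1) \<le> cmod (u x)"
      using eta_inside[OF n \<zeta> x] True by (simp add: eta_def field_simps)
    have "exp (- real K) \<le> (real n / (real n + 1)) ^ (K * n)"
    proof -
      have "1 + 1 / real n \<le> exp (1 / real n)" by (rule exp_ge_add_one_self)
      then have "(1 + 1 / real n) ^ (K * n) \<le> exp (1 / real n) ^ (K * n)" by (intro power_mono) auto
      also have "\<dots> = exp (real K)" using n by (simp flip: exp_of_nat_mult)
      finally have "1 / exp (real K) \<le> 1 / (1 + 1 / real n) ^ (K * n)"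
        using n by (intro divide_left_mono) (auto intro!: mult_pos_pos zero_less_power add_pos_nonneg)
      moreover have "1 / (1 + 1 / real n) = real n / (real n + 1)" using n by (simp add: field_simps)
      ultimately show ?thesis by (metis exp_minus inverse_eq_divide power_one_over)
    qed
    also have "\<dots> \<le> cmod (u x) ^ (K * n)" using ux by (intro power_mono) auto
    finally have "cmod (poly R x) * exp (- real K) \<le> cmod (poly R x) * cmod (u x) ^ (K * n)"
      by (intro mult_left_mono) auto
    also have "\<dots> \<le> M" by (rule bernstein_walsh[OF deg M True])
    finally show ?thesis by (simp add: exp_minus field_simps)
  qed
qed

text \<open>At a point \<open>\<zeta>\<close> where \<open>|R|\<close> attains its maximum over \<open>L\<close>, Cauchy's estimate keeps \<open>|R|\<close> large
  on a disc around \<open>\<zeta>\<close> of radius comparable to \<open>rn n \<zeta>\<close>; the corkscrew condition puts a comparable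
  disc inside \<open>G\<close>.\<close>
lemma large_on_interior_disc:
  obtains \<tau> where "0 < \<tau>"
    "\<And>R n z. n \<ge> 1 \<Longrightarrow> degree R \<le> K * n \<Longrightarrow> z \<in> L \<Longrightarrow> \<exists>\<zeta>\<in>L. \<exists>y. ball y (\<tau> * rn n \<zeta>) \<subseteq> G \<and>
      (\<forall>x\<in>ball y (\<tau> * rn n \<zeta>). dist \<zeta> x \<le> rn n \<zeta> / 8 \<and> \<tau> * rn n \<zeta> \<le> infdist x L \<and> cmod (poly R z) / 2 \<le> cmod (poly R x))"
proof -
  obtain r0 where r0: "r0 > 0" "\<And>z r. z \<in> L \<Longrightarrow> 0 < r \<Longrightarrow> r \<le> r0 \<Longrightarrow> \<exists>m\<in>G. dist z m \<le> r \<and> ck * r \<le> infdist m L"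
    by (fact corkscrew_G)
  obtain B where B: "B > 0" "\<And>n z. n \<ge> 1 \<Longrightarrow> z \<in> L \<Longrightarrow> rn n z \<le> B" by (fact rn_bounded)
  define E where "E = exp (real K)"
  have E: "1 \<le> E" by (simp add: E_def)
  \<comment> \<open>Cauchy's estimate on discs of radius \<rho> / 4 bounds the derivative by 4 E M /
    \<rho>. Over a distance \<theta> \<rho> the polynomial thus changes by at most 4 E \<theta> M =
    M / 2.\<close>
  define \<theta> where "\<theta> = 1 / (8 * E)"
  have th: "0 < \<theta>" "\<theta> \<le> 1/8" "4 * E * \<theta> = 1/2" using E by (auto simp: \<theta>_def field_simps)
  \<comment> \<open>The bound r0 / B keeps \<kappa> \<rho> in the range of the corkscrew condition,
    and \<theta> / 2 leaves room for a disc of radius \<tau> \<rho> <= \<kappa> \<rho> / 2 about the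
    corkscrew point.\<close>
  define \<kappa> where "\<kappa> = min (\<theta> / 2) (r0 / B)"
  have k: "0 < \<kappa>" "\<kappa> \<le> \<theta> / 2" "\<kappa> \<le> r0 / B" 
  proof -
    show "0 < \<kappa>" using th r0 B by (simp add: \<kappa>_def)
    show "\<kappa> \<le> \<theta> / 2" "\<kappa> \<le> r0 / B" unfolding \<kappa>_def by (rule min.cobounded1, rule min.cobounded2)
  qed
  define \<tau> where "\<tau> = ck * \<kappa> / 2"
  have t: "0 < \<tau>" "2 * \<tau> = ck * \<kappa>" "\<tau> \<le> \<kappa> / 2" using ck k by (auto simp: \<tau>_def mult_left_le_one_le)
  have "\<exists>\<zeta>\<in>L. \<exists>y. ball y (\<tau> * rn n \<zeta>) \<subseteq> G \<and>
      (\<forall>x\<in>ball y (\<tau> * rn n \<zeta>). dist \<zeta> x \<le> rn n \<zeta> / 8 \<and> \<tau> * rn n \<zeta> \<le> infdist x L \<and> cmod (poly R z) / 2 \<le> cmod (poly R x))"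
    if n: "n \<ge> 1" and deg: "degree R \<le> K * n" and z: "z \<in> L" for R n z
  proof -
    have "continuous_on L (\<lambda>w. cmod (poly R w))" by (intro continuous_intros)
    then obtain \<zeta> where \<zeta>: "\<zeta> \<in> L" "\<And>w. w \<in> L \<Longrightarrow> cmod (poly R w) \<le> cmod (poly R \<zeta>)"
      using continuous_attains_sup[OF compact_L L_ne] by blast
    define M where "M = cmod (poly R \<zeta>)"
    define \<rho> where "\<rho> = rn n \<zeta>"
    have rp: "0 < \<rho>" "\<rho> \<le> B" using rn_pos[OF n \<zeta>(1)] B(2)[OF n \<zeta>(1)] by (auto simp: \<rho>_def)
    have up: "cmod (poly R x) \<le> E * M" if "dist \<zeta> x < \<rho>" for x
      unfolding E_def M_def using poly_bound_collar[OF deg n \<zeta>(2) \<zeta>(1)] that by (simp add: \<rho>_def)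
    have der: "cmod (poly (pderiv R) x) \<le> 4 * E * M / \<rho>" if x: "dist \<zeta> x < \<rho> / 2" for x
    proof -
      have "cmod ((deriv ^^ 1) (poly R) x) \<le> fact 1 * (E * M) / (\<rho> / 4) ^ 1"
      proof (rule Cauchy_inequality)
        fix y assume "cmod (x - y) = \<rho> / 4"
        then show "cmod (poly R y) \<le> E * M" using x rp dist_triangle[of \<zeta> y x] by (intro up) (simp add: dist_norm)
      qed (use rp in \<open>auto intro!: holomorphic_intros continuous_intros\<close>)
      moreover have "deriv (poly R) x = poly (pderiv R) x" by (rule DERIV_imp_deriv[OF poly_DERIV])
      ultimately show ?thesis using rp by (simp add: mult_ac)
    qed
    have low: "M / 2 \<le> cmod (poly R x)" if x: "dist \<zeta> x \<le> \<theta> * \<rho>" for x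
    proof -
      have xs: "dist \<zeta> x < \<rho> / 2"
      proof -
        have "\<theta> * \<rho> \<le> 1/8 * \<rho>" using th rp by (intro mult_right_mono) auto
        then show ?thesis using x rp by linarith
      qed
      have "cmod (poly R x - poly R \<zeta>) \<le> 4 * E * M / \<rho> * cmod (x - \<zeta>)"
      proof (rule field_differentiable_bound[where S="ball \<zeta> (\<rho> / 2)" and f'="poly (pderiv R)"])
        show "(poly R has_field_derivative poly (pderiv R) y) (at y within ball \<zeta> (\<rho> / 2))" for y
          using poly_DERIV[of R y] by (rule has_field_derivative_at_within)
      qed (use der xs rp in auto)
      also have "\<dots> \<le> 4 * E * M / \<rho> * (\<theta> * \<rho>)"
        using x rp E by (intro mult_left_mono) (auto simp: dist_norm norm_minus_commute M_def)
      also have "\<dots> = (4 * E * \<theta>) * M" using rp by simp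
      also have "\<dots> = M / 2" using th by simp
      finally have "cmod (poly R x - poly R \<zeta>) \<le> M / 2" .
      then show ?thesis using norm_triangle_ineq3[of "poly R \<zeta>" "poly R x"] by (simp add: M_def norm_minus_commute)
    qed
    have "\<kappa> * \<rho> \<le> r0 / B * B" using k rp r0 B by (intro mult_mono) auto
    then have "0 < \<kappa> * \<rho>" "\<kappa> * \<rho> \<le> r0" using k rp B by auto
    then obtain y where y: "y \<in> G" "dist \<zeta> y \<le> \<kappa> * \<rho>" "ck * (\<kappa> * \<rho>) \<le> infdist y L"
      using r0(2)[OF \<zeta>(1)] by blast
    have y2: "2 * (\<tau> * \<rho>) \<le> infdist y L" using y(3) t(2) by (metis mult.assoc)
    have tr: "0 < \<tau> * \<rho>" using t rp by simp
    have inf: "\<tau> * \<rho> \<le> infdist x L" if "x \<in> ball y (\<tau> * \<rho>)" for x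
      using infdist_triangle[of y L x] y2 that by simp
    have sub: "ball y (\<tau> * \<rho>) \<subseteq> G"
    proof (rule ccontr)
      assume "\<not> ball y (\<tau> * \<rho>) \<subseteq> G"
      moreover have "y \<in> ball y (\<tau> * \<rho>) \<inter> G" using y tr by simp
      ultimately have "ball y (\<tau> * \<rho>) \<inter> L \<noteq> {}" by (intro connected_Int_frontier connected_ball) blast+
      then obtain x where "x \<in> ball y (\<tau> * \<rho>)" "x \<in> L" by blast
      then show False using inf[of x] tr by simp
    qed
    have near: "dist \<zeta> x \<le> \<theta> * \<rho>" if "x \<in> ball y (\<tau> * \<rho>)" for x
    proof -
      have "dist \<zeta> x \<le> \<kappa> * \<rho> + \<tau> * \<rho>" using y(2) that dist_triangle[of \<zeta> x y] by simp
      also have "\<dots> = (\<kappa> + \<tau>) * \<rho>" by (simp add: algebra_simps)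
      also have "\<dots> \<le> \<theta> * \<rho>" using k t rp by (intro mult_right_mono) auto
      finally show ?thesis .
    qed
    have th8: "\<theta> * \<rho> \<le> \<rho> / 8" using mult_right_mono[OF th(2), of \<rho>] rp by simp
    show ?thesis
    proof (intro bexI[OF _ \<zeta>(1)] exI[of _ y] conjI ballI)
      show "ball y (\<tau> * rn n \<zeta>) \<subseteq> G" using sub by (simp add: \<rho>_def)
      fix x assume "x \<in> ball y (\<tau> * rn n \<zeta>)"
      then have x: "x \<in> ball y (\<tau> * \<rho>)" by (simp add: \<rho>_def)
      show "dist \<zeta> x \<le> rn n \<zeta> / 8" using near[OF x] th8 by (simp add: \<rho>_def)
      show "\<tau> * rn n \<zeta> \<le> infdist x L" using inf[OF x] by (simp add: \<rho>_def)
      show "cmod (poly R z) / 2 \<le> cmod (poly R x)" using low[OF near[OF x]] \<zeta>(2)[OF z] by (simp add: M_def)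
    qed
  qed
  then show thesis by (rule that[OF t(1)])
qed

end

section \<open>The generalized Jacobi measure and the two bounds\<close>

lemma powr_comparable_lower:
  fixes a b S \<alpha> :: real
  assumes "0 < a" "0 < b" "a \<le> S * b" "b \<le> S * a" "0 < S"
  shows "a powr \<alpha> \<le> S powr \<bar>\<alpha>\<bar> * b powr \<alpha>"
proof (cases "0 \<le> \<alpha>")
  case True
  have "a powr \<alpha> \<le> (S * b) powr \<alpha>" using assms True by (intro powr_mono2) auto
  then show ?thesis using assms True by (simp add: powr_mult)
next
  case False
  have "(S * a) powr \<alpha> \<le> b powr \<alpha>" using assms False by (intro powr_mono2') auto
  then have "S powr (- \<alpha>) * (S powr \<alpha> * a powr \<alpha>) \<le> S powr (- \<alpha>) * b powr \<alpha>"
    using assms by (intro mult_left_mono) (auto simp: powr_mult)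
  moreover have "S powr (- \<alpha>) * (S powr \<alpha> * a powr \<alpha>) = a powr \<alpha>" using assms by (simp add: powr_minus)
  ultimately show ?thesis using False by simp
qed

locale jacobi = quasidisk_chart G \<Phi> w0 \<phi> Cq for G \<Phi> w0 \<phi> Cq +
  fixes h0 :: "complex \<Rightarrow> real" and m :: nat and zs :: "nat \<Rightarrow> complex" and \<alpha> :: "nat \<Rightarrow> real" and Ch p :: real
  assumes zs: "\<And>j. j \<in> {1..m} \<Longrightarrow> zs j \<in> L" and inj_zs: "inj_on zs {1..m}"
    and alpha: "\<forall>j\<in>{1..m}. \<alpha> j > -2"
    and h0_meas: "h0 \<in> borel_measurable (lebesgue_on G)" and Ch: "Ch \<ge> 1"
    and h0_bounds: "\<And>z. z \<in> G \<Longrightarrow> inverse Ch \<le> h0 z \<and> h0 z \<le> Ch" and p: "p \<ge> 1"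
begin

definition W :: "complex \<Rightarrow> real" where "W = jacobi_weight G h0 m zs \<alpha>"
definition \<nu> :: "complex measure" where "\<nu> = jacobi_measure G h0 m zs \<alpha>"
definition P :: "complex \<Rightarrow> real" where "P x = (\<Prod>j=1..m. norm (x - zs j) powr \<alpha> j)"
text \<open>At \<rho> = \<open>rn n z\<close> this is the reciprocal of the product in the theorem,
  so the claim becomes two-sided comparability of \<open>lam n z\<close> with
  \<open>(rn n z)\<^sup>2 * D z (rn n z)\<close>.\<close>

definition D :: "complex \<Rightarrow> real \<Rightarrow> real" where "D z \<rho> = (\<Prod>j=1..m. (norm (z - zs j) + \<rho>) powr \<alpha> j)"

lemma P_nonneg: "0 \<le> P x" unfolding P_def by (intro prod_nonneg) auto

lemma P_measurable: "P \<in> borel_measurable borel" unfolding P_def by measurable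

lemma W_bounds:
  shows W_nonneg: "0 \<le> W x" and W_upper: "W x \<le> Ch * P x" and W_lower: "x \<in> G \<Longrightarrow> P x / Ch \<le> W x"
proof -
  have h: "0 \<le> h0 x" "h0 x \<le> Ch" "1 / Ch \<le> h0 x" if "x \<in> G"
  proof -
    show "h0 x \<le> Ch" "1 / Ch \<le> h0 x" using h0_bounds[OF that] by (auto simp: inverse_eq_divide)
    moreover have "0 < 1 / Ch" using Ch by simp
    ultimately show "0 \<le> h0 x" by linarith
  qed
  have W: "W x = (if x \<in> G then h0 x * P x else 0)" by (simp add: W_def jacobi_weight_def P_def)
  show "0 \<le> W x" using h P_nonneg by (simp add: W)
  show "W x \<le> Ch * P x" using h P_nonneg[of x] Ch by (simp add: W mult_right_mono)
  show "P x / Ch \<le> W x" if "x \<in> G" using mult_right_mono[OF h(3)[OF that] P_nonneg[of x]] that by (simp add: W)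
qed

lemma W_measurable: "W \<in> borel_measurable lebesgue"
proof -
  have "G \<in> sets lebesgue" using open_G by auto
  then have "(\<lambda>x. if x \<in> G then h0 x else 0) \<in> borel_measurable lebesgue"
    using h0_meas by (simp add: borel_measurable_if)
  moreover have "P \<in> borel_measurable lebesgue" using P_measurable by (simp add: measurable_completion)
  ultimately have "(\<lambda>x. (if x \<in> G then h0 x else 0) * P x) \<in> borel_measurable lebesgue" by (rule borel_measurable_times)
  moreover have "W = (\<lambda>x. (if x \<in> G then h0 x else 0) * P x)"
    by (rule ext) (simp add: W_def jacobi_weight_def P_def)
  ultimately show ?thesis by simp
qed

text \<open>The integrand is nonnegative, so all estimates can be made with nonnegative extended
  integrals; the passage from the completed to the Borel measure does not change these.\<close>

lemma LINT_nu:
  "(LINT w|\<nu>. norm (poly q w) powr p) = enn2real (\<integral>\<^sup>+x. ennreal (W x * cmod (poly q x) powr p) \<partial>lborel)"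
proof -
  have q: "(\<lambda>w. norm (poly q w) powr p) \<in> borel_measurable borel"
  proof -
    have "poly q \<in> borel_measurable borel" by (intro borel_measurable_continuous_onI continuous_intros)
    then show ?thesis by measurable
  qed
  then have q': "(\<lambda>w. norm (poly q w) powr p) \<in> borel_measurable lebesgue" by (simp add: measurable_completion)
  have nu: "\<nu> = density lebesgue (\<lambda>x. ennreal (W x))" by (simp add: \<nu>_def jacobi_measure_def W_def)
  have "(LINT w|\<nu>. norm (poly q w) powr p) = enn2real (\<integral>\<^sup>+x. ennreal (norm (poly q x) powr p) \<partial>\<nu>)"
    by (rule integral_eq_nn_integral) (use q' in \<open>auto simp: nu\<close>)
  also have "(\<integral>\<^sup>+x. ennreal (norm (poly q x) powr p) \<partial>\<nu>) = (\<integral>\<^sup>+x. ennreal (W x) * ennreal (norm (poly q x) powr p) \<partial>lebesgue)"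
    unfolding nu using W_measurable q' by (intro nn_integral_density) auto
  also have "\<dots> = (\<integral>\<^sup>+x. ennreal (W x * cmod (poly q x) powr p) \<partial>lborel)"
    using W_nonneg by (simp add: nn_integral_completion ennreal_mult')
  finally show ?thesis .
qed

lemma W_zero_outside: "x \<notin> G \<Longrightarrow> W x = 0" by (simp add: W_def jacobi_weight_def)

text \<open>Since X^k lies in [0, 1] and p >= 1, its p-th power is at most X^k. One decay exponent k
  therefore serves every p.\<close>

lemma nn_integral_poly_upper:
  assumes bd: "\<And>w. w \<in> closure G \<Longrightarrow> cmod (poly q w) \<le> C * X w ^ k" and X: "\<And>w. 0 \<le> X w" "\<And>w. X w \<le> 1" and C: "0 \<le> C"
    and X_meas: "X \<in> borel_measurable borel"
    and int: "(\<integral>\<^sup>+x. ennreal (X x ^ k * P x) \<partial>lborel) \<le> ennreal I"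
  shows "(\<integral>\<^sup>+x. ennreal (W x * cmod (poly q x) powr p) \<partial>lborel) \<le> ennreal (Ch * C powr p) * ennreal I"
proof -
  have pt: "W x * cmod (poly q x) powr p \<le> Ch * C powr p * (X x ^ k * P x)" for x
  proof (cases "x \<in> G")
    case True
    then have xc: "x \<in> closure G" using closure_G by auto
    have Xk: "0 \<le> X x ^ k" "X x ^ k \<le> 1" using X by (auto intro: power_le_one)
    have "cmod (poly q x) powr p \<le> (C * X x ^ k) powr p" using bd[OF xc] p by (intro powr_mono2) auto
    also have "\<dots> = C powr p * (X x ^ k) powr p" using C Xk by (simp add: powr_mult)
    also have "\<dots> \<le> C powr p * X x ^ k"
    proof (intro mult_left_mono)
      show "(X x ^ k) powr p \<le> X x ^ k"
      proof (cases "X x ^ k = 0")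
        case True
        show ?thesis unfolding True by simp
      next
        case False
        then show ?thesis using powr_mono'[of 1 p "X x ^ k"] p Xk by simp
      qed
    qed auto
    finally have "W x * cmod (poly q x) powr p \<le> (Ch * P x) * (C powr p * X x ^ k)"
      using W_nonneg W_upper P_nonneg Ch by (intro mult_mono) auto
    then show ?thesis by (simp only: mult_ac)
  next
    case False
    then show ?thesis using P_nonneg Ch X by (simp add: W_zero_outside)
  qed
  have meas: "(\<lambda>x. ennreal (X x ^ k * P x)) \<in> borel_measurable lborel"
    using X_meas P_measurable by measurable
  have "(\<integral>\<^sup>+x. ennreal (W x * cmod (poly q x) powr p) \<partial>lborel) \<le> (\<integral>\<^sup>+x. ennreal (Ch * C powr p) * ennreal (X x ^ k * P x) \<partial>lborel)"
  proof (rule nn_integral_mono)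
    fix x
    have "ennreal (Ch * C powr p * (X x ^ k * P x)) = ennreal (Ch * C powr p) * ennreal (X x ^ k * P x)"
      using Ch by (intro ennreal_mult') auto
    then show "ennreal (W x * cmod (poly q x) powr p) \<le> ennreal (Ch * C powr p) * ennreal (X x ^ k * P x)"
      using ennreal_leI[OF pt[of x]] by simp
  qed
  also have "\<dots> = ennreal (Ch * C powr p) * (\<integral>\<^sup>+x. ennreal (X x ^ k * P x) \<partial>lborel)"
    by (rule nn_integral_cmult[OF meas])
  also have "\<dots> \<le> ennreal (Ch * C powr p) * ennreal I" by (intro mult_left_mono int) auto
  finally show ?thesis .
qed


definition lam :: "nat \<Rightarrow> complex \<Rightarrow> real" where "lam n z = christoffel \<nu> n p z"

lemma kernel_factor:
  assumes "0 < \<rho>" shows "0 \<le> \<rho> / (dist z x + \<rho>)" "\<rho> / (dist z x + \<rho>) \<le> 1"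
  using assms by (auto simp: divide_le_eq_1 add_nonneg_pos)

lemma kernel_measurable: fixes z :: complex shows "(\<lambda>x. \<rho> / (dist z x + \<rho>)) \<in> borel_measurable borel" by measurable

lemma D_pos: "0 < \<rho> \<Longrightarrow> 0 < D z \<rho>"
proof -
  assume "0 < \<rho>"
  then have "0 < norm (z - zs j) + \<rho>" for j by (rule add_nonneg_pos[OF norm_ge_zero])
  then have "norm (z - zs j) + \<rho> \<noteq> 0" for j by (metis less_irrefl)
  then show ?thesis unfolding D_def by (intro prod_pos) simp
qed

text \<open>The exponent k is dictated by the weight through
  \<open>singular_weight_integral\<close>; the localizing polynomial of degree at most n with this k
  is then the test polynomial.\<close>

lemma lam_upper: obtains C where "0 < C" "\<And>n z. n \<ge> 1 \<Longrightarrow> z \<in> L \<Longrightarrow> lam n z \<le> C * (rn n z)\<^sup>2 * D z (rn n z)"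
proof -
  obtain B where B: "B > 0" "\<And>n z. n \<ge> 1 \<Longrightarrow> z \<in> L \<Longrightarrow> rn n z \<le> B" by (fact rn_bounded)
  obtain C1 and k :: nat where C1: "0 < C1" "\<And>z \<rho>. 0 < \<rho> \<Longrightarrow> \<rho> \<le> B \<Longrightarrow>
      (\<integral>\<^sup>+x. ennreal ((\<rho> / (dist z x + \<rho>)) ^ k * (\<Prod>j=1..m. norm (x - zs j) powr \<alpha> j)) \<partial>lborel)
        \<le> ennreal (C1 * \<rho>\<^sup>2 * (\<Prod>j=1..m. (norm (z - zs j) + \<rho>) powr \<alpha> j))"
    by (fact singular_weight_integral[OF inj_zs alpha B(1)])
  obtain C2 where C2: "C2 \<ge> 1"
    "\<And>n z. n \<ge> 1 \<Longrightarrow> z \<in> L \<Longrightarrow> \<exists>q :: complex poly. degree q \<le> n \<and> poly q z = 1 \<and>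
       (\<forall>w\<in>closure G. cmod (poly q w) \<le> C2 * (rn n z / (dist z w + rn n z)) ^ k)"
    by (fact poly_localizing_degree)
  have "lam n z \<le> (Ch * C2 powr p * C1) * (rn n z)\<^sup>2 * D z (rn n z)" if n: "n \<ge> 1" and z: "z \<in> L" for n z
  proof -
    define \<rho> where "\<rho> = rn n z"
    have rp: "0 < \<rho>" "\<rho> \<le> B" using rn_pos[OF n z] B(2)[OF n z] by (auto simp: \<rho>_def)
    obtain q where q: "degree q \<le> n" "poly q z = 1"
       "\<And>w. w \<in> closure G \<Longrightarrow> cmod (poly q w) \<le> C2 * (\<rho> / (dist z w + \<rho>)) ^ k"
      using C2(2)[OF n z] unfolding \<rho>_def by blast
    have "lam n z \<le> (LINT w|\<nu>. norm (poly q w) powr p)"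
      unfolding lam_def christoffel_def
      by (rule cINF_lower) (use q in \<open>auto intro!: bdd_belowI[of _ 0] integral_nonneg_AE\<close>)
    also have "\<dots> = enn2real (\<integral>\<^sup>+x. ennreal (W x * cmod (poly q x) powr p) \<partial>lborel)" by (rule LINT_nu)
    also have "\<dots> \<le> Ch * C2 powr p * (C1 * \<rho>\<^sup>2 * D z \<rho>)"
    proof -
      have int: "(\<integral>\<^sup>+x. ennreal ((\<rho> / (dist z x + \<rho>)) ^ k * P x) \<partial>lborel) \<le> ennreal (C1 * \<rho>\<^sup>2 * D z \<rho>)"
        unfolding P_def D_def by (rule C1(2)[OF rp])
      have "(\<integral>\<^sup>+x. ennreal (W x * cmod (poly q x) powr p) \<partial>lborel) \<le> ennreal (Ch * C2 powr p) * ennreal (C1 * \<rho>\<^sup>2 * D z \<rho>)"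
        by (rule nn_integral_poly_upper[OF q(3) kernel_factor[OF rp(1)] _ kernel_measurable int]) (use C2 in auto)
      also have "\<dots> = ennreal (Ch * C2 powr p * (C1 * \<rho>\<^sup>2 * D z \<rho>))" using Ch by (intro ennreal_mult'[symmetric]) auto
      finally show ?thesis
        using Ch C1 D_pos[OF rp(1), of z] by (intro enn2real_leI) auto
    qed
    finally show ?thesis by (simp add: \<rho>_def mult_ac)
  qed
  note main = this
  have "0 < Ch * C2 powr p * C1" using Ch C1 C2 by simp
  then show thesis by (rule that[OF _ main])
qed

text \<open>\<open>enn2real\<close> sends infinity to 0, so a lower bound for the extended integral
  passes to \<open>LINT_nu\<close> only once the integral is known to be finite.\<close>

lemma nn_integral_poly_finite: "(\<integral>\<^sup>+x. ennreal (W x * cmod (poly q x) powr p) \<partial>lborel) < \<infinity>"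
proof -
  obtain B where B: "\<And>w. w \<in> closure G \<Longrightarrow> dist w0 w \<le> B"
    using bounded_closure[OF bounded_G] bounded_any_center[of "closure G" w0] by auto
  \<comment> \<open>On the closure of G the kernel b / (dist w0 w + b) is then at least 1/2, so a
    bounded polynomial satisfies the hypothesis of \<open>nn_integral_poly_upper\<close> with any
    exponent k.\<close>
  define b where "b = \<bar>B\<bar> + 1"
  have b: "0 < b" by (simp add: b_def)
  obtain C1 and k :: nat where C1: "0 < C1" "\<And>z \<rho>. 0 < \<rho> \<Longrightarrow> \<rho> \<le> b \<Longrightarrow>
      (\<integral>\<^sup>+x. ennreal ((\<rho> / (dist z x + \<rho>)) ^ k * (\<Prod>j=1..m. norm (x - zs j) powr \<alpha> j)) \<partial>lborel)
        \<le> ennreal (C1 * \<rho>\<^sup>2 * (\<Prod>j=1..m. (norm (z - zs j) + \<rho>) powr \<alpha> j))"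
    by (fact singular_weight_integral[OF inj_zs alpha b])
  have "compact (closure G)" using bounded_closure[OF bounded_G] by (simp add: compact_eq_bounded_closed)
  then have "bounded (poly q ` closure G)"
    by (intro compact_imp_bounded compact_continuous_image continuous_intros)
  then obtain Q where Q: "0 < Q" "\<And>w. w \<in> closure G \<Longrightarrow> cmod (poly q w) \<le> Q"
    unfolding bounded_pos by auto
  have up: "cmod (poly q w) \<le> Q * 2 ^ k * (b / (dist w0 w + b)) ^ k" if w: "w \<in> closure G" for w
  proof -
    have "1 \<le> 2 * (b / (dist w0 w + b))" using B[OF w] b by (simp add: b_def pos_le_divide_eq add_nonneg_pos)
    then have "1 \<le> (2 * (b / (dist w0 w + b))) ^ k" by (rule one_le_power)
    then have "Q * 1 \<le> Q * (2 * (b / (dist w0 w + b))) ^ k" using Q by (intro mult_left_mono) auto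
    also have "\<dots> = Q * 2 ^ k * (b / (dist w0 w + b)) ^ k" unfolding power_mult_distrib by simp
    finally show ?thesis using Q(2)[OF w] by simp
  qed
  have int: "(\<integral>\<^sup>+x. ennreal ((b / (dist w0 x + b)) ^ k * P x) \<partial>lborel) \<le> ennreal (C1 * b\<^sup>2 * D w0 b)"
    unfolding P_def D_def by (rule C1(2)[OF b order.refl])
  have "(\<integral>\<^sup>+x. ennreal (W x * cmod (poly q x) powr p) \<partial>lborel) \<le> ennreal (Ch * (Q * 2 ^ k) powr p) * ennreal (C1 * b\<^sup>2 * D w0 b)"
    by (rule nn_integral_poly_upper[OF up kernel_factor[OF b] _ kernel_measurable int]) (use Q in auto)
  also have "\<dots> < \<infinity>" by (simp add: ennreal_mult_less_top)
  finally show ?thesis .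
qed

text \<open>The maximum point \<zeta> may be far from z, where both \<rho> and the weight differ
  from their values at z. This is compensated: the product has modulus at least 1/2 near \<zeta>
  while the localizing factor is small there, so the admissible polynomial itself is at least a
  multiple of Y^k, with Y = (|z - \<zeta>| + \<rho>) / \<rho>.\<close>

lemma lam_lower: obtains c where "0 < c" "\<And>n z. n \<ge> 1 \<Longrightarrow> z \<in> L \<Longrightarrow> c * (rn n z)\<^sup>2 * D z (rn n z) \<le> lam n z"
proof -
  obtain Cr and kr :: nat where Cr: "Cr \<ge> 1"
    "\<And>n z z'. n \<ge> 1 \<Longrightarrow> z \<in> L \<Longrightarrow> z' \<in> L \<Longrightarrow> rn n z \<le> Cr * ((dist z z' + rn n z) / rn n z) ^ kr * rn n z'"
    by (fact rn_compare)
  define Aa where "Aa = (\<Sum>j=1..m. \<bar>\<alpha> j\<bar>)"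
  obtain ka :: nat where ka: "Aa \<le> real ka" using real_arch_simple by blast
  \<comment> \<open>(kr + 1) ka powers of Y pay for the weight, which changes by at most S^ka with S
    of order Y^(kr + 1); 2 kr powers pay for \<rho>^2 against the square of
    \<open>rn n \<zeta>\<close>.\<close>
  define k where "k = (kr + 1) * ka + 2 * kr"
  obtain C and M :: nat where M: "C \<ge> 1" "M \<ge> 1"
    "\<And>n z. n \<ge> 1 \<Longrightarrow> z \<in> L \<Longrightarrow> \<exists>q :: complex poly. degree q \<le> M * n \<and> poly q z = 1 \<and>
       (\<forall>w\<in>closure G. cmod (poly q w) \<le> C * (rn n z / (dist z w + rn n z)) ^ k)"
    by (fact poly_localizing)
  obtain \<tau> where t: "0 < \<tau>"
    "\<And>R n z. n \<ge> 1 \<Longrightarrow> degree R \<le> (M + 1) * n \<Longrightarrow> z \<in> L \<Longrightarrow> \<exists>\<zeta>\<in>L. \<exists>y. ball y (\<tau> * rn n \<zeta>) \<subseteq> G \<and>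
      (\<forall>x\<in>ball y (\<tau> * rn n \<zeta>). dist \<zeta> x \<le> rn n \<zeta> / 8 \<and> \<tau> * rn n \<zeta> \<le> infdist x L \<and> cmod (poly R z) / 2 \<le> cmod (poly R x))"
    by (fact large_on_interior_disc)
  \<comment> \<open>The 3 serves the comparison of |x - zs j| with |z - zs j| + \<rho> from above; 2
    Cr / \<tau> serves the converse, where \<rho> is estimated through \<open>rn n \<zeta>\<close>
    and the distance of x from L.\<close>
  define A where "A = 3 + 2 * Cr / \<tau>"
  have A: "3 \<le> A" using Cr t by (simp add: A_def)
  define c where "c = 1 / Ch * (1 / A ^ ka) * (1 / (2 * C) powr p) * (1 / 2 ^ k) * (pi * \<tau>\<^sup>2) / Cr\<^sup>2"
  have c: "0 < c" using Ch A M t Cr by (simp add: c_def)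
  have main: "c * (rn n z)\<^sup>2 * D z (rn n z) \<le> (LINT w|\<nu>. norm (poly q w) powr p)"
    if n: "n \<ge> 1" and z: "z \<in> L" and q: "degree q \<le> n" "poly q z = 1" for n z q
  proof -
    define \<rho> where "\<rho> = rn n z"
    have rp: "0 < \<rho>" using rn_pos[OF n z] by (simp add: \<rho>_def)
    obtain Q where Q: "degree Q \<le> M * n" "poly Q z = 1"
      "\<And>w. w \<in> closure G \<Longrightarrow> cmod (poly Q w) \<le> C * (\<rho> / (dist z w + \<rho>)) ^ k"
      using M(3)[OF n z] unfolding \<rho>_def by blast
    have "degree (q * Q) \<le> (M + 1) * n" using degree_mult_le[of q Q] q(1) Q(1) by simp
    from t(2)[OF n this z] obtain \<zeta> y where \<zeta>: "\<zeta> \<in> L" "ball y (\<tau> * rn n \<zeta>) \<subseteq> G"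
      "\<And>x. x \<in> ball y (\<tau> * rn n \<zeta>) \<Longrightarrow> dist \<zeta> x \<le> rn n \<zeta> / 8"
      "\<And>x. x \<in> ball y (\<tau> * rn n \<zeta>) \<Longrightarrow> \<tau> * rn n \<zeta> \<le> infdist x L"
      "\<And>x. x \<in> ball y (\<tau> * rn n \<zeta>) \<Longrightarrow> cmod (poly (q * Q) z) / 2 \<le> cmod (poly (q * Q) x)" by blast
    define \<rho>' where "\<rho>' = rn n \<zeta>"
    have rp': "0 < \<rho>'" using rn_pos[OF n \<zeta>(1)] by (simp add: \<rho>'_def)
    define Y where "Y = (dist z \<zeta> + \<rho>) / \<rho>"
    have Y: "1 \<le> Y" "Y * \<rho> = dist z \<zeta> + \<rho>" using rp by (auto simp: Y_def)
    have lip: "\<rho>' \<le> Y * \<rho>" using rn_lipschitz[of n \<zeta> z] Y(2) by (simp add: \<rho>_def \<rho>'_def dist_commute)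
    have cmp: "\<rho> \<le> Cr * Y ^ kr * \<rho>'" using Cr(2)[OF n z \<zeta>(1)] by (simp add: \<rho>_def \<rho>'_def Y_def)
    define S where "S = A * Y ^ (kr + 1)"
    have Yk: "Y \<le> Y ^ (kr + 1)" using power_increasing[of 1 "kr + 1" Y] Y by simp
    have S: "3 * Y \<le> S" "1 \<le> S"
    proof -
      show "3 * Y \<le> S" unfolding S_def using A Y Yk by (intro mult_mono) auto
      then show "1 \<le> S" using Y by linarith
    qed
    define Z where "Z = ball y (\<tau> * \<rho>')"
    have tr: "0 < \<tau> * \<rho>'" using t rp' by simp
    \<comment> \<open>A lower bound for the integrand on the disc Z. Its factors come from h0, from
      the weight moved from z to x, and from the p-th power of the modulus of q.\<close>
    define c0 where "c0 = 1 / Ch * (D z \<rho> / S ^ ka) * (1 / (2 * C) powr p * (Y / 2) ^ k)"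
    have c00: "0 \<le> c0" using Ch D_pos[OF rp, of z] S Y by (simp add: c0_def)
    have pt: "c0 \<le> W x * cmod (poly q x) powr p" if x: "x \<in> Z" for x
    proof -
      have x': "x \<in> ball y (\<tau> * rn n \<zeta>)" using x by (simp add: Z_def \<rho>'_def)
      have xG: "x \<in> G" using \<zeta>(2) x' by blast
      have xc: "x \<in> closure G" using xG closure_G by auto
      have dx: "dist \<zeta> x \<le> \<rho>' / 8" using \<zeta>(3)[OF x'] by (simp add: \<rho>'_def)
      define X where "X = \<rho> / (dist z x + \<rho>)"
      have X: "0 < X" "X \<le> 1" using rp kernel_factor[OF rp, of z x] by (auto simp: X_def add_nonneg_pos)
      \<comment> \<open>x is within \<rho>' / 8 of \<zeta>, and \<rho>' is at most |z - \<zeta>| +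
        \<rho>; so the numerator of Y exceeds |z - x| + \<rho> by at most a factor 2.\<close>
      have YX: "Y / 2 \<le> 1 / X"
      proof -
        have "dist z \<zeta> \<le> dist z x + \<rho>' / 8" using dx dist_triangle2[of z \<zeta> x] by simp
        moreover have "\<rho>' \<le> dist z \<zeta> + \<rho>" using lip Y(2) by simp
        ultimately have "Y * \<rho> \<le> 2 * (dist z x + \<rho>)" unfolding Y(2) using rp zero_le_dist[of z x] by argo
        then show ?thesis using rp by (simp add: X_def pos_le_divide_eq)
      qed
      have qx: "(1 / (2 * C) * (1 / X) ^ k) powr p \<le> cmod (poly q x) powr p"
      proof -
        have "1 / 2 \<le> cmod (poly q x) * cmod (poly Q x)"
          using \<zeta>(5)[OF x'] q Q by (simp add: norm_mult)
        also have "\<dots> \<le> cmod (poly q x) * (C * X ^ k)" using Q(3)[OF xc] by (intro mult_left_mono) (auto simp: X_def)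
        finally have "1 / 2 / (C * X ^ k) \<le> cmod (poly q x)" using M X by (simp add: pos_divide_le_eq)
        then have "1 / (2 * C) * (1 / X) ^ k \<le> cmod (poly q x)" by (simp add: power_divide)
        then show ?thesis using M X p by (intro powr_mono2) auto
      qed
      \<comment> \<open>Since 1 / X >= 1 and p >= 1, raising (1 / X)^k to the power p only helps, so
        k needs no adjustment to p.\<close>
      have "1 / (2 * C) powr p * (Y / 2) ^ k \<le> 1 / (2 * C) powr p * ((1 / X) ^ k) powr p"
      proof (intro mult_left_mono)
        have "(Y / 2) ^ k \<le> (1 / X) ^ k" using YX Y by (intro power_mono) auto
        also have "\<dots> = ((1 / X) ^ k) powr 1" using X by simp
        also have "\<dots> \<le> ((1 / X) ^ k) powr p" using X p by (intro powr_mono one_le_power) auto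
        finally show "(Y / 2) ^ k \<le> ((1 / X) ^ k) powr p" .
      qed auto
      also have "\<dots> = (1 / (2 * C) * (1 / X) ^ k) powr p" using M X by (simp add: powr_mult powr_divide)
      finally have low: "1 / (2 * C) powr p * (Y / 2) ^ k \<le> cmod (poly q x) powr p" using qx by linarith
      have fac: "(norm (z - zs j) + \<rho>) powr \<alpha> j \<le> S powr \<bar>\<alpha> j\<bar> * norm (x - zs j) powr \<alpha> j" if j: "j \<in> {1..m}" for j
      proof (rule powr_comparable_lower)
        have inf: "\<tau> * \<rho>' \<le> norm (x - zs j)"
          using \<zeta>(4)[OF x'] infdist_le[OF zs[OF j], of x] by (simp add: \<rho>'_def dist_norm)
        show a: "0 < norm (z - zs j) + \<rho>" using rp by (simp add: add_nonneg_pos)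
        show b: "0 < norm (x - zs j)" using inf tr by linarith
        show "0 < S" using S by linarith
        have zx: "dist z x \<le> 2 * (Y * \<rho>)"
          using dist_triangle[of z x \<zeta>] dx lip Y(2) rp rp' zero_le_dist[of z \<zeta>] by linarith
        have "norm (x - zs j) \<le> norm (z - zs j) + dist z x"
          using dist_triangle[of x "zs j" z] by (simp add: dist_norm norm_minus_commute)
        also have "\<dots> \<le> norm (z - zs j) + 2 * (Y * \<rho>)" using zx by simp
        also have "\<dots> \<le> 3 * Y * (norm (z - zs j) + \<rho>)"
        proof -
          have "1 * norm (z - zs j) \<le> (3 * Y) * norm (z - zs j)" using Y by (intro mult_right_mono) auto
          moreover have "0 \<le> Y * \<rho>" using Y rp by simp
          ultimately show ?thesis by (simp add: algebra_simps)
        qed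
        also have "\<dots> \<le> S * (norm (z - zs j) + \<rho>)" using S a by (intro mult_right_mono) auto
        finally show "norm (x - zs j) \<le> S * (norm (z - zs j) + \<rho>)" .
        have "norm (z - zs j) + \<rho> \<le> norm (x - zs j) + dist z x + \<rho>"
          using dist_triangle[of z "zs j" x] by (simp add: dist_norm)
        moreover have "dist z x + \<rho> \<le> 2 * (Y * \<rho>)"
          using dist_triangle[of z x \<zeta>] dx lip Y(2) rp rp' zero_le_dist[of z \<zeta>] by linarith
        ultimately have "norm (z - zs j) + \<rho> \<le> norm (x - zs j) + 2 * (Y * \<rho>)" by linarith
        also have "2 * (Y * \<rho>) \<le> 2 * (Y * (Cr * Y ^ kr * (norm (x - zs j) / \<tau>)))"
        proof -
          have "\<rho>' \<le> norm (x - zs j) / \<tau>" using inf t(1) by (simp add: pos_le_divide_eq mult.commute)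
          then have "Cr * Y ^ kr * \<rho>' \<le> Cr * Y ^ kr * (norm (x - zs j) / \<tau>)" using Cr(1) Y by (intro mult_left_mono) auto
          then have "\<rho> \<le> Cr * Y ^ kr * (norm (x - zs j) / \<tau>)" using cmp by linarith
          then show ?thesis using Y by (intro mult_left_mono) auto
        qed
        also have "norm (x - zs j) + 2 * (Y * (Cr * Y ^ kr * (norm (x - zs j) / \<tau>))) = (1 + 2 * Cr / \<tau> * Y ^ (kr + 1)) * norm (x - zs j)"
          by (simp add: algebra_simps)
        also have "\<dots> \<le> S * norm (x - zs j)"
        proof (intro mult_right_mono)
          have "1 \<le> 3 * Y ^ (kr + 1)" using Y Yk by linarith
          then show "1 + 2 * Cr / \<tau> * Y ^ (kr + 1) \<le> S" unfolding S_def A_def by (simp only: distrib_right add_right_mono)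
        qed auto
        finally show "norm (z - zs j) + \<rho> \<le> S * norm (x - zs j)" by simp
      qed
      have "D z \<rho> \<le> (\<Prod>j=1..m. S powr \<bar>\<alpha> j\<bar> * norm (x - zs j) powr \<alpha> j)"
        unfolding D_def using fac by (intro prod_mono) auto
      also have "\<dots> = S powr Aa * P x" using S by (simp add: prod.distrib P_def Aa_def powr_sum)
      also have "\<dots> \<le> S ^ ka * P x"
      proof (intro mult_right_mono P_nonneg)
        have "S powr Aa \<le> S powr real ka" using S ka by (intro powr_mono) auto
        then show "S powr Aa \<le> S ^ ka" using S by (simp add: powr_realpow)
      qed
      finally have "D z \<rho> / S ^ ka \<le> P x" using S by (simp add: pos_divide_le_eq mult.commute)
      then have "1 / Ch * (D z \<rho> / S ^ ka) \<le> 1 / Ch * P x" using Ch by (intro mult_left_mono) auto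
      also have "\<dots> \<le> W x" using W_lower[OF xG] by simp
      finally have "1 / Ch * (D z \<rho> / S ^ ka) \<le> W x" .
      then show ?thesis unfolding c0_def using low W_nonneg Y by (intro mult_mono) auto
    qed
    have "ennreal (c0 * (pi * (\<tau> * \<rho>')\<^sup>2)) = (\<integral>\<^sup>+x. ennreal c0 * indicator Z x \<partial>lborel)"
    proof -
      have "emeasure lborel Z = ennreal (pi * (\<tau> * \<rho>')\<^sup>2)"
        unfolding Z_def using emeasure_ball[of "\<tau> * \<rho>'" y] tr by (simp add: unit_ball_vol_2)
      moreover have "Z \<in> sets lborel" by (simp add: Z_def)
      ultimately show ?thesis using c00 by (simp add: nn_integral_cmult_indicator ennreal_mult')
    qed
    also have "\<dots> \<le> (\<integral>\<^sup>+x. ennreal (W x * cmod (poly q x) powr p) \<partial>lborel)"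
    proof (rule nn_integral_mono)
      fix x
      show "ennreal c0 * indicator Z x \<le> ennreal (W x * cmod (poly q x) powr p)"
        using pt[of x] by (cases "x \<in> Z") (auto intro: ennreal_leI)
    qed
    finally have int: "ennreal (c0 * (pi * (\<tau> * \<rho>')\<^sup>2)) \<le> (\<integral>\<^sup>+x. ennreal (W x * cmod (poly q x) powr p) \<partial>lborel)" .
    have "c * \<rho>\<^sup>2 * D z \<rho> \<le> c0 * (pi * (\<tau> * \<rho>')\<^sup>2)"
    proof -
      have "\<rho>\<^sup>2 \<le> (Cr * Y ^ kr * \<rho>')\<^sup>2" using cmp rp by (intro power_mono) auto
      then have "c * \<rho>\<^sup>2 * D z \<rho> \<le> c * (Cr * Y ^ kr * \<rho>')\<^sup>2 * D z \<rho>"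
        using c D_pos[OF rp, of z] by (intro mult_right_mono mult_left_mono) auto
      also have "\<dots> = c0 * (pi * (\<tau> * \<rho>')\<^sup>2)"
      proof -
        have Y0: "Y \<noteq> 0" "Cr \<noteq> 0" using Y Cr by auto
        have "Y ^ k = (Y ^ (kr + 1)) ^ ka * (Y ^ kr)\<^sup>2"
          unfolding k_def power_mult[symmetric] power_add[symmetric] by (simp add: mult.commute)
        then have YS: "(Y / 2) ^ k / S ^ ka = (1 / 2 ^ k) * (Y ^ kr)\<^sup>2 * (1 / A ^ ka)"
          using Y0 by (simp add: S_def power_mult_distrib power_divide)
        have "c0 = 1 / Ch * D z \<rho> * (1 / (2 * C) powr p) * ((Y / 2) ^ k / S ^ ka)"
          by (simp add: c0_def)
        then have "c0 * (pi * (\<tau> * \<rho>')\<^sup>2) = 1 / Ch * D z \<rho> * (1 / (2 * C) powr p) * ((1 / 2 ^ k) * (Y ^ kr)\<^sup>2 * (1 / A ^ ka)) * (pi * (\<tau> * \<rho>')\<^sup>2)"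
          unfolding YS by (simp only:)
        also have "\<dots> = c * (Cr * Y ^ kr * \<rho>')\<^sup>2 * D z \<rho>"
          using Y0 by (simp add: c_def power_mult_distrib mult_ac)
        finally show ?thesis by simp
      qed
      finally show ?thesis .
    qed
    also have "\<dots> \<le> (LINT w|\<nu>. norm (poly q w) powr p)"
    proof -
      have "enn2real (ennreal (c0 * (pi * (\<tau> * \<rho>')\<^sup>2))) \<le> enn2real (\<integral>\<^sup>+x. ennreal (W x * cmod (poly q x) powr p) \<partial>lborel)"
        by (rule enn2real_mono[OF int]) (use nn_integral_poly_finite in auto)
      then show ?thesis unfolding LINT_nu using c00 by simp
    qed
    finally show ?thesis by (simp add: \<rho>_def)
  qed
  have "c * (rn n z)\<^sup>2 * D z (rn n z) \<le> lam n z" if "n \<ge> 1" "z \<in> L" for n z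
    unfolding lam_def christoffel_def
  proof (rule cINF_greatest)
    have "1 \<in> {q :: complex poly. degree q \<le> n \<and> poly q z = 1}" by simp
    then show "{q :: complex poly. degree q \<le> n \<and> poly q z = 1} \<noteq> {}" by blast
  qed (use main[OF that] in auto)
  then show thesis by (rule that[OF c])
qed

end

section \<open>Instantiation of the locales and the theorem\<close>

lemma quasidisk_locale:
  assumes "bounded_quasidisk G"
  obtains C where "quasidisk_domain G C"
proof -
  obtain C where C: "C \<ge> 1" "\<forall>\<zeta>1\<in>frontier G. \<forall>\<zeta>2\<in>frontier G. \<zeta>1 \<noteq> \<zeta>2 \<longrightarrow>
        (\<exists>L' L''. L' \<noteq> L'' \<and> components (frontier G - {\<zeta>1, \<zeta>2}) = {L', L''} \<and>
           min (diameter L') (diameter L'') \<le> C * norm (\<zeta>1 - \<zeta>2))"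
    using assms unfolding bounded_quasidisk_def quasiconformal_curve_def by blast
  have "quasidisk_domain G C"
    by unfold_locales (use assms C in \<open>auto simp: bounded_quasidisk_def\<close>)
  then show thesis by (rule that)
qed

lemma chart_locale:
  assumes "bounded_jordan_domain G" "exterior_riemann_map G \<Phi>"
  obtains w0 \<phi> where "exterior_chart G \<Phi> w0 \<phi>"
proof -
  interpret exterior_map G \<Phi> by unfold_locales (use assms in auto)
  obtain w0 \<phi> where c: "w0 \<in> G" "\<phi> holomorphic_on ball 0 1" "inj_on \<phi> (ball 0 1)" "\<phi> 0 = 0" "deriv \<phi> 0 \<noteq> 0"
     "\<forall>s\<in>ball 0 1. s \<noteq> 0 \<longrightarrow> w0 + 1 / \<phi> s \<in> Ext \<and> \<Phi> (w0 + 1 / \<phi> s) = 1 / s"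
     "\<forall>x\<in>Ext. w0 + 1 / \<phi> (1 / \<Phi> x) = x"
    using exterior_chart by blast
  have "exterior_chart G \<Phi> w0 \<phi>"
    by unfold_locales (use c in blast)+
  then show thesis by (rule that)
qed

theorem theorem1:
  fixes G :: "complex set" and m :: nat and zs :: "nat \<Rightarrow> complex" and \<alpha> :: "nat \<Rightarrow> real"
    and h\<^sub>0 :: "complex \<Rightarrow> real" and C\<^sub>h p :: real and \<Phi> :: "complex \<Rightarrow> complex"
  assumes "bounded_quasidisk G"
    and "\<And>j. j \<in> {1..m} \<Longrightarrow> zs j \<in> frontier G"
    and "inj_on zs {1..m}"
    and "\<And>j. j \<in> {1..m} \<Longrightarrow> \<alpha> j > -2"
    and "h\<^sub>0 \<in> borel_measurable (lebesgue_on G)"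
    and "C\<^sub>h \<ge> 1"
    and "\<And>z. z \<in> G \<Longrightarrow> inverse C\<^sub>h \<le> h\<^sub>0 z \<and> h\<^sub>0 z \<le> C\<^sub>h"
    and "p \<ge> 1"
    and "exterior_riemann_map G \<Phi>"
  shows "\<exists>C::real. C \<ge> 1 \<and>
    (\<forall>n::nat. n \<ge> 1 \<longrightarrow> (\<forall>z \<in> frontier G.
       let \<rho> = rho G \<Phi> (1 / real n) z;
           Q = christoffel (jacobi_measure G h\<^sub>0 m zs \<alpha>) n p z * \<rho> powi (-2)
                 * (\<Prod>j=1..m. (norm (z - zs j) + \<rho>) powr (- \<alpha> j))
       in inverse C \<le> Q \<and> Q \<le> C))"
proof -
  obtain Cq where q: "quasidisk_domain G Cq" using quasidisk_locale[OF assms(1)] .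
  obtain w0 \<phi> where c: "exterior_chart G \<Phi> w0 \<phi>"
    using chart_locale[OF _ assms(9)] assms(1) unfolding bounded_quasidisk_def by blast
  have "jacobi G \<Phi> w0 \<phi> Cq h\<^sub>0 m zs \<alpha> C\<^sub>h p"
    by (intro jacobi.intro quasidisk_chart.intro q c jacobi_axioms.intro) (use assms in auto)
  then interpret jacobi G \<Phi> w0 \<phi> Cq h\<^sub>0 m zs \<alpha> C\<^sub>h p .
  obtain C1 where C1: "0 < C1" "\<And>n z. n \<ge> 1 \<Longrightarrow> z \<in> L \<Longrightarrow> lam n z \<le> C1 * (rn n z)\<^sup>2 * D z (rn n z)" using lam_upper by blast
  obtain c1 where c1: "0 < c1" "\<And>n z. n \<ge> 1 \<Longrightarrow> z \<in> L \<Longrightarrow> c1 * (rn n z)\<^sup>2 * D z (rn n z) \<le> lam n z" using lam_lower by blast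
  define C where "C = Max {1, C1, 1 / c1}"
  have C: "1 \<le> C" "C1 \<le> C" "1 / c1 \<le> C" unfolding C_def by (rule Max_ge; simp)+
  have iC: "inverse C \<le> c1"
    using C(1,3) c1(1) by (simp add: inverse_eq_divide divide_le_eq mult.commute)
  show ?thesis
  proof (intro exI[of _ C] conjI allI impI ballI)
    show "1 \<le> C" by fact
    fix n :: nat and z assume n: "1 \<le> n" and z: "z \<in> L"
    define \<rho> where "\<rho> = rho G \<Phi> (1 / real n) z"
    have rn: "rn n z = \<rho>" by (simp add: rn_def \<rho>_def)
    have rp: "0 < \<rho>" using rn_pos[OF n z] rn by simp
    define l where "l = christoffel (jacobi_measure G h\<^sub>0 m zs \<alpha>) n p z"
    have l: "lam n z = l" by (simp add: lam_def \<nu>_def l_def)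
    have Dp: "0 < D z \<rho>" by (rule D_pos[OF rp])
    have Dm: "(\<Prod>j=1..m. (norm (z - zs j) + \<rho>) powr (- \<alpha> j)) = 1 / D z \<rho>"
      by (simp add: D_def powr_minus prod_dividef inverse_eq_divide)
    define E where "E = \<rho>\<^sup>2 * D z \<rho>"
    have E: "0 < E" using rp Dp by (simp add: E_def)
    have Q: "l * \<rho> powi (-2) * (\<Prod>j=1..m. (norm (z - zs j) + \<rho>) powr (- \<alpha> j)) = l / E"
      unfolding Dm by (simp add: E_def power_int_minus divide_inverse)
    have "l \<le> C1 * E" "c1 * E \<le> l" using C1(2)[OF n z] c1(2)[OF n z] by (simp_all add: rn l E_def mult.assoc)
    then have "c1 \<le> l / E" "l / E \<le> C1" using E by (simp_all add: pos_le_divide_eq pos_divide_le_eq)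
    then show "let \<rho> = rho G \<Phi> (1 / real n) z;
           Q = christoffel (jacobi_measure G h\<^sub>0 m zs \<alpha>) n p z * \<rho> powi (-2)
                 * (\<Prod>j=1..m. (norm (z - zs j) + \<rho>) powr (- \<alpha> j))
       in inverse C \<le> Q \<and> Q \<le> C"
      unfolding Let_def \<rho>_def[symmetric] l_def[symmetric] Q using iC C(2) by linarith
  qed
qed

end
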